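(* Let $\mathcal{C}$ be a triangulated category and let $(\mathcal{X},\mathcal{Y})$ be any torsion pair in $\mathcal{C}$, with heart $\underline{\mathcal{H}}$ (an abelian category). Then the additive functor $H\colon\mathcal{C}\to\underline{\mathcal{H}}$ associated with $(\mathcal{X},\mathcal{Y})$, given by $H=\tau^+\tau^-\circ\underline{(\ )}\cong\tau^-\tau^+\circ\underline{(\ )}$, is cohomological; that is, for any distinguished triangle $A\overset{f}{\longrightarrow}B\overset{g}{\longrightarrow}C\longrightarrow A[1]$ in $\mathcal{C}$, the sequence $H(A)\overset{H(f)}{\longrightarrow}H(B)\overset{H(g)}{\longrightarrow}H(C)$ is exact in $\underline{\mathcal{H}}$.
   Context: Torsion pair: a pair $(\mathcal{X},\mathcal{Y})$ of full additive thick subcategories of $\mathcal{C}$ (thick here means closed under isomorphisms and direct summands; closure under shifts is not required) such that (i) $\mathcal{C}(X,Y)=0$ for all $X\in\mathcal{X}$, $Y\in\mathcal{Y}$, where $\mathcal{C}(-,-)$ denotes the set of morphisms in $\mathcal{C}$; (ii) for every $C\in\mathcal{C}$ there is a distinguished triangle $X\to C\to Y\to X[1]$ with $X\in\mathcal{X}$, $Y\in\mathcal{Y}$. Then $C\in\mathcal{X}$ iff $\mathcal{C}(C,\mathcal{Y})=0$, and $C\in\mathcal{Y}$ iff $\mathcal{C}(\mathcal{X},C)=0$. Put $\mathcal{W}=\mathcal{X}[1]\cap\mathcal{Y}$. Let $\mathcal{C}^+$ be the full subcategory of those $C$ for which there is a distinguished triangle $Y\to W\to C\to Y[1]$ with $Y\in\mathcal{Y}$,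 $W\in\mathcal{W}$; let $\mathcal{C}^-$ be the full subcategory of those $C$ for which there is a distinguished triangle $X\to C\to W\to X[1]$ with $X\in\mathcal{X}$, $W\in\mathcal{W}$. Put $\mathcal{H}=\mathcal{C}^+\cap\mathcal{C}^-$. Let $\underline{\mathcal{C}}=\mathcal{C}/\mathcal{W}$ be the additive quotient (same objects; morphisms modulo those factoring through an object of $\mathcal{W}$), with quotient functor $\underline{(\ )}\colon\mathcal{C}\to\underline{\mathcal{C}}$. All of $\mathcal{C}^+,\mathcal{C}^-,\mathcal{H}$ contain $\mathcal{W}$, and $\underline{\mathcal{C}}^+,\underline{\mathcal{C}}^-,\underline{\mathcal{H}}$ denote their images, i.e. $\mathcal{C}^+/\mathcal{W}$, $\mathcal{C}^-/\mathcal{W}$, $\mathcal{H}/\mathcal{W}$, as full subcategories of $\underline{\mathcal{C}}$. $\underline{\mathcal{H}}$ is called the heart of $(\mathcal{X},\mathcal{Y})$; it is known to be an abelian category. It is known that the inclusion $i_+\colon\underline{\mathcal{C}}^+\hookrightarrow\underline{\mathcal{C}}$ has an additive left adjoint $\tau^+\colon\underline{\mathcal{C}}\to\underline{\mathcal{C}}^+$, and the inclusion $i_-\colon\underline{\mathcal{C}}^-\hookrightarrow\underline{\mathcal{C}}$ has an additive right adjoint $\tau^-\colon\underline{\mathcal{C}}\to\underline{\mathcal{C}}^-$. The composites $\tau^+\tau^-=i_+\tau^+i_-\tau^-$ and $\tau^-\tau^+=i_-\tau^-i_+\tau^+$ are naturally isomorphic endofunctors of $\underline{\mathcal{C}}$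 and factor through $\underline{\mathcal{H}}$; $H\colon\mathcal{C}\to\underline{\mathcal{H}}$ denotes either one precomposed with the quotient functor, e.g. $H(C)=\tau^+(\tau^-(C))$. *)

theory Defs
  imports "HOL-Algebra.Group"
begin

section \<open>Additive and abelian categories\<close>

text \<open>
  A category is given by a set of objects and a set of morphisms with domain and codomain (so
  Hom-sets are pairwise disjoint). \<open>g \<cdot>\<^bsub>C\<^esub> f\<close> is \<open>g\<close> after \<open>f\<close>. Values of the operations
  outside the carriers and on non-composable or non-parallel morphisms are irrelevant.
\<close>

record ('o, 'm) addcat =
  Obj  :: "'o set"
  Arr  :: "'m set"
  Dom  :: "'m \<Rightarrow> 'o"
  Cod  :: "'m \<Rightarrow> 'o"
  Idn  :: "'o \<Rightarrow> 'm"
  Cmp  :: "'m \<Rightarrow> 'm \<Rightarrow> 'm"  (infixl "\<cdot>\<index>" 70)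
  Add  :: "'m \<Rightarrow> 'm \<Rightarrow> 'm"
  Zero :: "'o \<Rightarrow> 'o \<Rightarrow> 'm"

definition Hom :: "('o, 'm, 'x) addcat_scheme \<Rightarrow> 'o \<Rightarrow> 'o \<Rightarrow> 'm set" where
  "Hom C A B = {f \<in> Arr C. Dom C f = A \<and> Cod C f = B}"

definition Hom_group :: "('o, 'm, 'x) addcat_scheme \<Rightarrow> 'o \<Rightarrow> 'o \<Rightarrow> 'm monoid" where
  "Hom_group C A B = \<lparr>carrier = Hom C A B, mult = Add C, one = Zero C A B\<rparr>"

definition Neg :: "('o, 'm, 'x) addcat_scheme \<Rightarrow> 'm \<Rightarrow> 'm" where
  "Neg C f = inv\<^bsub>Hom_group C (Dom C f) (Cod C f)\<^esub> f"

locale category =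
  fixes C :: "('o, 'm, 'x) addcat_scheme" (structure)
  assumes Dom_in_Obj: "f \<in> Arr C \<Longrightarrow> Dom C f \<in> Obj C"
    and Cod_in_Obj: "f \<in> Arr C \<Longrightarrow> Cod C f \<in> Obj C"
    and Idn_in_Hom: "A \<in> Obj C \<Longrightarrow> Idn C A \<in> Hom C A A"
    and Cmp_in_Hom: "\<lbrakk>f \<in> Hom C A B; g \<in> Hom C B D\<rbrakk> \<Longrightarrow> g \<cdot> f \<in> Hom C A D"
    and Idn_right: "f \<in> Hom C A B \<Longrightarrow> f \<cdot> Idn C A = f"
    and Idn_left: "f \<in> Hom C A B \<Longrightarrow> Idn C B \<cdot> f = f"
    and Cmp_assoc: "\<lbrakk>f \<in> Hom C A B; g \<in> Hom C B D; h \<in> Hom C D E\<rbrakk>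
      \<Longrightarrow> h \<cdot> (g \<cdot> f) = (h \<cdot> g) \<cdot> f"

locale preadditive_category = category +
  assumes Hom_comm_group: "\<lbrakk>A \<in> Obj C; B \<in> Obj C\<rbrakk> \<Longrightarrow> comm_group (Hom_group C A B)"
    and Cmp_Add_left: "\<lbrakk>f \<in> Hom C A B; g \<in> Hom C B D; g' \<in> Hom C B D\<rbrakk>
      \<Longrightarrow> Add C g g' \<cdot> f = Add C (g \<cdot> f) (g' \<cdot> f)"
    and Cmp_Add_right: "\<lbrakk>f \<in> Hom C A B; f' \<in> Hom C A B; g \<in> Hom C B D\<rbrakk>
      \<Longrightarrow> g \<cdot> Add C f f' = Add C (g \<cdot> f) (g \<cdot> f')"

definition zero_object :: "('o, 'm, 'x) addcat_scheme \<Rightarrow> 'o \<Rightarrow> bool" where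
  "zero_object C Z \<longleftrightarrow> Z \<in> Obj C \<and>
     (\<forall>A\<in>Obj C. (\<exists>!f. f \<in> Hom C Z A) \<and> (\<exists>!f. f \<in> Hom C A Z))"

definition biproduct :: "('o, 'm, 'x) addcat_scheme \<Rightarrow> 'o \<Rightarrow> 'o \<Rightarrow> 'o \<Rightarrow> bool" where
  "biproduct C P A B \<longleftrightarrow> P \<in> Obj C \<and> A \<in> Obj C \<and> B \<in> Obj C \<and>
     (\<exists>i\<in>Hom C A P. \<exists>j\<in>Hom C B P. \<exists>p\<in>Hom C P A. \<exists>q\<in>Hom C P B.
        p \<cdot>\<^bsub>C\<^esub> i = Idn C A \<and> q \<cdot>\<^bsub>C\<^esub> j = Idn C B \<and>
        q \<cdot>\<^bsub>C\<^esub> i = Zero C A B \<and> p \<cdot>\<^bsub>C\<^esub> j = Zero C B A \<and>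
        Add C (i \<cdot>\<^bsub>C\<^esub> p) (j \<cdot>\<^bsub>C\<^esub> q) = Idn C P)"

locale additive_category = preadditive_category +
  assumes ex_zero_object: "\<exists>Z. zero_object C Z"
    and ex_biproduct: "\<lbrakk>A \<in> Obj C; B \<in> Obj C\<rbrakk> \<Longrightarrow> \<exists>P. biproduct C P A B"

definition is_iso :: "('o, 'm, 'x) addcat_scheme \<Rightarrow> 'm \<Rightarrow> bool" where
  "is_iso C f \<longleftrightarrow> f \<in> Arr C \<and> (\<exists>g\<in>Hom C (Cod C f) (Dom C f).
     g \<cdot>\<^bsub>C\<^esub> f = Idn C (Dom C f) \<and> f \<cdot>\<^bsub>C\<^esub> g = Idn C (Cod C f))"

definition isomorphic :: "('o, 'm, 'x) addcat_scheme \<Rightarrow> 'o \<Rightarrow> 'o \<Rightarrow> bool" where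
  "isomorphic C A B \<longleftrightarrow> (\<exists>f\<in>Hom C A B. is_iso C f)"

definition is_mono :: "('o, 'm, 'x) addcat_scheme \<Rightarrow> 'm \<Rightarrow> bool" where
  "is_mono C f \<longleftrightarrow> f \<in> Arr C \<and> (\<forall>A\<in>Obj C. \<forall>u\<in>Hom C A (Dom C f). \<forall>v\<in>Hom C A (Dom C f).
     f \<cdot>\<^bsub>C\<^esub> u = f \<cdot>\<^bsub>C\<^esub> v \<longrightarrow> u = v)"

definition is_epi :: "('o, 'm, 'x) addcat_scheme \<Rightarrow> 'm \<Rightarrow> bool" where
  "is_epi C f \<longleftrightarrow> f \<in> Arr C \<and> (\<forall>A\<in>Obj C. \<forall>u\<in>Hom C (Cod C f) A. \<forall>v\<in>Hom C (Cod C f) A.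
     u \<cdot>\<^bsub>C\<^esub> f = v \<cdot>\<^bsub>C\<^esub> f \<longrightarrow> u = v)"

text \<open>\<open>is_kernel C f k\<close>: the morphism \<open>k\<close> is a kernel of \<open>f\<close>; dually for cokernels.\<close>

definition is_kernel :: "('o, 'm, 'x) addcat_scheme \<Rightarrow> 'm \<Rightarrow> 'm \<Rightarrow> bool" where
  "is_kernel C f k \<longleftrightarrow> f \<in> Arr C \<and> k \<in> Arr C \<and> Cod C k = Dom C f \<and>
     f \<cdot>\<^bsub>C\<^esub> k = Zero C (Dom C k) (Cod C f) \<and>
     (\<forall>A\<in>Obj C. \<forall>t\<in>Hom C A (Dom C f). f \<cdot>\<^bsub>C\<^esub> t = Zero C A (Cod C f) \<longrightarrow>
        (\<exists>!u. u \<in> Hom C A (Dom C k) \<and> k \<cdot>\<^bsub>C\<^esub> u = t))"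

definition is_cokernel :: "('o, 'm, 'x) addcat_scheme \<Rightarrow> 'm \<Rightarrow> 'm \<Rightarrow> bool" where
  "is_cokernel C f c \<longleftrightarrow> f \<in> Arr C \<and> c \<in> Arr C \<and> Dom C c = Cod C f \<and>
     c \<cdot>\<^bsub>C\<^esub> f = Zero C (Dom C f) (Cod C c) \<and>
     (\<forall>A\<in>Obj C. \<forall>t\<in>Hom C (Cod C f) A. t \<cdot>\<^bsub>C\<^esub> f = Zero C (Dom C f) A \<longrightarrow>
        (\<exists>!u. u \<in> Hom C (Cod C c) A \<and> u \<cdot>\<^bsub>C\<^esub> c = t))"

locale abelian_category = additive_category +
  assumes ex_kernel: "f \<in> Arr C \<Longrightarrow> \<exists>k. is_kernel C f k"
    and ex_cokernel: "f \<in> Arr C \<Longrightarrow> \<exists>c. is_cokernel C f c"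
    and mono_is_kernel: "is_mono C f \<Longrightarrow> \<exists>g. is_kernel C g f"
    and epi_is_cokernel: "is_epi C f \<Longrightarrow> \<exists>g. is_cokernel C g f"

text \<open>
  Exactness of \<open>f\<close>, \<open>g\<close> at the middle object: image and kernel agree as subobjects, where the
  image of \<open>f\<close> is the kernel of its cokernel.
\<close>

definition is_image :: "('o, 'm, 'x) addcat_scheme \<Rightarrow> 'm \<Rightarrow> 'm \<Rightarrow> bool" where
  "is_image C f k \<longleftrightarrow> (\<exists>c. is_cokernel C f c \<and> is_kernel C c k)"

definition exact :: "('o, 'm, 'x) addcat_scheme \<Rightarrow> 'm \<Rightarrow> 'm \<Rightarrow> bool" where
  "exact C f g \<longleftrightarrow> f \<in> Arr C \<and> g \<in> Arr C \<and> Cod C f = Dom C g \<and>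
     (\<exists>k. is_image C f k \<and> is_kernel C g k)"

section \<open>Functors\<close>

record ('o, 'm, 'p, 'n) func =
  fobj :: "'o \<Rightarrow> 'p"
  farr :: "'m \<Rightarrow> 'n"

definition id_func :: "('o, 'm, 'o, 'm) func" where
  "id_func = \<lparr>fobj = (\<lambda>A. A), farr = (\<lambda>f. f)\<rparr>"

definition comp_func ::
  "('p, 'n, 'q, 'l) func \<Rightarrow> ('o, 'm, 'p, 'n) func \<Rightarrow> ('o, 'm, 'q, 'l) func"
  (infixr "\<circ>\<^sub>F" 55) where
  "G \<circ>\<^sub>F F = \<lparr>fobj = fobj G \<circ> fobj F, farr = farr G \<circ> farr F\<rparr>"

definition is_functor ::
  "('o, 'm, 'x) addcat_scheme \<Rightarrow> ('p, 'n, 'y) addcat_scheme \<Rightarrow> ('o, 'm, 'p, 'n) func \<Rightarrow> bool" where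
  "is_functor C D F \<longleftrightarrow>
     (\<forall>A\<in>Obj C. fobj F A \<in> Obj D) \<and>
     (\<forall>A\<in>Obj C. \<forall>B\<in>Obj C. \<forall>f\<in>Hom C A B. farr F f \<in> Hom D (fobj F A) (fobj F B)) \<and>
     (\<forall>A\<in>Obj C. farr F (Idn C A) = Idn D (fobj F A)) \<and>
     (\<forall>f\<in>Arr C. \<forall>g\<in>Arr C. Cod C f = Dom C g \<longrightarrow> farr F (g \<cdot>\<^bsub>C\<^esub> f) = farr F g \<cdot>\<^bsub>D\<^esub> farr F f)"

definition additive_functor ::
  "('o, 'm, 'x) addcat_scheme \<Rightarrow> ('p, 'n, 'y) addcat_scheme \<Rightarrow> ('o, 'm, 'p, 'n) func \<Rightarrow> bool" where
  "additive_functor C D F \<longleftrightarrow> is_functor C D F \<and>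
     (\<forall>A\<in>Obj C. \<forall>B\<in>Obj C. \<forall>f\<in>Hom C A B. \<forall>g\<in>Hom C A B.
        farr F (Add C f g) = Add D (farr F f) (farr F g))"

definition naturally_isomorphic ::
  "('o, 'm, 'x) addcat_scheme \<Rightarrow> ('p, 'n, 'y) addcat_scheme
     \<Rightarrow> ('o, 'm, 'p, 'n) func \<Rightarrow> ('o, 'm, 'p, 'n) func \<Rightarrow> bool" where
  "naturally_isomorphic C D F G \<longleftrightarrow> is_functor C D F \<and> is_functor C D G \<and>
     (\<exists>\<theta>. (\<forall>A\<in>Obj C. \<theta> A \<in> Hom D (fobj F A) (fobj G A) \<and> is_iso D (\<theta> A)) \<and>
          (\<forall>f\<in>Arr C. \<theta> (Cod C f) \<cdot>\<^bsub>D\<^esub> farr F f = farr G f \<cdot>\<^bsub>D\<^esub> \<theta> (Dom C f)))"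

definition is_equivalence ::
  "('o, 'm, 'x) addcat_scheme \<Rightarrow> ('p, 'n, 'y) addcat_scheme \<Rightarrow> ('o, 'm, 'p, 'n) func \<Rightarrow> bool" where
  "is_equivalence C D F \<longleftrightarrow> is_functor C D F \<and>
     (\<exists>G. is_functor D C G \<and> naturally_isomorphic C C (G \<circ>\<^sub>F F) id_func \<and>
          naturally_isomorphic D D (F \<circ>\<^sub>F G) id_func)"

text \<open>\<open>adjoint C D F G\<close>: the functor \<open>F\<close> from \<open>C\<close> to \<open>D\<close> is left adjoint to \<open>G\<close> from \<open>D\<close> to \<open>C\<close>.\<close>

definition adjoint ::
  "('o, 'm, 'x) addcat_scheme \<Rightarrow> ('p, 'n, 'y) addcat_scheme
     \<Rightarrow> ('o, 'm, 'p, 'n) func \<Rightarrow> ('p, 'n, 'o, 'm) func \<Rightarrow> bool" where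
  "adjoint C D F G \<longleftrightarrow> is_functor C D F \<and> is_functor D C G \<and>
     (\<exists>\<phi>. (\<forall>A\<in>Obj C. \<forall>B\<in>Obj D.
             bij_betw (\<phi> A B) (Hom D (fobj F A) B) (Hom C A (fobj G B))) \<and>
          (\<forall>A\<in>Obj C. \<forall>A'\<in>Obj C. \<forall>B\<in>Obj D. \<forall>B'\<in>Obj D.
             \<forall>a\<in>Hom C A' A. \<forall>f\<in>Hom D (fobj F A) B. \<forall>b\<in>Hom D B B'.
               \<phi> A' B' (b \<cdot>\<^bsub>D\<^esub> f \<cdot>\<^bsub>D\<^esub> farr F a) = farr G b \<cdot>\<^bsub>C\<^esub> \<phi> A B f \<cdot>\<^bsub>C\<^esub> a))"

section \<open>Full subcategories and additive quotients\<close>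

definition full_subcategory ::
  "('o, 'm, 'x) addcat_scheme \<Rightarrow> 'o set \<Rightarrow> ('o, 'm, 'x) addcat_scheme" where
  "full_subcategory C S =
     C\<lparr>Obj := Obj C \<inter> S, Arr := {f \<in> Arr C. Dom C f \<in> S \<and> Cod C f \<in> S}\<rparr>"

definition factors_through :: "('o, 'm, 'x) addcat_scheme \<Rightarrow> 'o set \<Rightarrow> 'm \<Rightarrow> bool" where
  "factors_through C S f \<longleftrightarrow>
     (\<exists>W\<in>S. \<exists>a\<in>Hom C (Dom C f) W. \<exists>b\<in>Hom C W (Cod C f). f = b \<cdot>\<^bsub>C\<^esub> a)"

text \<open>
  Morphisms of the additive quotient are the residue classes of morphisms modulo those that factor
  through an object of \<open>S\<close>; its structure is computed on representatives.
\<close>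

definition residue :: "('o, 'm, 'x) addcat_scheme \<Rightarrow> 'o set \<Rightarrow> 'm \<Rightarrow> 'm set" where
  "residue C S f =
     {g \<in> Hom C (Dom C f) (Cod C f). factors_through C S (Add C g (Neg C f))}"

definition representative :: "'m set \<Rightarrow> 'm" where
  "representative F = (SOME f. f \<in> F)"

definition additive_quotient ::
  "('o, 'm, 'x) addcat_scheme \<Rightarrow> 'o set \<Rightarrow> ('o, 'm set) addcat" where
  "additive_quotient C S =
     \<lparr>Obj = Obj C,
      Arr = residue C S ` Arr C,
      Dom = (\<lambda>F. Dom C (representative F)),
      Cod = (\<lambda>F. Cod C (representative F)),
      Idn = (\<lambda>A. residue C S (Idn C A)),
      Cmp = (\<lambda>G F. residue C S (representative G \<cdot>\<^bsub>C\<^esub> representative F)),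
      Add = (\<lambda>F G. residue C S (Add C (representative F) (representative G))),
      Zero = (\<lambda>A B. residue C S (Zero C A B))\<rparr>"

definition quotient_functor ::
  "('o, 'm, 'x) addcat_scheme \<Rightarrow> 'o set \<Rightarrow> ('o, 'm, 'o, 'm set) func" where
  "quotient_functor C S = \<lparr>fobj = (\<lambda>A. A), farr = residue C S\<rparr>"

section \<open>Triangulated categories\<close>

text \<open>
  A triangle \<open>A \<rightarrow> B \<rightarrow> D \<rightarrow> A[1]\<close> is recorded by its three morphisms. The shift is only required to
  be an autoequivalence, which includes the case of an automorphism.
\<close>

record ('o, 'm) tricat = "('o, 'm) addcat" +
  Shift :: "('o, 'm, 'o, 'm) func"
  Dist  :: "('m \<times> 'm \<times> 'm) set"

abbreviation sobj :: "('o, 'm, 'x) tricat_scheme \<Rightarrow> 'o \<Rightarrow> 'o" where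
  "sobj T A \<equiv> fobj (Shift T) A"

abbreviation sarr :: "('o, 'm, 'x) tricat_scheme \<Rightarrow> 'm \<Rightarrow> 'm" where
  "sarr T f \<equiv> farr (Shift T) f"

definition triangle :: "('o, 'm, 'x) tricat_scheme \<Rightarrow> 'm \<Rightarrow> 'm \<Rightarrow> 'm \<Rightarrow> bool" where
  "triangle T f g h \<longleftrightarrow> f \<in> Arr T \<and> g \<in> Arr T \<and> h \<in> Arr T \<and>
     Cod T f = Dom T g \<and> Cod T g = Dom T h \<and> Cod T h = sobj T (Dom T f)"

text \<open>The last axiom is the octahedral axiom, applied to \<open>f\<close>, \<open>g\<close> and \<open>g \<cdot> f\<close>.\<close>

locale triangulated_category = additive_category T
  for T :: "('o, 'm, 'x) tricat_scheme" (structure) +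
  assumes Shift_additive: "additive_functor T T (Shift T)"
    and Shift_equivalence: "is_equivalence T T (Shift T)"
    and Dist_triangle: "(f, g, h) \<in> Dist T \<Longrightarrow> triangle T f g h"
    and Dist_iso: "\<lbrakk>(f, g, h) \<in> Dist T; triangle T f' g' h';
        a \<in> Hom T (Dom T f) (Dom T f'); b \<in> Hom T (Dom T g) (Dom T g');
        c \<in> Hom T (Dom T h) (Dom T h'); is_iso T a; is_iso T b; is_iso T c;
        b \<cdot> f = f' \<cdot> a; c \<cdot> g = g' \<cdot> b; sarr T a \<cdot> h = h' \<cdot> c\<rbrakk>
      \<Longrightarrow> (f', g', h') \<in> Dist T"
    and Dist_Idn: "\<lbrakk>A \<in> Obj T; zero_object T Z\<rbrakk>
      \<Longrightarrow> (Idn T A, Zero T A Z, Zero T Z (sobj T A)) \<in> Dist T"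
    and Dist_cone: "f \<in> Arr T \<Longrightarrow> \<exists>g h. (f, g, h) \<in> Dist T"
    and Dist_rotate: "triangle T f g h
      \<Longrightarrow> (f, g, h) \<in> Dist T \<longleftrightarrow> (g, h, Neg T (sarr T f)) \<in> Dist T"
    and Dist_complete: "\<lbrakk>(f, g, h) \<in> Dist T; (f', g', h') \<in> Dist T;
        a \<in> Hom T (Dom T f) (Dom T f'); b \<in> Hom T (Dom T g) (Dom T g'); b \<cdot> f = f' \<cdot> a\<rbrakk>
      \<Longrightarrow> \<exists>c\<in>Hom T (Dom T h) (Dom T h'). c \<cdot> g = g' \<cdot> b \<and> sarr T a \<cdot> h = h' \<cdot> c"
    and Dist_octahedral: "\<lbrakk>(f, f', f'') \<in> Dist T; (g, g', g'') \<in> Dist T; Cod T f = Dom T g;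
        (g \<cdot> f, h', h'') \<in> Dist T\<rbrakk>
      \<Longrightarrow> \<exists>u\<in>Hom T (Cod T f') (Cod T h'). \<exists>v\<in>Hom T (Cod T h') (Cod T g').
            (u, v, sarr T f' \<cdot> g'') \<in> Dist T \<and>
            u \<cdot> f' = h' \<cdot> g \<and> h'' \<cdot> u = f'' \<and> v \<cdot> h' = g' \<and> g'' \<cdot> v = sarr T f \<cdot> h''"

text \<open>\<open>F\<close> is an additive functor from the triangulated category \<open>T\<close> to the abelian category \<open>D\<close>
  that sends distinguished triangles to exact sequences.\<close>

definition cohomological ::
  "('o, 'm, 'x) tricat_scheme \<Rightarrow> ('p, 'n, 'y) addcat_scheme \<Rightarrow> ('o, 'm, 'p, 'n) func \<Rightarrow> bool" where
  "cohomological T D F \<longleftrightarrow> abelian_category D \<and> additive_functor T D F \<and>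
     (\<forall>f g h. (f, g, h) \<in> Dist T \<longrightarrow> exact D (farr F f) (farr F g))"

section \<open>Torsion pairs and their hearts\<close>

text \<open>Full subcategories are represented by their sets of objects. Thickness does not involve
  the shift.\<close>

definition additive_thick :: "('o, 'm, 'x) addcat_scheme \<Rightarrow> 'o set \<Rightarrow> bool" where
  "additive_thick C S \<longleftrightarrow> S \<subseteq> Obj C \<and>
     (\<forall>Z. zero_object C Z \<longrightarrow> Z \<in> S) \<and>
     (\<forall>P A B. biproduct C P A B \<and> A \<in> S \<and> B \<in> S \<longrightarrow> P \<in> S) \<and>
     (\<forall>A B. A \<in> S \<and> B \<in> Obj C \<and> isomorphic C A B \<longrightarrow> B \<in> S) \<and>
     (\<forall>P A B. biproduct C P A B \<and> P \<in> S \<longrightarrow> A \<in> S)"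

definition torsion_pair :: "('o, 'm, 'x) tricat_scheme \<Rightarrow> 'o set \<Rightarrow> 'o set \<Rightarrow> bool" where
  "torsion_pair T X Y \<longleftrightarrow> additive_thick T X \<and> additive_thick T Y \<and>
     (\<forall>A\<in>X. \<forall>B\<in>Y. Hom T A B = {Zero T A B}) \<and>
     (\<forall>C\<in>Obj T. \<exists>(f, g, h)\<in>Dist T. Dom T f \<in> X \<and> Cod T f = C \<and> Cod T g \<in> Y)"

definition shifted :: "('o, 'm, 'x) tricat_scheme \<Rightarrow> 'o set \<Rightarrow> 'o set" where
  "shifted T S = {A \<in> Obj T. \<exists>B\<in>S. isomorphic T (sobj T B) A}"

definition core :: "('o, 'm, 'x) tricat_scheme \<Rightarrow> 'o set \<Rightarrow> 'o set \<Rightarrow> 'o set" where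
  "core T X Y = shifted T X \<inter> Y"

definition Cplus :: "('o, 'm, 'x) tricat_scheme \<Rightarrow> 'o set \<Rightarrow> 'o set \<Rightarrow> 'o set" where
  "Cplus T X Y = {C \<in> Obj T. \<exists>(f, g, h)\<in>Dist T. Dom T f \<in> Y \<and> Cod T f \<in> core T X Y \<and> Cod T g = C}"

definition Cminus :: "('o, 'm, 'x) tricat_scheme \<Rightarrow> 'o set \<Rightarrow> 'o set \<Rightarrow> 'o set" where
  "Cminus T X Y = {C \<in> Obj T. \<exists>(f, g, h)\<in>Dist T. Dom T f \<in> X \<and> Cod T f = C \<and> Cod T g \<in> core T X Y}"

definition under :: "('o, 'm, 'x) tricat_scheme \<Rightarrow> 'o set \<Rightarrow> 'o set \<Rightarrow> ('o, 'm set) addcat" where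
  "under T X Y = additive_quotient T (core T X Y)"

definition under_plus ::
  "('o, 'm, 'x) tricat_scheme \<Rightarrow> 'o set \<Rightarrow> 'o set \<Rightarrow> ('o, 'm set) addcat" where
  "under_plus T X Y = full_subcategory (under T X Y) (Cplus T X Y)"

definition under_minus ::
  "('o, 'm, 'x) tricat_scheme \<Rightarrow> 'o set \<Rightarrow> 'o set \<Rightarrow> ('o, 'm set) addcat" where
  "under_minus T X Y = full_subcategory (under T X Y) (Cminus T X Y)"

definition heart :: "('o, 'm, 'x) tricat_scheme \<Rightarrow> 'o set \<Rightarrow> 'o set \<Rightarrow> ('o, 'm set) addcat" where
  "heart T X Y = full_subcategory (under T X Y) (Cplus T X Y \<inter> Cminus T X Y)"

text \<open>
  The adjoints are only determined up to natural isomorphism, so they are arbitrary functors with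
  the defining property. The inclusion of a full subcategory acts as the identity on objects and
  morphisms, hence is represented by \<^const>\<open>id_func\<close>.
\<close>

definition is_tau_plus ::
  "('o, 'm, 'x) tricat_scheme \<Rightarrow> 'o set \<Rightarrow> 'o set \<Rightarrow> ('o, 'm set, 'o, 'm set) func \<Rightarrow> bool" where
  "is_tau_plus T X Y F \<longleftrightarrow> additive_functor (under T X Y) (under_plus T X Y) F \<and>
     adjoint (under T X Y) (under_plus T X Y) F id_func"

definition is_tau_minus ::
  "('o, 'm, 'x) tricat_scheme \<Rightarrow> 'o set \<Rightarrow> 'o set \<Rightarrow> ('o, 'm set, 'o, 'm set) func \<Rightarrow> bool" where
  "is_tau_minus T X Y F \<longleftrightarrow> additive_functor (under T X Y) (under_minus T X Y) F \<and>
     adjoint (under_minus T X Y) (under T X Y) id_func F"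

end

theory Submission
  imports Defs
begin

text \<open>
  Put \<open>\<U> = \<X>[1]\<close> and \<open>\<V> = \<Y>\<close>. An object \<open>D\<close> lies in \<open>\<C>\<^sup>+\<close> iff every composite
  \<open>U' \<rightarrow> U[1] \<rightarrow> D[1]\<close> with \<open>U, U'\<close> in \<open>\<U>\<close> vanishes, and dually for \<open>\<C>\<^sup>-\<close>. Modulo \<open>\<W>\<close>, a triangle
  \<open>S \<rightarrow> C \<rightarrow> N \<rightarrow> S[1]\<close> with \<open>S\<close> in \<open>\<X>\<close>, \<open>N\<close> in \<open>\<C>\<^sup>+\<close> and \<open>S \<rightarrow> C\<close> factoring through \<open>\<U>\<close> makes
  \<open>C \<rightarrow> N\<close> the reflection into \<open>\<C>\<^sup>+\<close>. The octahedral axiom, applied to a coreflection of \<open>C\<close> followed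
  by a reflection, yields a commutative square of reflections and coreflections, so \<open>\<tau>\<^sup>+\<tau>\<^sup>-\<close> and
  \<open>\<tau>\<^sup>-\<tau>\<^sup>+\<close> agree.

  For a triangle \<open>B \<rightarrow> M \<rightarrow> U \<rightarrow> B[1]\<close> whose last map factors as \<open>U \<rightarrow> A[1] \<rightarrow> B[1]\<close>, where
  \<open>A \<rightarrow> V \<rightarrow> U \<rightarrow> A[1]\<close> is a decomposition of \<open>A\<close>, the map \<open>H(B) \<rightarrow> H(M)\<close> is a cokernel of \<open>H(A) \<rightarrow> H(B)\<close>;
  for a triangle \<open>V \<rightarrow> M \<rightarrow> C \<rightarrow> V[1]\<close> the map \<open>H(M) \<rightarrow> H(C)\<close> is a monomorphism. Decomposing \<open>A\<close> and forming
  the homotopy pushout with \<open>A \<rightarrow> B\<close> gives both triangles with the same \<open>M\<close>, whence exactness at \<open>H(B)\<close>.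
\<close>

section \<open>Preadditive categories and duality\<close>

text \<open>The two halves of exactness are natural for different composites. A triangle B
  \<rightarrow> M \<rightarrow> U \<rightarrow> B[1] can be pulled back along the coreflection of M;
  this also yields a coreflection of B and keeps U as third term, so tau^- followed by tau^+ can be
  followed on it. The dual argument for V \<rightarrow> M \<rightarrow> C \<rightarrow> V[1]
  controls the opposite order. The comparison of both orders is therefore an ingredient of
  exactness: H(g) is a cokernel of H(f) followed by a map whose injectivity is first known for the
  other composite. Half of the statements are to come by duality. The obstacle is that the shift is
  only an autoequivalence, so the opposite category is triangulated only after choosing a
  quasi-inverse. The argument therefore runs on a calculus of Hom and Ext in which second extensions
  occur only through composites that vanish. The functors tau^+ and tau^- are arbitrary adjoints.
  The explicit triangles reach them through the uniqueness of reflections in the quotient, so every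
  construction is first made in C with strict factorizations and then read modulo W.\<close>

context category
begin

lemma Hom_Obj:
  assumes "f \<in> Hom C A B"
  shows "A \<in> Obj C" "B \<in> Obj C"
  using assms Dom_in_Obj Cod_in_Obj by (auto simp: Hom_def)

lemma Arr_Hom: "f \<in> Arr C \<Longrightarrow> f \<in> Hom C (Dom C f) (Cod C f)"
  by (simp add: Hom_def)

end

lemma Hom_Arr: "f \<in> Hom C A B \<Longrightarrow> f \<in> Arr C"
  and Hom_Dom: "f \<in> Hom C A B \<Longrightarrow> Dom C f = A"
  and Hom_Cod: "f \<in> Hom C A B \<Longrightarrow> Cod C f = B"
  by (simp_all add: Hom_def)

context preadditive_category
begin

lemma Add_in_Hom:
  assumes "f \<in> Hom C A B" "g \<in> Hom C A B"
  shows "Add C f g \<in> Hom C A B"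
proof -
  interpret G: comm_group "Hom_group C A B" using Hom_comm_group assms Hom_Obj by blast
  show ?thesis using G.m_closed assms by (simp add: Hom_group_def)
qed

lemma Zero_in_Hom:
  assumes "A \<in> Obj C" "B \<in> Obj C"
  shows "Zero C A B \<in> Hom C A B"
proof -
  interpret G: comm_group "Hom_group C A B" using Hom_comm_group assms by blast
  show ?thesis using G.one_closed by (simp add: Hom_group_def)
qed

lemma Neg_in_Hom:
  assumes "f \<in> Hom C A B"
  shows "Neg C f \<in> Hom C A B"
proof -
  interpret G: comm_group "Hom_group C A B" using Hom_comm_group assms Hom_Obj by blast
  show ?thesis using G.inv_closed[of f] assms by (simp add: Neg_def Hom_group_def Hom_def)
qed

lemma Add_assoc:
  assumes "f \<in> Hom C A B" "g \<in> Hom C A B" "h \<in> Hom C A B"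
  shows "Add C (Add C f g) h = Add C f (Add C g h)"
proof -
  interpret G: comm_group "Hom_group C A B" using Hom_comm_group assms Hom_Obj by blast
  show ?thesis using G.m_assoc[of f g h] assms by (simp add: Hom_group_def)
qed

lemma Add_commute:
  assumes "f \<in> Hom C A B" "g \<in> Hom C A B"
  shows "Add C f g = Add C g f"
proof -
  interpret G: comm_group "Hom_group C A B" using Hom_comm_group assms Hom_Obj by blast
  show ?thesis using G.m_comm[of f g] assms by (simp add: Hom_group_def)
qed

lemma Add_Zero:
  assumes "f \<in> Hom C A B"
  shows "Add C f (Zero C A B) = f" "Add C (Zero C A B) f = f"
proof -
  interpret G: comm_group "Hom_group C A B" using Hom_comm_group assms Hom_Obj by blast
  show "Add C f (Zero C A B) = f" "Add C (Zero C A B) f = f"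
    using G.r_one[of f] G.l_one[of f] assms by (simp_all add: Hom_group_def)
qed

lemma Add_Neg:
  assumes "f \<in> Hom C A B"
  shows "Add C f (Neg C f) = Zero C A B" "Add C (Neg C f) f = Zero C A B"
proof -
  interpret G: comm_group "Hom_group C A B" using Hom_comm_group assms Hom_Obj by blast
  show "Add C f (Neg C f) = Zero C A B" "Add C (Neg C f) f = Zero C A B"
    using G.r_inv[of f] G.l_inv[of f] assms by (simp_all add: Hom_group_def Neg_def Hom_def)
qed

lemma Add_cancel:
  assumes "f \<in> Hom C A B" "g \<in> Hom C A B" "h \<in> Hom C A B" "Add C f g = Add C f h"
  shows "g = h"
proof -
  note n = Neg_in_Hom[OF assms(1)]
  have "Add C (Neg C f) (Add C f k) = k" if "k \<in> Hom C A B" for k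
    using Add_assoc[OF n assms(1) that] Add_Neg(2)[OF assms(1)] Add_Zero(2)[OF that] by simp
  from this[OF assms(2)] this[OF assms(3)] show ?thesis unfolding assms(4) by (rule trans[OF sym])
qed

lemma Neg_unique:
  assumes "f \<in> Hom C A B" "g \<in> Hom C A B" "Add C f g = Zero C A B"
  shows "g = Neg C f"
  by (rule Add_cancel[OF assms(1,2) Neg_in_Hom[OF assms(1)]]) (simp only: assms(3) Add_Neg(1)[OF assms(1)])

lemma Neg_Neg: "f \<in> Hom C A B \<Longrightarrow> Neg C (Neg C f) = f"
  by (rule Neg_unique[symmetric, OF Neg_in_Hom]) (simp_all only: Add_Neg)

lemma Add_idem_Zero:
  assumes "f \<in> Hom C A B" "Add C f f = f"
  shows "f = Zero C A B"
proof -
  have "Add C f f = Add C f (Zero C A B)" using assms Add_Zero by simp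
  then show ?thesis using Add_cancel[OF assms(1) assms(1)] Zero_in_Hom Hom_Obj[OF assms(1)] by blast
qed

lemma Cmp_Zero:
  assumes "f \<in> Hom C A B" "D \<in> Obj C"
  shows "Zero C B D \<cdot> f = Zero C A D" "f \<cdot> Zero C D A = Zero C D B"
proof -
  have z: "Zero C B D \<in> Hom C B D" "Zero C D A \<in> Hom C D A"
    using Zero_in_Hom assms Hom_Obj[OF assms(1)] by auto
  have "Add C (Zero C B D \<cdot> f) (Zero C B D \<cdot> f) = Zero C B D \<cdot> f"
    using Cmp_Add_left[OF assms(1) z(1) z(1)] Add_Zero(1)[OF z(1)] by simp
  then show "Zero C B D \<cdot> f = Zero C A D"
    by (rule Add_idem_Zero[OF Cmp_in_Hom[OF assms(1) z(1)]])
  have "Add C (f \<cdot> Zero C D A) (f \<cdot> Zero C D A) = f \<cdot> Zero C D A"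
    using Cmp_Add_right[OF z(2) z(2) assms(1)] Add_Zero(1)[OF z(2)] by simp
  then show "f \<cdot> Zero C D A = Zero C D B"
    by (rule Add_idem_Zero[OF Cmp_in_Hom[OF z(2) assms(1)]])
qed

lemma Cmp_Neg:
  assumes "f \<in> Hom C A B" "g \<in> Hom C B D"
  shows "Neg C g \<cdot> f = Neg C (g \<cdot> f)" "g \<cdot> Neg C f = Neg C (g \<cdot> f)"
proof -
  have gf: "g \<cdot> f \<in> Hom C A D" using Cmp_in_Hom assms by blast
  have n: "Neg C f \<in> Hom C A B" "Neg C g \<in> Hom C B D" using Neg_in_Hom assms by auto
  have "Add C (g \<cdot> f) (Neg C g \<cdot> f) = Zero C A D"
    using Cmp_Add_left[OF assms(1) assms(2) n(2)] Add_Neg(1)[OF assms(2)]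
      Cmp_Zero(1)[OF assms(1)] Hom_Obj(2)[OF assms(2)] by simp
  then show "Neg C g \<cdot> f = Neg C (g \<cdot> f)"
    by (rule Neg_unique[OF gf Cmp_in_Hom[OF assms(1) n(2)]])
  have "Add C (g \<cdot> f) (g \<cdot> Neg C f) = Zero C A D"
    using Cmp_Add_right[OF assms(1) n(1) assms(2)] Add_Neg(1)[OF assms(1)]
      Cmp_Zero(2)[OF assms(2)] Hom_Obj(1)[OF assms(1)] by simp
  then show "g \<cdot> Neg C f = Neg C (g \<cdot> f)"
    by (rule Neg_unique[OF gf Cmp_in_Hom[OF n(1) assms(2)]])
qed

lemma Neg_Zero:
  assumes "A \<in> Obj C" "B \<in> Obj C"
  shows "Neg C (Zero C A B) = Zero C A B"
  using Neg_unique[of "Zero C A B" A B "Zero C A B"] Zero_in_Hom Add_Zero assms by simp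

lemma Neg_Add:
  assumes "f \<in> Hom C A B" "g \<in> Hom C A B"
  shows "Neg C (Add C f g) = Add C (Neg C f) (Neg C g)"
proof -
  interpret G: comm_group "Hom_group C A B"
    by (rule Hom_comm_group[OF Hom_Obj[OF assms(1)]])
  have n: "Neg C h = inv\<^bsub>Hom_group C A B\<^esub> h" if "h \<in> Hom C A B" for h
    using that by (simp add: Neg_def Hom_def)
  show ?thesis
    unfolding n[OF assms(1)] n[OF assms(2)] n[OF Add_in_Hom[OF assms]]
    using G.inv_mult[of f g] assms by (simp add: Hom_group_def)
qed

definition Sub :: "'b \<Rightarrow> 'b \<Rightarrow> 'b" where
  "Sub f g = Add C f (Neg C g)"

lemma Sub_in_Hom: "\<lbrakk>f \<in> Hom C A B; g \<in> Hom C A B\<rbrakk> \<Longrightarrow> Sub f g \<in> Hom C A B"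
  by (simp add: Sub_def Add_in_Hom Neg_in_Hom)

lemma Add_Sub:
  assumes "f \<in> Hom C A B" "g \<in> Hom C A B"
  shows "Add C g (Sub f g) = f" "Add C (Sub f g) g = f"
proof -
  show *: "Add C (Sub f g) g = f"
    unfolding Sub_def
    by (simp add: Add_assoc[OF assms(1) Neg_in_Hom[OF assms(2)] assms(2)] Add_Neg(2)[OF assms(2)]
        Add_Zero(1)[OF assms(1)])
  show "Add C g (Sub f g) = f"
    using Add_commute[OF assms(2) Sub_in_Hom[OF assms]] * by simp
qed

lemma Sub_eq_Zero:
  assumes "f \<in> Hom C A B" "g \<in> Hom C A B"
  shows "Sub f g = Zero C A B \<longleftrightarrow> f = g"
  using Add_Sub(2)[OF assms] Add_Zero(2)[OF assms(2)] Add_Neg(1)[OF assms(2)]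
  by (auto simp: Sub_def)

lemma Sub_Add:
  assumes "f \<in> Hom C A B" "g \<in> Hom C A B"
  shows "Sub (Add C f g) g = f" "Sub (Add C g f) g = f"
proof -
  show *: "Sub (Add C f g) g = f"
    unfolding Sub_def
    by (simp add: Add_assoc[OF assms Neg_in_Hom[OF assms(2)]] Add_Neg(1)[OF assms(2)]
        Add_Zero(1)[OF assms(1)])
  show "Sub (Add C g f) g = f" using Add_commute[OF assms] * by simp
qed

lemma Cmp_Sub_left:
  assumes "f \<in> Hom C A B" "g \<in> Hom C B D" "g' \<in> Hom C B D"
  shows "Sub g g' \<cdot> f = Sub (g \<cdot> f) (g' \<cdot> f)"
  unfolding Sub_def
  by (simp add: Cmp_Add_left[OF assms(1,2) Neg_in_Hom[OF assms(3)]] Cmp_Neg(1)[OF assms(1,3)])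

lemma Cmp_Sub_right:
  assumes "f \<in> Hom C A B" "f' \<in> Hom C A B" "g \<in> Hom C B D"
  shows "g \<cdot> Sub f f' = Sub (g \<cdot> f) (g \<cdot> f')"
  unfolding Sub_def
  by (simp add: Cmp_Add_right[OF assms(1) Neg_in_Hom[OF assms(2)] assms(3)] Cmp_Neg(2)[OF assms(2,3)])

end

section \<open>Opposite categories\<close>

text \<open>The result is a bare \<open>addcat\<close>: further record fields, such as a shift, are
  dropped. Taking opposites twice is therefore compared with the original field by field.\<close>

definition op_cat :: "('o, 'm, 'x) addcat_scheme \<Rightarrow> ('o, 'm) addcat" where
  "op_cat C = \<lparr>Obj = Obj C, Arr = Arr C, Dom = Cod C, Cod = Dom C, Idn = Idn C,
     Cmp = (\<lambda>g f. f \<cdot>\<^bsub>C\<^esub> g), Add = Add C, Zero = (\<lambda>A B. Zero C B A)\<rparr>"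

lemma op_cat_simps [simp]:
  "Obj (op_cat C) = Obj C" "Arr (op_cat C) = Arr C" "Dom (op_cat C) = Cod C"
  "Cod (op_cat C) = Dom C" "Idn (op_cat C) = Idn C" "f \<cdot>\<^bsub>op_cat C\<^esub> g = g \<cdot>\<^bsub>C\<^esub> f"
  "Add (op_cat C) = Add C" "Zero (op_cat C) A B = Zero C B A"
  by (simp_all add: op_cat_def)

lemma Hom_op [simp]: "Hom (op_cat C) A B = Hom C B A"
  by (auto simp: Hom_def)

lemma Hom_group_op [simp]: "Hom_group (op_cat C) A B = Hom_group C B A"
  by (simp add: Hom_group_def)

lemma Neg_op [simp]: "Neg (op_cat C) f = Neg C f"
  by (simp add: Neg_def)

lemma category_op:
  assumes "category C"
  shows "category (op_cat C)"
proof -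
  interpret category C by fact
  show ?thesis
    by unfold_locales
      (simp_all add: Dom_in_Obj Cod_in_Obj Idn_in_Hom Idn_left Idn_right Cmp_in_Hom Cmp_assoc)
qed

lemma preadditive_op:
  assumes "preadditive_category C"
  shows "preadditive_category (op_cat C)"
proof -
  interpret preadditive_category C by fact
  interpret op: category "op_cat C" by (rule category_op) unfold_locales
  show ?thesis
    by (intro preadditive_category.intro preadditive_category_axioms.intro op.category_axioms)
      (simp_all add: Hom_comm_group Cmp_Add_left Cmp_Add_right)
qed

lemma zero_object_op [simp]: "zero_object (op_cat C) Z \<longleftrightarrow> zero_object C Z"
  unfolding zero_object_def op_cat_simps Hom_op by blast

lemma biproductE:
  assumes "biproduct C P A B"
  obtains i j p q where "P \<in> Obj C" "A \<in> Obj C" "B \<in> Obj C"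
    "i \<in> Hom C A P" "j \<in> Hom C B P" "p \<in> Hom C P A" "q \<in> Hom C P B"
    "p \<cdot>\<^bsub>C\<^esub> i = Idn C A" "q \<cdot>\<^bsub>C\<^esub> j = Idn C B" "q \<cdot>\<^bsub>C\<^esub> i = Zero C A B" "p \<cdot>\<^bsub>C\<^esub> j = Zero C B A"
    "Add C (i \<cdot>\<^bsub>C\<^esub> p) (j \<cdot>\<^bsub>C\<^esub> q) = Idn C P"
  using assms unfolding biproduct_def by blast

lemma biproductI:
  assumes "P \<in> Obj C" "A \<in> Obj C" "B \<in> Obj C"
    "i \<in> Hom C A P" "j \<in> Hom C B P" "p \<in> Hom C P A" "q \<in> Hom C P B"
    "p \<cdot>\<^bsub>C\<^esub> i = Idn C A" "q \<cdot>\<^bsub>C\<^esub> j = Idn C B" "q \<cdot>\<^bsub>C\<^esub> i = Zero C A B" "p \<cdot>\<^bsub>C\<^esub> j = Zero C B A"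
    "Add C (i \<cdot>\<^bsub>C\<^esub> p) (j \<cdot>\<^bsub>C\<^esub> q) = Idn C P"
  shows "biproduct C P A B"
  using assms unfolding biproduct_def by blast

lemma biproduct_op_imp:
  assumes "biproduct C P A B"
  shows "biproduct (op_cat C) P A B"
proof -
  obtain i j p q where "P \<in> Obj C" "A \<in> Obj C" "B \<in> Obj C"
    "i \<in> Hom C A P" "j \<in> Hom C B P" "p \<in> Hom C P A" "q \<in> Hom C P B"
    "p \<cdot>\<^bsub>C\<^esub> i = Idn C A" "q \<cdot>\<^bsub>C\<^esub> j = Idn C B" "q \<cdot>\<^bsub>C\<^esub> i = Zero C A B" "p \<cdot>\<^bsub>C\<^esub> j = Zero C B A"
    "Add C (i \<cdot>\<^bsub>C\<^esub> p) (j \<cdot>\<^bsub>C\<^esub> q) = Idn C P"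
    by (rule biproductE[OF assms])
  then show ?thesis
    by (intro biproductI[where i = p and j = q and p = i and q = j]) simp_all
qed

lemma biproduct_op [simp]: "biproduct (op_cat C) P A B \<longleftrightarrow> biproduct C P A B"
proof
  assume "biproduct (op_cat C) P A B"
  then have "biproduct (op_cat (op_cat C)) P A B" by (rule biproduct_op_imp)
  then show "biproduct C P A B" unfolding biproduct_def op_cat_simps Hom_op .
qed (rule biproduct_op_imp)

lemma additive_op:
  assumes "additive_category C"
  shows "additive_category (op_cat C)"
proof -
  interpret additive_category C by fact
  interpret op: preadditive_category "op_cat C" by (rule preadditive_op) unfold_locales
  show ?thesis
    by unfold_locales (simp_all add: ex_zero_object ex_biproduct)
qed

lemma is_kernel_op [simp]: "is_kernel (op_cat C) f k \<longleftrightarrow> is_cokernel C f k"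
  by (simp add: is_kernel_def is_cokernel_def)

lemma is_cokernel_op [simp]: "is_cokernel (op_cat C) f k \<longleftrightarrow> is_kernel C f k"
  by (simp add: is_kernel_def is_cokernel_def)

lemma is_mono_op [simp]: "is_mono (op_cat C) f \<longleftrightarrow> is_epi C f"
  by (simp add: is_mono_def is_epi_def)

lemma is_epi_op [simp]: "is_epi (op_cat C) f \<longleftrightarrow> is_mono C f"
  by (simp add: is_mono_def is_epi_def)

lemma full_subcategory_op: "full_subcategory (op_cat C) S = op_cat (full_subcategory (C::('o,'m) addcat) S)"
  by (auto simp: full_subcategory_def op_cat_def)

lemma factors_through_op [simp]: "factors_through (op_cat C) S f \<longleftrightarrow> factors_through C S f"
  unfolding factors_through_def op_cat_simps Hom_op by blast

lemma residue_op [simp]: "residue (op_cat C) S f = residue C S f"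
  by (auto simp: residue_def)

text \<open>A literal equality of records, so that facts proved over \<open>op_cat C\<close> can be
  rewritten into facts about the opposite of the quotient.\<close>

lemma additive_quotient_op: "additive_quotient (op_cat C) S = op_cat (additive_quotient C S)"
proof -
  have r: "residue (op_cat C) S = residue C S" by (rule ext) simp
  show ?thesis
    unfolding op_cat_def[of "additive_quotient C S"] by (simp add: additive_quotient_def r)
qed

section \<open>Full subcategories and additive quotients\<close>

lemma Hom_full:
  "Hom (full_subcategory K S) A B = (if A \<in> S \<and> B \<in> S then Hom K A B else {})"
  by (auto simp: Hom_def full_subcategory_def)

lemma full_simps [simp]:
  "Obj (full_subcategory K S) = Obj K \<inter> S" "Dom (full_subcategory K S) = Dom K"
  "Cod (full_subcategory K S) = Cod K" "Idn (full_subcategory K S) = Idn K"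
  "Cmp (full_subcategory K S) = Cmp K" "Add (full_subcategory K S) = Add K"
  "Zero (full_subcategory K S) = Zero K"
  "Arr (full_subcategory K S) = {f \<in> Arr K. Dom K f \<in> S \<and> Cod K f \<in> S}"
  by (simp_all add: full_subcategory_def)

lemma full_additive:
  assumes "additive_category K" and Z: "Z \<in> S" "zero_object K Z"
    and P: "\<And>A B. A \<in> S \<Longrightarrow> B \<in> S \<Longrightarrow> A \<in> Obj K \<Longrightarrow> B \<in> Obj K \<Longrightarrow> \<exists>P\<in>S. biproduct K P A B"
  shows "additive_category (full_subcategory K S)"
proof -
  interpret additive_category K by fact
  interpret F: category "full_subcategory K S"
    by unfold_locales
      (simp_all add: Hom_full Dom_in_Obj Cod_in_Obj Idn_in_Hom Idn_left Idn_right Cmp_in_Hom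
        Cmp_assoc split: if_splits)
  interpret F: preadditive_category "full_subcategory K S"
  proof (intro preadditive_category.intro preadditive_category_axioms.intro F.category_axioms)
    fix A B assume "A \<in> Obj (full_subcategory K S)" "B \<in> Obj (full_subcategory K S)"
    then have "Hom_group (full_subcategory K S) A B = Hom_group K A B"
      and "comm_group (Hom_group K A B)"
      using Hom_comm_group by (auto simp: Hom_group_def Hom_full)
    then show "comm_group (Hom_group (full_subcategory K S) A B)" by simp
  qed (simp_all add: Hom_full Cmp_Add_left Cmp_Add_right split: if_splits)
  show ?thesis
  proof unfold_locales
    have "zero_object (full_subcategory K S) Z"
      using Z by (simp add: zero_object_def Hom_full)
    then show "\<exists>Z. zero_object (full_subcategory K S) Z" ..
  next
    fix A B assume "A \<in> Obj (full_subcategory K S)" "B \<in> Obj (full_subcategory K S)"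
    then have AB: "A \<in> S" "B \<in> S" "A \<in> Obj K" "B \<in> Obj K" by simp_all
    then obtain P where "P \<in> S" "biproduct K P A B" using assms(4) by blast
    then have "biproduct (full_subcategory K S) P A B"
      using AB by (simp add: biproduct_def Hom_full)
    then show "\<exists>P. biproduct (full_subcategory K S) P A B" ..
  qed
qed

section \<open>The ideal of morphisms factoring through W and its quotient\<close>

locale additive_ideal = additive_category +
  fixes W :: "'a set"
  assumes W_Obj: "W \<subseteq> Obj C"
    and W_zero: "\<exists>Z\<in>W. zero_object C Z"
    and W_biproduct: "\<lbrakk>A \<in> W; B \<in> W\<rbrakk> \<Longrightarrow> \<exists>P\<in>W. biproduct C P A B"
begin

abbreviation null :: "'b \<Rightarrow> bool" where "null \<equiv> factors_through C W"
abbreviation res :: "'b \<Rightarrow> 'b set" where "res \<equiv> residue C W"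
abbreviation Q :: "('a, 'b set) addcat" where "Q \<equiv> additive_quotient C W"
abbreviation Q_Cmp (infixl "\<bullet>" 70) where "G \<bullet> F \<equiv> G \<cdot>\<^bsub>Q\<^esub> F"

lemma nullI:
  assumes "w \<in> W" "a \<in> Hom C A w" "b \<in> Hom C w B"
  shows "null (b \<cdot> a)"
  using assms Cmp_in_Hom[OF assms(2,3)] unfolding factors_through_def Hom_def by auto

lemma nullE:
  assumes "null f" "f \<in> Hom C A B"
  obtains w a b where "w \<in> W" "a \<in> Hom C A w" "b \<in> Hom C w B" "f = b \<cdot> a"
  using assms unfolding factors_through_def Hom_def by auto

lemma null_Cmp_left:
  assumes "null f" "f \<in> Hom C A B" "g \<in> Hom C B D"
  shows "null (g \<cdot> f)"
proof -
  obtain w a b where w: "w \<in> W" "a \<in> Hom C A w" "b \<in> Hom C w B" "f = b \<cdot> a"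
    using nullE assms by blast
  have "g \<cdot> f = (g \<cdot> b) \<cdot> a" using Cmp_assoc[OF w(2,3) assms(3)] w(4) by simp
  then show ?thesis using nullI[OF w(1,2)] Cmp_in_Hom[OF w(3) assms(3)] by simp
qed

lemma null_Cmp_right:
  assumes "null g" "f \<in> Hom C A B" "g \<in> Hom C B D"
  shows "null (g \<cdot> f)"
proof -
  obtain w a b where w: "w \<in> W" "a \<in> Hom C B w" "b \<in> Hom C w D" "g = b \<cdot> a"
    using nullE assms by blast
  have "g \<cdot> f = b \<cdot> (a \<cdot> f)" using Cmp_assoc[OF assms(2) w(2,3)] w(4) by simp
  then show ?thesis using nullI[OF w(1) _ w(3)] Cmp_in_Hom[OF assms(2) w(2)] by simp
qed

lemma null_Zero:
  assumes "A \<in> Obj C" "B \<in> Obj C"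
  shows "null (Zero C A B)"
proof -
  obtain Z where Z: "Z \<in> W" using W_zero by blast
  then have zo: "Z \<in> Obj C" using W_Obj by blast
  have "Zero C Z B \<cdot> Zero C A Z = Zero C A B"
    using Cmp_Zero(2) Zero_in_Hom assms zo by blast
  then show ?thesis using nullI[OF Z Zero_in_Hom[OF assms(1) zo] Zero_in_Hom[OF zo assms(2)]] by simp
qed

lemma null_Neg:
  assumes "null f" "f \<in> Hom C A B"
  shows "null (Neg C f)"
proof -
  obtain w a b where w: "w \<in> W" "a \<in> Hom C A w" "b \<in> Hom C w B" "f = b \<cdot> a"
    using nullE assms by blast
  then show ?thesis using nullI[OF w(1,2) Neg_in_Hom[OF w(3)]] Cmp_Neg(1)[OF w(2,3)] by simp
qed

text \<open>Both factorizations are combined over a biproduct of the two middle objects: b a + b' a'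
  = (b p + b' q)(i a + j a'), the mixed terms being zero.\<close>

lemma null_Add:
  assumes "null f" "null g" and h: "f \<in> Hom C A B" "g \<in> Hom C A B"
  shows "null (Add C f g)"
proof -
  obtain w a b where w: "w \<in> W" "a \<in> Hom C A w" "b \<in> Hom C w B" "f = b \<cdot> a"
    using nullE assms by blast
  obtain w' a' b' where w': "w' \<in> W" "a' \<in> Hom C A w'" "b' \<in> Hom C w' B" "g = b' \<cdot> a'"
    using nullE assms by blast
  obtain P where P: "P \<in> W" "biproduct C P w w'" using W_biproduct w(1) w'(1) by blast
  obtain i j p q where b:
    "i \<in> Hom C w P" "j \<in> Hom C w' P" "p \<in> Hom C P w" "q \<in> Hom C P w'"
    "p \<cdot> i = Idn C w" "q \<cdot> j = Idn C w'" "q \<cdot> i = Zero C w w'" "p \<cdot> j = Zero C w' w"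
    "Add C (i \<cdot> p) (j \<cdot> q) = Idn C P"
    by (rule biproductE[OF P(2)])
  have ia: "i \<cdot> a \<in> Hom C A P" "j \<cdot> a' \<in> Hom C A P" and bp: "b \<cdot> p \<in> Hom C P B" "b' \<cdot> q \<in> Hom C P B"
    using Cmp_in_Hom w w' b by blast+
  have ob: "w \<in> Obj C" "w' \<in> Obj C" "B \<in> Obj C" "A \<in> Obj C"
    using Hom_Obj w(2,3) w'(2) by blast+
  have c1: "(b \<cdot> p) \<cdot> (i \<cdot> a) = f"
    using Cmp_assoc[OF ia(1) b(3) w(3)] Cmp_assoc[OF w(2) b(1) b(3)] b(5) Idn_left[OF w(2)] w(4) by simp
  have c2: "(b' \<cdot> q) \<cdot> (j \<cdot> a') = g"
    using Cmp_assoc[OF ia(2) b(4) w'(3)] Cmp_assoc[OF w'(2) b(2) b(4)] b(6) Idn_left[OF w'(2)] w'(4) by simp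
  have c3: "(b \<cdot> p) \<cdot> (j \<cdot> a') = Zero C A B"
    using Cmp_assoc[OF ia(2) b(3) w(3)] Cmp_assoc[OF w'(2) b(2) b(3)] b(8)
      Cmp_Zero(1)[OF w'(2) ob(1)] Cmp_Zero(2)[OF w(3) ob(4)] by simp
  have c4: "(b' \<cdot> q) \<cdot> (i \<cdot> a) = Zero C A B"
    using Cmp_assoc[OF ia(1) b(4) w'(3)] Cmp_assoc[OF w(2) b(1) b(4)] b(7)
      Cmp_Zero(1)[OF w(2) ob(2)] Cmp_Zero(2)[OF w'(3) ob(4)] by simp
  have "Add C (b \<cdot> p) (b' \<cdot> q) \<cdot> Add C (i \<cdot> a) (j \<cdot> a')
      = Add C (Add C f (Zero C A B)) (Add C (Zero C A B) g)"
    by (simp only: Cmp_Add_left[OF Add_in_Hom[OF ia] bp] Cmp_Add_right[OF ia bp(1)]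
        Cmp_Add_right[OF ia bp(2)] c1 c2 c3 c4)
  also have "\<dots> = Add C f g" by (simp only: Add_Zero[OF h(1)] Add_Zero[OF h(2)])
  finally show ?thesis using nullI[OF P(1) Add_in_Hom[OF ia] Add_in_Hom[OF bp]] by simp
qed

lemma mem_res:
  assumes "f \<in> Hom C A B"
  shows "g \<in> res f \<longleftrightarrow> g \<in> Hom C A B \<and> null (Sub g f)"
  using assms by (simp add: residue_def Hom_def Sub_def)

lemma null_Sub_refl: "f \<in> Hom C A B \<Longrightarrow> null (Sub f f)"
  using null_Zero Hom_Obj Sub_eq_Zero[of f A B f] by metis

lemma Neg_Sub:
  assumes "f \<in> Hom C A B" "g \<in> Hom C A B"
  shows "Neg C (Sub f g) = Sub g f"
  unfolding Sub_def
  by (simp only: Neg_Add[OF assms(1) Neg_in_Hom[OF assms(2)]] Neg_Neg[OF assms(2)]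
      Add_commute[OF Neg_in_Hom[OF assms(1)] assms(2)])

lemma Sub_Sub_Add:
  assumes "f \<in> Hom C A B" "g \<in> Hom C A B" "h \<in> Hom C A B"
  shows "Add C (Sub f g) (Sub g h) = Sub f h"
proof -
  note n = Neg_in_Hom[OF assms(2)] Neg_in_Hom[OF assms(3)]
  have "Add C (Sub f g) (Sub g h) = Add C f (Add C (Neg C g) (Add C g (Neg C h)))"
    unfolding Sub_def by (rule Add_assoc[OF assms(1) n(1) Add_in_Hom[OF assms(2) n(2)]])
  also have "Add C (Neg C g) (Add C g (Neg C h)) = Neg C h"
    using Add_assoc[OF n(1) assms(2) n(2)] Add_Neg(2)[OF assms(2)] Add_Zero(2)[OF n(2)] by simp
  finally show ?thesis by (simp add: Sub_def)
qed

lemma res_eq_iff: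
  assumes "f \<in> Hom C A B" "g \<in> Hom C A B"
  shows "res f = res g \<longleftrightarrow> null (Sub f g)"
proof
  assume "res f = res g"
  then have "f \<in> res g" using mem_res[OF assms(1)] null_Sub_refl[OF assms(1)] assms(1) by blast
  then show "null (Sub f g)" using mem_res[OF assms(2)] by blast
next
  assume n: "null (Sub f g)"
  have n': "null (Sub g f)"
    using null_Neg[OF n Sub_in_Hom[OF assms]] Neg_Sub[OF assms] by simp
  have "null (Sub h f) \<longleftrightarrow> null (Sub h g)" if h: "h \<in> Hom C A B" for h
    using null_Add[OF _ n Sub_in_Hom[OF h assms(1)] Sub_in_Hom[OF assms]]
      null_Add[OF _ n' Sub_in_Hom[OF h assms(2)] Sub_in_Hom[OF assms(2,1)]]
      Sub_Sub_Add[OF h assms] Sub_Sub_Add[OF h assms(2,1)] by auto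
  then show "res f = res g"
    using mem_res[OF assms(1)] mem_res[OF assms(2)] by blast
qed

lemma representative_res:
  assumes "f \<in> Hom C A B"
  shows "representative (res f) \<in> Hom C A B" "res (representative (res f)) = res f"
proof -
  have "f \<in> res f" using mem_res[OF assms] null_Sub_refl[OF assms] assms by blast
  then have "representative (res f) \<in> res f" unfolding representative_def by (rule someI)
  then have *: "representative (res f) \<in> Hom C A B" "null (Sub (representative (res f)) f)"
    using mem_res[OF assms] by blast+
  show "representative (res f) \<in> Hom C A B" by fact
  show "res (representative (res f)) = res f" using res_eq_iff[OF *(1) assms] *(2) by blast
qed

lemma Obj_Q [simp]: "Obj Q = Obj C"
  by (simp add: additive_quotient_def)

lemma Idn_Q [simp]: "Idn Q A = res (Idn C A)"
  by (simp add: additive_quotient_def)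

lemma Zero_Q [simp]: "Zero Q A B = res (Zero C A B)"
  by (simp add: additive_quotient_def)

lemma res_in_Hom: "f \<in> Hom C A B \<Longrightarrow> res f \<in> Hom Q A B"
  using representative_res(1)[of f A B] by (auto simp: Hom_def additive_quotient_def)

lemma Hom_Q_E:
  assumes "F \<in> Hom Q A B"
  obtains f where "f \<in> Hom C A B" "F = res f"
proof -
  obtain f where f: "f \<in> Arr C" "F = res f"
    using assms by (auto simp: Hom_def additive_quotient_def)
  have "res f \<in> Hom Q (Dom C f) (Cod C f)" using res_in_Hom[OF Arr_Hom[OF f(1)]] .
  then have "Dom C f = A" "Cod C f = B" using assms f(2) by (auto simp: Hom_def)
  then show ?thesis using that f Arr_Hom by blast
qed

text \<open>Composition of classes uses representatives picked by \<open>SOME\<close>. Independence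
  of this choice is the splitting g' f' - g f = (g' - g) f' + g (f' - f) into two null
  terms.\<close>

lemma res_Cmp:
  assumes "f \<in> Hom C A B" "g \<in> Hom C B D"
  shows "res g \<bullet> res f = res (g \<cdot> f)"
proof -
  define f' where "f' = representative (res f)"
  define g' where "g' = representative (res g)"
  have h: "f' \<in> Hom C A B" "g' \<in> Hom C B D"
    unfolding f'_def g'_def using representative_res(1) assms by blast+
  have nf: "null (Sub f' f)" and ng: "null (Sub g' g)"
    using res_eq_iff[OF h(1) assms(1)] res_eq_iff[OF h(2) assms(2)]
      representative_res(2)[OF assms(1)] representative_res(2)[OF assms(2)]
    unfolding f'_def g'_def by blast+
  have "Add C (Sub (g' \<cdot> f') (g \<cdot> f')) (Sub (g \<cdot> f') (g \<cdot> f)) = Sub (g' \<cdot> f') (g \<cdot> f)"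
    using Sub_Sub_Add Cmp_in_Hom h assms by blast
  moreover have "null (Sub (g' \<cdot> f') (g \<cdot> f'))"
    using null_Cmp_right[OF ng h(1) Sub_in_Hom[OF h(2) assms(2)]] Cmp_Sub_left[OF h(1,2) assms(2)] by simp
  moreover have "null (Sub (g \<cdot> f') (g \<cdot> f))"
    using null_Cmp_left[OF nf Sub_in_Hom[OF h(1) assms(1)] assms(2)] Cmp_Sub_right[OF h(1) assms] by simp
  moreover have "Sub (g' \<cdot> f') (g \<cdot> f') \<in> Hom C A D" "Sub (g \<cdot> f') (g \<cdot> f) \<in> Hom C A D"
    using Sub_in_Hom Cmp_in_Hom h assms by blast+
  ultimately have "null (Sub (g' \<cdot> f') (g \<cdot> f))" using null_Add by metis
  then have "res (g' \<cdot> f') = res (g \<cdot> f)" using res_eq_iff Cmp_in_Hom h assms by blast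
  then show ?thesis by (simp add: additive_quotient_def f'_def g'_def)
qed

lemma res_Add:
  assumes "f \<in> Hom C A B" "g \<in> Hom C A B"
  shows "Add Q (res f) (res g) = res (Add C f g)"
proof -
  define f' where "f' = representative (res f)"
  define g' where "g' = representative (res g)"
  have h: "f' \<in> Hom C A B" "g' \<in> Hom C A B"
    unfolding f'_def g'_def using representative_res(1) assms by blast+
  have nf: "null (Sub f' f)" and ng: "null (Sub g' g)"
    using res_eq_iff[OF h(1) assms(1)] res_eq_iff[OF h(2) assms(2)]
      representative_res(2)[OF assms(1)] representative_res(2)[OF assms(2)]
    unfolding f'_def g'_def by blast+
  have "Add C (Sub f' f) (Sub g' g) = Add C (Sub (Add C f' g') (Add C f g')) (Sub (Add C f g') (Add C f g))"
  proof -
    have e1: "Sub (Add C f' g') (Add C f g') = Sub f' f"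
    proof -
      have "Add C (Sub f' f) (Add C f g') = Add C f' g'"
        using Add_assoc[OF Sub_in_Hom[OF h(1) assms(1)] assms(1) h(2)] Add_Sub(2)[OF h(1) assms(1)] by simp
      then show ?thesis
        using Sub_Add(1)[OF Sub_in_Hom[OF h(1) assms(1)] Add_in_Hom[OF assms(1) h(2)]] by simp
    qed
    have e2: "Sub (Add C f g') (Add C f g) = Sub g' g"
    proof -
      have "Add C (Add C f g) (Sub g' g) = Add C f g'"
        using Add_assoc[OF assms Sub_in_Hom[OF h(2) assms(2)]] Add_Sub(1)[OF h(2) assms(2)] by simp
      then show ?thesis
        using Sub_Add(2)[OF Sub_in_Hom[OF h(2) assms(2)] Add_in_Hom[OF assms]] by simp
    qed
    show ?thesis by (simp only: e1 e2)
  qed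
  also have "\<dots> = Sub (Add C f' g') (Add C f g)"
    using Sub_Sub_Add Add_in_Hom h assms by blast
  finally have "null (Sub (Add C f' g') (Add C f g))"
    using null_Add[OF nf ng Sub_in_Hom[OF h(1) assms(1)] Sub_in_Hom[OF h(2) assms(2)]] by simp
  then have "res (Add C f' g') = res (Add C f g)" using res_eq_iff Add_in_Hom h assms by blast
  then show ?thesis by (simp add: additive_quotient_def f'_def g'_def)
qed

lemma res_eq_Zero:
  assumes "f \<in> Hom C A B"
  shows "res f = res (Zero C A B) \<longleftrightarrow> null f"
proof -
  note z = Zero_in_Hom[OF Hom_Obj[OF assms]]
  have "Sub f (Zero C A B) = f"
    using Sub_Add(1)[OF assms z] Add_Zero(1)[OF assms] by simp
  then show ?thesis using res_eq_iff[OF assms z] by simp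
qed

lemma zero_object_Q:
  assumes "zero_object C Z"
  shows "zero_object Q Z"
proof -
  have Z: "Z \<in> Obj C" "\<And>A. A \<in> Obj C \<Longrightarrow> \<exists>!f. f \<in> Hom C Z A" "\<And>A. A \<in> Obj C \<Longrightarrow> \<exists>!f. f \<in> Hom C A Z"
    using assms unfolding zero_object_def by auto
  have "\<exists>!F. F \<in> Hom Q Z A" "\<exists>!F. F \<in> Hom Q A Z" if A: "A \<in> Obj C" for A
    using Z(2)[OF A] Z(3)[OF A] by (metis Hom_Q_E res_in_Hom)+
  then show ?thesis using Z(1) by (simp add: zero_object_def)
qed

lemma biproduct_Q: 
  assumes P: "biproduct C P A B"
  shows "biproduct Q P A B"
proof -
  obtain i j p q where b: "P \<in> Obj C" "A \<in> Obj C" "B \<in> Obj C"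
    "i \<in> Hom C A P" "j \<in> Hom C B P" "p \<in> Hom C P A" "q \<in> Hom C P B"
    "p \<cdot> i = Idn C A" "q \<cdot> j = Idn C B" "q \<cdot> i = Zero C A B" "p \<cdot> j = Zero C B A"
    "Add C (i \<cdot> p) (j \<cdot> q) = Idn C P"
    by (rule biproductE[OF P(1)])
  show ?thesis
    by (rule biproductI[where i = "res i" and j = "res j" and p = "res p" and q = "res q"])
      (simp_all add: b res_in_Hom res_Cmp[OF b(4,6)] res_Cmp[OF b(5,7)] res_Cmp[OF b(4,7)]
        res_Cmp[OF b(5,6)] res_Cmp[OF b(6,4)] res_Cmp[OF b(7,5)]
        res_Add[OF Cmp_in_Hom[OF b(6,4)] Cmp_in_Hom[OF b(7,5)]])
qed

lemma Q_additive: "additive_category Q"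
proof -
  interpret Q: category Q
  proof unfold_locales
    fix F assume F: "F \<in> Arr Q"
    then obtain f where f: "f \<in> Arr C" "F = res f" by (auto simp: additive_quotient_def)
    have h: "F \<in> Hom Q (Dom C f) (Cod C f)" using res_in_Hom[OF Arr_Hom[OF f(1)]] f(2) by simp
    show "Dom Q F \<in> Obj Q" "Cod Q F \<in> Obj Q"
      using h f(1) Dom_in_Obj Cod_in_Obj by (auto simp: Hom_def)
  next
    fix A assume "A \<in> Obj Q"
    then show "Idn Q A \<in> Hom Q A A" using res_in_Hom Idn_in_Hom by simp
  next
    fix F G A B D assume a: "F \<in> Hom Q A B" "G \<in> Hom Q B D"
    obtain f g where "f \<in> Hom C A B" "F = res f" "g \<in> Hom C B D" "G = res g"
      using a Hom_Q_E by metis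
    then show "G \<bullet> F \<in> Hom Q A D" using res_Cmp res_in_Hom Cmp_in_Hom by metis
  next
    fix F A B assume a: "F \<in> Hom Q A B"
    obtain f where f: "f \<in> Hom C A B" "F = res f" using a Hom_Q_E by metis
    then show "F \<bullet> Idn Q A = F" "Idn Q B \<bullet> F = F"
      using res_Cmp[OF Idn_in_Hom f(1)] res_Cmp[OF f(1) Idn_in_Hom] Hom_Obj[OF f(1)]
        Idn_left[OF f(1)] Idn_right[OF f(1)] by simp_all
  next
    fix F G K A B D E assume a: "F \<in> Hom Q A B" "G \<in> Hom Q B D" "K \<in> Hom Q D E"
    obtain f g k where h: "f \<in> Hom C A B" "g \<in> Hom C B D" "k \<in> Hom C D E"
      and e: "F = res f" "G = res g" "K = res k"
      using a Hom_Q_E by metis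
    show "K \<bullet> (G \<bullet> F) = (K \<bullet> G) \<bullet> F"
      by (simp only: e res_Cmp[OF h(1,2)] res_Cmp[OF h(2,3)] res_Cmp[OF Cmp_in_Hom[OF h(1,2)] h(3)]
          res_Cmp[OF h(1) Cmp_in_Hom[OF h(2,3)]] Cmp_assoc[OF h])
  qed
  interpret Q: preadditive_category Q
  proof (intro preadditive_category.intro preadditive_category_axioms.intro Q.category_axioms)
    fix A B assume "A \<in> Obj Q" "B \<in> Obj Q"
    then have ob: "A \<in> Obj C" "B \<in> Obj C" by simp_all
    show "comm_group (Hom_group Q A B)"
    proof (rule comm_groupI)
      fix F G assume "F \<in> carrier (Hom_group Q A B)" "G \<in> carrier (Hom_group Q A B)"
      then obtain f g where h: "f \<in> Hom C A B" "g \<in> Hom C A B" "F = res f" "G = res g"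
        unfolding Hom_group_def by (auto elim!: Hom_Q_E)
      show "F \<otimes>\<^bsub>Hom_group Q A B\<^esub> G \<in> carrier (Hom_group Q A B)"
        using h res_Add res_in_Hom Add_in_Hom by (simp add: Hom_group_def)
      show "F \<otimes>\<^bsub>Hom_group Q A B\<^esub> G = G \<otimes>\<^bsub>Hom_group Q A B\<^esub> F"
        unfolding h(3,4) Hom_group_def monoid.simps
        by (simp only: res_Add[OF h(1,2)] res_Add[OF h(2,1)] Add_commute[OF h(1,2)])
    next
      show "\<one>\<^bsub>Hom_group Q A B\<^esub> \<in> carrier (Hom_group Q A B)"
        using res_in_Hom Zero_in_Hom ob by (simp add: Hom_group_def)
    next
      fix F G K assume "F \<in> carrier (Hom_group Q A B)" "G \<in> carrier (Hom_group Q A B)"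
        "K \<in> carrier (Hom_group Q A B)"
      then obtain f g k where h: "f \<in> Hom C A B" "g \<in> Hom C A B" "k \<in> Hom C A B"
        and e: "F = res f" "G = res g" "K = res k"
        unfolding Hom_group_def by (auto elim!: Hom_Q_E)
      show "F \<otimes>\<^bsub>Hom_group Q A B\<^esub> G \<otimes>\<^bsub>Hom_group Q A B\<^esub> K
        = F \<otimes>\<^bsub>Hom_group Q A B\<^esub> (G \<otimes>\<^bsub>Hom_group Q A B\<^esub> K)"
        unfolding e Hom_group_def monoid.simps
        by (simp only: res_Add[OF h(1,2)] res_Add[OF h(2,3)] res_Add[OF Add_in_Hom[OF h(1,2)] h(3)]
          res_Add[OF h(1) Add_in_Hom[OF h(2,3)]] Add_assoc[OF h])
    next
      fix F assume "F \<in> carrier (Hom_group Q A B)"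
      then obtain f where f: "f \<in> Hom C A B" "F = res f"
        unfolding Hom_group_def by (auto elim!: Hom_Q_E)
      show "\<one>\<^bsub>Hom_group Q A B\<^esub> \<otimes>\<^bsub>Hom_group Q A B\<^esub> F = F"
        using res_Add[OF Zero_in_Hom[OF ob] f(1)] Add_Zero(2)[OF f(1)] f(2)
        by (simp add: Hom_group_def)
      show "\<exists>G\<in>carrier (Hom_group Q A B). G \<otimes>\<^bsub>Hom_group Q A B\<^esub> F = \<one>\<^bsub>Hom_group Q A B\<^esub>"
        using res_Add[OF Neg_in_Hom[OF f(1)] f(1)] Add_Neg(2)[OF f(1)] f(2) res_in_Hom[OF Neg_in_Hom[OF f(1)]]
        by (auto simp: Hom_group_def)
    qed
  next
    fix F G G' A B D assume a: "F \<in> Hom Q A B" "G \<in> Hom Q B D" "G' \<in> Hom Q B D"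
    obtain f g g' where h: "f \<in> Hom C A B" "g \<in> Hom C B D" "g' \<in> Hom C B D"
      and e: "F = res f" "G = res g" "G' = res g'"
      using a Hom_Q_E by metis
    show "Add Q G G' \<bullet> F = Add Q (G \<bullet> F) (G' \<bullet> F)"
      by (simp only: e res_Add[OF h(2,3)] res_Cmp[OF h(1) Add_in_Hom[OF h(2,3)]] res_Cmp[OF h(1,2)]
          res_Cmp[OF h(1,3)] res_Add[OF Cmp_in_Hom[OF h(1,2)] Cmp_in_Hom[OF h(1,3)]] Cmp_Add_left[OF h])
  next
    fix F F' G A B D assume a: "F \<in> Hom Q A B" "F' \<in> Hom Q A B" "G \<in> Hom Q B D"
    obtain f f' g where h: "f \<in> Hom C A B" "f' \<in> Hom C A B" "g \<in> Hom C B D"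
      and e: "F = res f" "F' = res f'" "G = res g"
      using a Hom_Q_E by metis
    show "G \<bullet> Add Q F F' = Add Q (G \<bullet> F) (G \<bullet> F')"
      by (simp only: e res_Add[OF h(1,2)] res_Cmp[OF Add_in_Hom[OF h(1,2)] h(3)] res_Cmp[OF h(1,3)]
          res_Cmp[OF h(2,3)] res_Add[OF Cmp_in_Hom[OF h(1,3)] Cmp_in_Hom[OF h(2,3)]] Cmp_Add_right[OF h])
  qed
  show ?thesis
  proof unfold_locales
    show "\<exists>Z. zero_object Q Z" using zero_object_Q ex_zero_object by blast
    show "\<And>A B. A \<in> Obj Q \<Longrightarrow> B \<in> Obj Q \<Longrightarrow> \<exists>P. biproduct Q P A B"
      using biproduct_Q ex_biproduct by (metis Obj_Q)
  qed
qed

end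

section \<open>Self-dual axioms for extensions\<close>

text \<open>
  In a triangulated category \<open>Ext Z A\<close> is \<open>Hom(Z, A[1])\<close>, and \<open>conf A B Z f g e\<close> says that
  \<open>A \<rightarrow> B \<rightarrow> Z \<rightarrow> A[1]\<close> is a distinguished triangle. Stated this way the axioms are invariant under
  passing to the opposite category, without inverting the shift. In \<open>ex5\<close> the obstruction to
  extending \<open>x\<close> along \<open>f\<close> is \<open>x[1] c[1] e = 0\<close>; the primed axioms are dual to the unprimed ones.
\<close>

locale ext_category = additive_category C
  for C :: "('o, 'm, 'x) addcat_scheme" (structure) +
  fixes Ext :: "'o \<Rightarrow> 'o \<Rightarrow> 'e set"
    and zer :: "'o \<Rightarrow> 'o \<Rightarrow> 'e"
    and push :: "'m \<Rightarrow> 'e \<Rightarrow> 'e"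
    and pull :: "'e \<Rightarrow> 'm \<Rightarrow> 'e"
    and conf :: "'o \<Rightarrow> 'o \<Rightarrow> 'o \<Rightarrow> 'm \<Rightarrow> 'm \<Rightarrow> 'e \<Rightarrow> bool"
  assumes zer_in: "\<lbrakk>Z \<in> Obj C; A \<in> Obj C\<rbrakk> \<Longrightarrow> zer Z A \<in> Ext Z A"
    and push_in: "\<lbrakk>e \<in> Ext Z A; f \<in> Hom C A B; Z \<in> Obj C\<rbrakk> \<Longrightarrow> push f e \<in> Ext Z B"
    and pull_in: "\<lbrakk>e \<in> Ext Z A; f \<in> Hom C B Z; A \<in> Obj C\<rbrakk> \<Longrightarrow> pull e f \<in> Ext B A"
    and push_Idn: "\<lbrakk>e \<in> Ext Z A; Z \<in> Obj C; A \<in> Obj C\<rbrakk> \<Longrightarrow> push (Idn C A) e = e"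
    and pull_Idn: "\<lbrakk>e \<in> Ext Z A; Z \<in> Obj C; A \<in> Obj C\<rbrakk> \<Longrightarrow> pull e (Idn C Z) = e"
    and push_Cmp: "\<lbrakk>e \<in> Ext Z A; f \<in> Hom C A B; g \<in> Hom C B D; Z \<in> Obj C\<rbrakk>
      \<Longrightarrow> push g (push f e) = push (g \<cdot> f) e"
    and pull_Cmp: "\<lbrakk>e \<in> Ext Z A; f \<in> Hom C B Z; g \<in> Hom C D B; A \<in> Obj C\<rbrakk>
      \<Longrightarrow> pull (pull e f) g = pull e (f \<cdot> g)"
    and push_pull: "\<lbrakk>e \<in> Ext Z A; f \<in> Hom C A B; g \<in> Hom C D Z\<rbrakk> \<Longrightarrow> pull (push f e) g = push f (pull e g)"
    and push_zer: "\<lbrakk>f \<in> Hom C A B; Z \<in> Obj C\<rbrakk> \<Longrightarrow> push f (zer Z A) = zer Z B"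
    and pull_zer: "\<lbrakk>f \<in> Hom C B Z; A \<in> Obj C\<rbrakk> \<Longrightarrow> pull (zer Z A) f = zer B A"
    and conf_Hom: "conf A B Z f g e \<Longrightarrow> f \<in> Hom C A B \<and> g \<in> Hom C B Z \<and> e \<in> Ext Z A"
    and realize: "\<lbrakk>e \<in> Ext Z A; Z \<in> Obj C; A \<in> Obj C\<rbrakk> \<Longrightarrow> \<exists>B f g. conf A B Z f g e"
    and inflation: "f \<in> Hom C A B \<Longrightarrow> \<exists>Z g e. conf A B Z f g e"
    and deflation: "g \<in> Hom C B Z \<Longrightarrow> \<exists>A f e. conf A B Z f g e"
    and conf_zero: "conf A B Z f g e \<Longrightarrow> g \<cdot> f = Zero C A Z"
    and conf_push: "conf A B Z f g e \<Longrightarrow> push f e = zer Z B"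
    and conf_pull: "conf A B Z f g e \<Longrightarrow> pull e g = zer B A"
    and ex1: "\<lbrakk>conf A B Z f g e; t \<in> Hom C B D; t \<cdot> f = Zero C A D\<rbrakk> \<Longrightarrow> \<exists>s\<in>Hom C Z D. s \<cdot> g = t"
    and ex1': "\<lbrakk>conf A B Z f g e; t \<in> Hom C D B; g \<cdot> t = Zero C D Z\<rbrakk> \<Longrightarrow> \<exists>s\<in>Hom C D A. f \<cdot> s = t"
    and ex2: "\<lbrakk>conf A B Z f g e; s \<in> Hom C A D; t \<in> Hom C A D; push s e = push t e\<rbrakk>
      \<Longrightarrow> \<exists>r\<in>Hom C B D. s = Add C t (r \<cdot> f)"
    and ex2': "\<lbrakk>conf A B Z f g e; s \<in> Hom C D Z; t \<in> Hom C D Z; pull e s = pull e t\<rbrakk>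
      \<Longrightarrow> \<exists>r\<in>Hom C D B. s = Add C t (g \<cdot> r)"
    and ex3: "\<lbrakk>conf A B Z f g e; x \<in> Ext Z D; D \<in> Obj C; pull x g = zer B D\<rbrakk>
      \<Longrightarrow> \<exists>t\<in>Hom C A D. push t e = x"
    and ex3': "\<lbrakk>conf A B Z f g e; x \<in> Ext D A; D \<in> Obj C; push f x = zer D B\<rbrakk>
      \<Longrightarrow> \<exists>t\<in>Hom C D Z. pull e t = x"
    and ex4: "\<lbrakk>conf A B Z f g e; x \<in> Ext B D; y \<in> Ext B D; D \<in> Obj C; pull x f = pull y f;
      \<forall>z\<in>Ext Z D. z = zer Z D\<rbrakk> \<Longrightarrow> x = y"
    and ex4': "\<lbrakk>conf A B Z f g e; x \<in> Ext D B; y \<in> Ext D B; D \<in> Obj C; push g x = push g y;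
      \<forall>z\<in>Ext D A. z = zer D A\<rbrakk> \<Longrightarrow> x = y"
    and ex5: "\<lbrakk>conf A B Z f g (push c e); c \<in> Hom C P A; e \<in> Ext Z P; x \<in> Ext A D; D \<in> Obj C;
      pull x c = zer P D\<rbrakk> \<Longrightarrow> \<exists>y\<in>Ext B D. pull y f = x"
    and ex5': "\<lbrakk>conf A B Z f g (pull e c); c \<in> Hom C Z P; e \<in> Ext P A; x \<in> Ext D Z; D \<in> Obj C;
      push c x = zer D P\<rbrakk> \<Longrightarrow> \<exists>y\<in>Ext D B. push g y = x"
    and ET4: "\<lbrakk>conf A B D f f' e; conf B B' E g g' x\<rbrakk>
      \<Longrightarrow> \<exists>M h y u v. conf A B' M (g \<cdot> f) h y \<and> conf D M E u v (push f' x) \<and> u \<cdot> f' = h \<cdot> g \<and> pull y u = e"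
    and ET4': "\<lbrakk>conf D B A f' f e; conf E B' B g' g x\<rbrakk>
      \<Longrightarrow> \<exists>M h y u v. conf M B' A h (f \<cdot> g) y \<and> conf E M D v u (pull x f') \<and> f' \<cdot> u = g \<cdot> h \<and> push u y = e"
    and PO: "\<lbrakk>conf A B D f f' e; conf A B' E g g' x\<rbrakk>
      \<Longrightarrow> \<exists>M m m' n n'. conf B M E m m' (push f x) \<and> conf B' M D n n' (push g e) \<and> m \<cdot> f = n \<cdot> g \<and> n' \<cdot> m = f'"
    and PB: "\<lbrakk>conf D B A f' f e; conf E B' A g' g x\<rbrakk>
      \<Longrightarrow> \<exists>M m m' n n'. conf E M B m' m (pull x f) \<and> conf D M B' n' n (pull e g) \<and> f \<cdot> m = g \<cdot> n \<and> m \<cdot> n' = f'"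
begin

lemma dual: "ext_category (op_cat C) (\<lambda>Z A. Ext A Z) (\<lambda>Z A. zer A Z) (\<lambda>f e. pull e f) (\<lambda>e f. push f e)
  (\<lambda>A B Z f g e. conf Z B A g f e)"
  apply (intro ext_category.intro ext_category_axioms.intro additive_op)
  apply unfold_locales
  apply (simp_all only: op_cat_simps Hom_op)
  subgoal by (rule zer_in)
  subgoal by (rule pull_in)
  subgoal by (rule push_in)
  subgoal by (rule pull_Idn)
  subgoal by (rule push_Idn)
  subgoal by (rule pull_Cmp)
  subgoal by (rule push_Cmp)
  subgoal using push_pull by fastforce
  subgoal by (rule pull_zer)
  subgoal by (rule push_zer)
  subgoal using conf_Hom by blast
  subgoal using realize by blast
  subgoal by (rule deflation)
  subgoal by (rule inflation)
  subgoal by (rule conf_zero)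
  subgoal by (rule conf_pull)
  subgoal by (rule conf_push)
  subgoal by (rule ex1')
  subgoal by (rule ex1)
  subgoal by (rule ex2')
  subgoal by (rule ex2)
  subgoal by (rule ex3')
  subgoal by (rule ex3)
  subgoal by (rule ex4')
  subgoal by (rule ex4)
  subgoal by (rule ex5')
  subgoal by (rule ex5)
  subgoal by (rule ET4')
  subgoal by (rule ET4)
  subgoal by (rule PB)
  subgoal by (rule PO)
  done

end

section \<open>Obstructions to lifting and extending; split extensions\<close>

context ext_category
begin

lemma confD:
  assumes "conf A B Z f g e"
  shows "f \<in> Hom C A B" "g \<in> Hom C B Z" "e \<in> Ext Z A" "A \<in> Obj C" "B \<in> Obj C" "Z \<in> Obj C"
  using conf_Hom[OF assms] Hom_Obj[of f A B] Hom_Obj[of g B Z] by auto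

text \<open>The axioms give \<open>Ext\<close> no addition, so the value at a zero map is found by
  factoring that map through \<open>g\<close>, along which \<open>e\<close> vanishes.\<close>

lemma pull_Zero:
  assumes "conf A B Z f g e" "D \<in> Obj C"
  shows "pull e (Zero C D Z) = zer D A"
proof -
  note c = confD[OF assms(1)]
  note z = Zero_in_Hom[OF assms(2) c(5)]
  have "pull e (Zero C D Z) = pull (pull e g) (Zero C D B)"
    using Cmp_Zero(2)[OF c(2) assms(2)] pull_Cmp[OF c(3) c(2) z c(4)] by simp
  also have "\<dots> = zer D A" using conf_pull[OF assms(1)] pull_zer[OF z c(4)] by simp
  finally show ?thesis .
qed

text \<open>\<open>ex2'\<close> compares \<open>t\<close> with the zero map. Together with
  \<open>UV_zer\<close> and the dual \<open>extend_iff\<close> this is the working tool: whenever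
  the obstruction lies in Ext(U, V), the lift or the extension exists.\<close>

lemma lift_iff:
  assumes c: "conf A B Z f g e" and t: "t \<in> Hom C D Z"
  shows "(\<exists>s\<in>Hom C D B. g \<cdot> s = t) \<longleftrightarrow> pull e t = zer D A"
proof
  note h = confD[OF c]
  assume "\<exists>s\<in>Hom C D B. g \<cdot> s = t"
  then obtain s where s: "s \<in> Hom C D B" "g \<cdot> s = t" by blast
  then show "pull e t = zer D A"
    using pull_Cmp[OF h(3,2) s(1) h(4)] conf_pull[OF c] pull_zer[OF s(1) h(4)] by simp
next
  note h = confD[OF c]
  assume a: "pull e t = zer D A"
  have D: "D \<in> Obj C" using Hom_Obj t by blast
  obtain r where r: "r \<in> Hom C D B" "t = Add C (Zero C D Z) (g \<cdot> r)"
    using ex2'[OF c t Zero_in_Hom[OF D h(6)]] a pull_Zero[OF c D] by auto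
  then have "g \<cdot> r = t" using Add_Zero(2)[OF Cmp_in_Hom[OF r(1) h(2)]] by simp
  then show "\<exists>s\<in>Hom C D B. g \<cdot> s = t" using r(1) by blast
qed

lemma extend_iff:
  assumes c: "conf A B Z f g e" and t: "t \<in> Hom C A D"
  shows "(\<exists>s\<in>Hom C B D. s \<cdot> f = t) \<longleftrightarrow> push t e = zer Z D"
  using ext_category.lift_iff[OF dual, OF c] t by simp

text \<open>Additivity of \<open>pull\<close> is replaced by additivity of lifts: realize
  \<open>e\<close>, lift both maps, and add the lifts.\<close>

lemma pull_Add_zer:
  assumes e: "e \<in> Ext Z A" "Z \<in> Obj C" "A \<in> Obj C" and h: "s \<in> Hom C D Z" "t \<in> Hom C D Z"
    and z: "pull e s = zer D A" "pull e t = zer D A"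
  shows "pull e (Add C s t) = zer D A"
proof -
  obtain B f g where c: "conf A B Z f g e" using realize e by blast
  note cd = confD[OF c]
  obtain s' t' where l: "s' \<in> Hom C D B" "g \<cdot> s' = s" "t' \<in> Hom C D B" "g \<cdot> t' = t"
    using lift_iff[OF c] h z by blast
  have "g \<cdot> Add C s' t' = Add C s t" using Cmp_Add_right[OF l(1,3) cd(2)] l by simp
  then show ?thesis using lift_iff[OF c Add_in_Hom[OF h]] Add_in_Hom[OF l(1,3)] by blast
qed

lemma push_Add_zer:
  assumes e: "e \<in> Ext Z A" "Z \<in> Obj C" "A \<in> Obj C" and h: "s \<in> Hom C A D" "t \<in> Hom C A D"
    and z: "push s e = zer Z D" "push t e = zer Z D"
  shows "push (Add C s t) e = zer Z D"
  using ext_category.pull_Add_zer[OF dual, of e Z A s D t] assms by simp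

text \<open>The zero class provides a retraction \<open>p\<close> of \<open>i\<close> and a section
  \<open>k\<close> of \<open>q\<close>. As \<open>p \<cdot> k\<close> may be nonzero, the second
  inclusion is not \<open>k\<close> but the map \<open>j\<close> through which 1 - i p
  factors.\<close>

lemma split_biproduct:
  assumes c: "conf A B Z i q (zer Z A)"
  shows "biproduct C B A Z"
proof -
  note cd = confD[OF c]
  obtain p where p: "p \<in> Hom C B A" "p \<cdot> i = Idn C A"
    using extend_iff[OF c Idn_in_Hom[OF cd(4)]] push_zer[OF Idn_in_Hom[OF cd(4)] cd(6)] by blast
  obtain k where k: "k \<in> Hom C Z B" "q \<cdot> k = Idn C Z"
    using lift_iff[OF c Idn_in_Hom[OF cd(6)]] pull_zer[OF Idn_in_Hom[OF cd(6)] cd(4)] by blast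
  note ip = Cmp_in_Hom[OF p(1) cd(1)] and one = Idn_in_Hom[OF cd(5)]
  note s = Sub_in_Hom[OF one ip]
  have "(i \<cdot> p) \<cdot> i = i"
    using Cmp_assoc[OF cd(1) p(1) cd(1)] p(2) Idn_right[OF cd(1)] by simp
  then have "Sub (Idn C B) (i \<cdot> p) \<cdot> i = Zero C A B"
    using Cmp_Sub_left[OF cd(1) one ip] Idn_left[OF cd(1)] Sub_eq_Zero[OF cd(1) cd(1)] by simp
  then obtain j where j: "j \<in> Hom C Z B" "j \<cdot> q = Sub (Idn C B) (i \<cdot> p)"
    using ex1[OF c s] by blast
  have sum: "Add C (i \<cdot> p) (j \<cdot> q) = Idn C B"
    using Add_Sub(1)[OF one ip] j(2) by simp
  note jq = Cmp_in_Hom[OF cd(2) j(1)]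
  have pj: "p \<cdot> j = Zero C Z A"
  proof -
    have "p \<cdot> (i \<cdot> p) = p" using Cmp_assoc[OF p(1) cd(1) p(1)] p(2) Idn_left[OF p(1)] by simp
    then have "p \<cdot> (j \<cdot> q) = Zero C B A"
      using j(2) Cmp_Sub_right[OF one ip p(1)] Idn_right[OF p(1)] Sub_eq_Zero[OF p(1) p(1)] by simp
    then have "(p \<cdot> j) \<cdot> q = Zero C B A" using Cmp_assoc[OF cd(2) j(1) p(1)] by simp
    then have "((p \<cdot> j) \<cdot> q) \<cdot> k = Zero C Z A" using Cmp_Zero(1)[OF k(1) cd(4)] by simp
    then show ?thesis
      using Cmp_assoc[OF k(1) cd(2) Cmp_in_Hom[OF j(1) p(1)]] k(2) Idn_right[OF Cmp_in_Hom[OF j(1) p(1)]]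
      by simp
  qed
  note qi = conf_zero[OF c]
  have "q = Add C (q \<cdot> (i \<cdot> p)) (q \<cdot> (j \<cdot> q))"
    using Cmp_Add_right[OF ip jq cd(2)] sum Idn_right[OF cd(2)] by simp
  also have "q \<cdot> (i \<cdot> p) = Zero C B Z"
    using Cmp_assoc[OF p(1) cd(1,2)] qi Cmp_Zero(1)[OF p(1) cd(6)] by simp
  finally have "q \<cdot> (j \<cdot> q) = q"
    using Add_Zero(2)[OF Cmp_in_Hom[OF jq cd(2)]] by simp
  then have "(q \<cdot> j) \<cdot> q = q" using Cmp_assoc[OF cd(2) j(1) cd(2)] by simp
  then have "(q \<cdot> j) \<cdot> (q \<cdot> k) = q \<cdot> k"
    using Cmp_assoc[OF k(1) cd(2) Cmp_in_Hom[OF j(1) cd(2)]] by simp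
  then have qj: "q \<cdot> j = Idn C Z" using k(2) Idn_right[OF Cmp_in_Hom[OF j(1) cd(2)]] by simp
  show ?thesis
    by (rule biproductI[OF cd(5) cd(4) cd(6) cd(1) j(1) p(1) cd(2) p(2) qj qi pj sum])
qed

end

section \<open>Cotorsion pairs\<close>

text \<open>In the intended instance U is X[1] and V is Y, so that Hom(X, Y) = 0 becomes Ext(U, V) =
  0. This form is symmetric under reversing arrows and exchanging U and V; \<open>W\<close> is a
  parameter so that both instances share it.\<close>

locale cotorsion = ext_category C Ext zer push pull conf
  for C :: "('o, 'm, 'x) addcat_scheme" (structure)
    and Ext :: "'o \<Rightarrow> 'o \<Rightarrow> 'e set" and zer push pull conf +
  fixes U V W :: "'o set"
  assumes W_def: "W = U \<inter> V"
    and U_Obj: "A \<in> U \<Longrightarrow> A \<in> Obj C"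
    and V_Obj: "A \<in> V \<Longrightarrow> A \<in> Obj C"
    and UV_zer: "\<lbrakk>u \<in> U; v \<in> V; e \<in> Ext u v\<rbrakk> \<Longrightarrow> e = zer u v"
    and ex_VU: "A \<in> Obj C \<Longrightarrow> \<exists>v\<in>V. \<exists>u\<in>U. \<exists>f g e. conf v u A f g e"
    and ex_UV: "A \<in> Obj C \<Longrightarrow> \<exists>u\<in>U. \<exists>v\<in>V. \<exists>f g e. conf A v u f g e"
    and U_perp: "\<lbrakk>A \<in> Obj C; \<And>v e. v \<in> V \<Longrightarrow> e \<in> Ext A v \<Longrightarrow> e = zer A v\<rbrakk> \<Longrightarrow> A \<in> U"
    and V_perp: "\<lbrakk>A \<in> Obj C; \<And>u e. u \<in> U \<Longrightarrow> e \<in> Ext u A \<Longrightarrow> e = zer u A\<rbrakk> \<Longrightarrow> A \<in> V"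
begin

lemma dual_cotorsion: "cotorsion (op_cat C) (\<lambda>Z A. Ext A Z) (\<lambda>Z A. zer A Z) (\<lambda>f e. pull e f)
  (\<lambda>e f. push f e) (\<lambda>A B Z f g e. conf Z B A g f e) V U W"
  apply (intro cotorsion.intro dual cotorsion_axioms.intro)
  apply (simp_all only: op_cat_simps)
  subgoal using W_def by blast
  subgoal by (rule V_Obj)
  subgoal by (rule U_Obj)
  subgoal by (rule UV_zer)
  subgoal using ex_UV by blast
  subgoal using ex_VU by blast
  subgoal by (rule V_perp)
  subgoal by (rule U_perp)
  done

lemma U_biproduct:
  assumes "biproduct C P A B" "A \<in> U" "B \<in> U"
  shows "P \<in> U"
proof -
  obtain i j p q where b: "P \<in> Obj C" "A \<in> Obj C" "B \<in> Obj C"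
    "i \<in> Hom C A P" "j \<in> Hom C B P" "p \<in> Hom C P A" "q \<in> Hom C P B"
    "p \<cdot> i = Idn C A" "q \<cdot> j = Idn C B" "q \<cdot> i = Zero C A B" "p \<cdot> j = Zero C B A"
    "Add C (i \<cdot> p) (j \<cdot> q) = Idn C P"
    by (rule biproductE[OF assms(1)])
  show ?thesis
  proof (rule U_perp[OF b(1)])
    fix v e assume v: "v \<in> V" and e: "e \<in> Ext P v"
    note vo = V_Obj[OF v]
    have "pull e i = zer A v" "pull e j = zer B v"
      using UV_zer[OF assms(2) v pull_in[OF e b(4) vo]] UV_zer[OF assms(3) v pull_in[OF e b(5) vo]] .
    then have "pull e (i \<cdot> p) = zer P v" "pull e (j \<cdot> q) = zer P v"
      using pull_Cmp[OF e b(4,6) vo] pull_Cmp[OF e b(5,7) vo] pull_zer[OF b(6) vo] pull_zer[OF b(7) vo]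
      by simp_all
    then show "e = zer P v"
      using pull_Add_zer[OF e b(1) vo Cmp_in_Hom[OF b(6,4)] Cmp_in_Hom[OF b(7,5)]] b(12)
        pull_Idn[OF e b(1) vo] by simp
  qed
qed

lemma V_biproduct:
  assumes "biproduct C P A B" "A \<in> V" "B \<in> V"
  shows "P \<in> V"
  using cotorsion.U_biproduct[OF dual_cotorsion, of P A B] assms by simp

lemma U_zero:
  assumes "zero_object C Z"
  shows "Z \<in> U"
proof (rule U_perp)
  show Z: "Z \<in> Obj C" using assms by (simp add: zero_object_def)
  fix v e assume v: "v \<in> V" and e: "e \<in> Ext Z v"
  obtain B f g where c: "conf v B Z f g e" using realize e Z V_Obj[OF v] by blast
  have "\<exists>!f. f \<in> Hom C Z Z" using assms Z by (simp add: zero_object_def)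
  then have "Idn C Z = Zero C Z Z" using Idn_in_Hom[OF Z] Zero_in_Hom[OF Z Z] by blast
  then show "e = zer Z v" using pull_Zero[OF c Z] pull_Idn[OF e Z V_Obj[OF v]] by simp
qed

lemma V_zero: "zero_object C Z \<Longrightarrow> Z \<in> V"
  using cotorsion.U_zero[OF dual_cotorsion, of Z] by simp

sublocale additive_ideal C W
proof unfold_locales
  show "W \<subseteq> Obj C" using W_def U_Obj by blast
  show "\<exists>Z\<in>W. zero_object C Z" using ex_zero_object U_zero V_zero W_def by blast
  show "\<And>A B. A \<in> W \<Longrightarrow> B \<in> W \<Longrightarrow> \<exists>P\<in>W. biproduct C P A B"
    using ex_biproduct U_biproduct V_biproduct U_Obj W_def by (metis IntD1 IntD2 IntI)
qed

section \<open>Objects of C^+ and C^- and maps that vanish modulo W\<close>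

text \<open>Since no triangle has to be exhibited, closure under extensions by V, biproducts and
  retracts modulo W become computations with \<open>push\<close> and \<open>pull\<close>.\<close>

definition ext_plus :: "'o set" where
  "ext_plus = {D \<in> Obj C. \<forall>u1\<in>U. \<forall>u2\<in>U. \<forall>e\<in>Ext u1 u2. \<forall>c\<in>Hom C u2 D. push c e = zer u1 D}"

definition ext_minus :: "'o set" where
  "ext_minus = {D \<in> Obj C. \<forall>v1\<in>V. \<forall>v2\<in>V. \<forall>e\<in>Ext v2 v1. \<forall>c\<in>Hom C D v2. pull e c = zer D v1}"

abbreviation hrt :: "'o set" where "hrt \<equiv> ext_plus \<inter> ext_minus"

lemma plus_Obj: "A \<in> ext_plus \<Longrightarrow> A \<in> Obj C"
  by (simp add: ext_plus_def)

lemma minus_Obj: "A \<in> ext_minus \<Longrightarrow> A \<in> Obj C"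
  by (simp add: ext_minus_def)

lemma plusD: "\<lbrakk>D \<in> ext_plus; u1 \<in> U; u2 \<in> U; e \<in> Ext u1 u2; c \<in> Hom C u2 D\<rbrakk> \<Longrightarrow> push c e = zer u1 D"
  by (simp add: ext_plus_def)

lemma minusD: "\<lbrakk>D \<in> ext_minus; v1 \<in> V; v2 \<in> V; e \<in> Ext v2 v1; c \<in> Hom C D v2\<rbrakk> \<Longrightarrow> pull e c = zer D v1"
  by (simp add: ext_minus_def)

text \<open>Serves as a rewrite rule: with \<open>dual_minus\<close> it turns results of the dual
  instance into results about the exchanged classes.\<close>

lemma dual_plus: "cotorsion.ext_plus (op_cat C) (\<lambda>Z A. Ext A Z) (\<lambda>Z A. zer A Z) (\<lambda>f e. pull e f) V = ext_minus"
  unfolding cotorsion.ext_plus_def[OF dual_cotorsion] ext_minus_def by simp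

lemma dual_minus: "cotorsion.ext_minus (op_cat C) (\<lambda>Z A. Ext A Z) (\<lambda>Z A. zer A Z) (\<lambda>e f. push f e) U = ext_plus"
  unfolding cotorsion.ext_minus_def[OF dual_cotorsion] ext_plus_def by simp

text \<open>In A \<rightarrow> v \<rightarrow> u the middle term lies in U: restriction along A
  \<rightarrow> v is injective on Ext(-, V) because Ext(u, V) = 0, and every restricted class
  vanishes by the condition on A.\<close>

lemma minus_conf:
  assumes "A \<in> ext_minus"
  shows "\<exists>w\<in>W. \<exists>u\<in>U. \<exists>f g e. conf A w u f g e"
proof -
  obtain u v f g e where u: "u \<in> U" and v: "v \<in> V" and c: "conf A v u f g e"
    using ex_UV minus_Obj assms by blast
  note cd = confD[OF c]
  have "v \<in> U"
  proof (rule U_perp[OF V_Obj[OF v]])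
    fix v1 x assume v1: "v1 \<in> V" and x: "x \<in> Ext v v1"
    note o = V_Obj[OF v1]
    have "pull x f = pull (zer v v1) f"
      using minusD[OF assms v1 v x cd(1)] pull_zer[OF cd(1) o] by simp
    then show "x = zer v v1"
      using ex4[OF c x zer_in[OF cd(5) o] o] UV_zer[OF u v1] by blast
  qed
  then show ?thesis using u v c W_def by blast
qed

text \<open>A map A \<rightarrow> v2 extends to \<open>w\<close> since Ext(u, v2) = 0, and Ext(w,
  v1) = 0 because W is contained in U.\<close>

lemma minusI_conf:
  assumes w: "w \<in> W" and u: "u \<in> U" and c: "conf A w u f g e"
  shows "A \<in> ext_minus"
proof -
  note cd = confD[OF c]
  have "pull x t = zer A v1" if v: "v1 \<in> V" "v2 \<in> V" "x \<in> Ext v2 v1" "t \<in> Hom C A v2" for v1 v2 x t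
  proof -
    note o = V_Obj[OF v(1)]
    have "push t e = zer u v2" using UV_zer[OF u v(2) push_in[OF cd(3) v(4) cd(6)]] .
    then obtain s where s: "s \<in> Hom C w v2" "s \<cdot> f = t" using extend_iff[OF c v(4)] by blast
    have "pull x s = zer w v1" using UV_zer[OF _ v(1) pull_in[OF v(3) s(1) o]] w W_def by blast
    then show ?thesis using pull_Cmp[OF v(3) s(1) cd(1) o] pull_zer[OF cd(1) o] s(2) by simp
  qed
  then show ?thesis using cd(4) by (simp add: ext_minus_def)
qed

lemma plus_conf:
  assumes "A \<in> ext_plus"
  shows "\<exists>w\<in>W. \<exists>v\<in>V. \<exists>f g e. conf v w A f g e"
  using cotorsion.minus_conf[OF dual_cotorsion, unfolded dual_minus, OF assms] by blast

lemma plusI_conf: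
  assumes "w \<in> W" "v \<in> V" "conf v w A f g e"
  shows "A \<in> ext_plus"
  using cotorsion.minusI_conf[OF dual_cotorsion, unfolded dual_minus, of w v A f g e] assms by simp

text \<open>For v \<rightarrow> w \<rightarrow> D the obstruction to lifting \<open>t\<close> to
  \<open>w\<close> lies in Ext(u, v) = 0.\<close>

lemma U_to_plus_null:
  assumes "u \<in> U" "D \<in> ext_plus" "t \<in> Hom C u D"
  shows "null t"
proof -
  obtain w v f g e where w: "w \<in> W" and v: "v \<in> V" and c: "conf v w D f g e"
    using plus_conf assms(2) by blast
  note cd = confD[OF c]
  have "pull e t = zer u v" using UV_zer[OF assms(1) v pull_in[OF cd(3) assms(3) cd(4)]] .
  then obtain s where "s \<in> Hom C u w" "g \<cdot> s = t" using lift_iff[OF c assms(3)] by blast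
  then show ?thesis using nullI[OF w _ cd(2)] by blast
qed

lemma minus_to_V_null:
  assumes "v \<in> V" "D \<in> ext_minus" "t \<in> Hom C D v"
  shows "null t"
  using cotorsion.U_to_plus_null[OF dual_cotorsion, unfolded dual_plus, of v D t] assms by simp

text \<open>Restriction along \<open>f\<close> is injective on Ext(N, v1), because Ext(u, v1) = 0;
  so the vanishing condition can be tested on \<open>A\<close>.\<close>

lemma conf_U_minus:
  assumes c: "conf A N u f g e" and u: "u \<in> U" and A: "A \<in> ext_minus"
  shows "N \<in> ext_minus"
proof -
  note cd = confD[OF c]
  have "pull x t = zer N v1" if v: "v1 \<in> V" "v2 \<in> V" "x \<in> Ext v2 v1" "t \<in> Hom C N v2" for v1 v2 x t
  proof -
    note o = V_Obj[OF v(1)]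
    have "pull (pull x t) f = zer A v1"
      using pull_Cmp[OF v(3,4) cd(1) o] minusD[OF A v(1-3) Cmp_in_Hom[OF cd(1) v(4)]] by simp
    also have "\<dots> = pull (zer N v1) f" using pull_zer[OF cd(1) o] by simp
    finally show ?thesis
      using ex4[OF c pull_in[OF v(3,4) o] zer_in[OF cd(5) o] o] UV_zer[OF u v(1)] by blast
  qed
  then show ?thesis using cd(5) by (simp add: ext_minus_def)
qed

lemma conf_V_plus:
  assumes "conf v N A f g e" "v \<in> V" "A \<in> ext_plus"
  shows "N \<in> ext_plus"
  using cotorsion.conf_U_minus[OF dual_cotorsion, unfolded dual_minus, of v N A f g e] assms by blast

text \<open>A factorization of \<open>t \<cdot> f\<close> through W extends from \<open>A\<close> to
  \<open>N\<close>, as Ext(u, w) = 0. After subtracting it, \<open>t\<close> kills \<open>f\<close>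
  and factors through \<open>u\<close>, and maps from U to \<open>ext_plus\<close> are null. This is
  the source of all uniqueness statements for reflections and cokernels.\<close>

lemma conf_U_null:
  assumes c: "conf A N u f g e" and u: "u \<in> U" and D: "D \<in> ext_plus" and t: "t \<in> Hom C N D"
    and n: "null (t \<cdot> f)"
  shows "null t"
proof -
  note cd = confD[OF c]
  obtain w a b where w: "w \<in> W" "a \<in> Hom C A w" "b \<in> Hom C w D" "t \<cdot> f = b \<cdot> a"
    by (rule nullE[OF n Cmp_in_Hom[OF cd(1) t]])
  have "push a e = zer u w" using UV_zer[OF u _ push_in[OF cd(3) w(2) cd(6)]] w(1) W_def by blast
  then obtain a' where a': "a' \<in> Hom C N w" "a' \<cdot> f = a" using extend_iff[OF c w(2)] by blast
  note ba = Cmp_in_Hom[OF a'(1) w(3)]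
  have "(b \<cdot> a') \<cdot> f = t \<cdot> f" using Cmp_assoc[OF cd(1) a'(1) w(3)] a'(2) w(4) by simp
  then have "Sub t (b \<cdot> a') \<cdot> f = Zero C A D"
    using Cmp_Sub_left[OF cd(1) t ba] Sub_eq_Zero[OF Cmp_in_Hom[OF cd(1) t] Cmp_in_Hom[OF cd(1) t]]
    by simp
  then obtain s where s: "s \<in> Hom C u D" "s \<cdot> g = Sub t (b \<cdot> a')"
    using ex1[OF c Sub_in_Hom[OF t ba]] by blast
  have "null (s \<cdot> g)" using null_Cmp_right[OF U_to_plus_null[OF u D s(1)] cd(2) s(1)] .
  then have "null (Add C (Sub t (b \<cdot> a')) (b \<cdot> a'))"
    using null_Add[OF _ nullI[OF w(1) a'(1) w(3)] Sub_in_Hom[OF t ba] ba] s(2) by simp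
  then show ?thesis using Add_Sub(2)[OF t ba] by simp
qed

text \<open>
  With \<open>S = u'[-1]\<close> this is the triangle \<open>S \<rightarrow> A \<rightarrow> N \<rightarrow> S[1]\<close> defining a reflection; that its class is
  \<open>push c e\<close> means that \<open>S \<rightarrow> A\<close> factors through \<open>c\<close>.
\<close>

definition Rplus :: "'o \<Rightarrow> 'o \<Rightarrow> 'm \<Rightarrow> bool" where
  "Rplus A N z \<longleftrightarrow> N \<in> ext_plus \<and>
     (\<exists>u\<in>U. \<exists>u'\<in>U. \<exists>z' c e. c \<in> Hom C u A \<and> e \<in> Ext u' u \<and> conf A N u' z z' (push c e))"

definition Rminus :: "'o \<Rightarrow> 'o \<Rightarrow> 'm \<Rightarrow> bool" where
  "Rminus A N z \<longleftrightarrow> N \<in> ext_minus \<and>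
     (\<exists>v\<in>V. \<exists>v'\<in>V. \<exists>z' c e. c \<in> Hom C A v \<and> e \<in> Ext v v' \<and> conf v' N A z' z (pull e c))"

lemma dual_Rplus: "cotorsion.Rplus (op_cat C) (\<lambda>Z A. Ext A Z) (\<lambda>Z A. zer A Z) (\<lambda>f e. pull e f)
  (\<lambda>A B Z f g e. conf Z B A g f e) V = Rminus"
  by (intro ext) (simp add: cotorsion.Rplus_def[OF dual_cotorsion] dual_plus Rminus_def)

lemma RplusE:
  assumes "Rplus A N z"
  obtains u u' z' c e where "N \<in> ext_plus" "u \<in> U" "u' \<in> U" "c \<in> Hom C u A" "e \<in> Ext u' u"
    "conf A N u' z z' (push c e)"
  using assms unfolding Rplus_def by blast

lemma RplusI:
  assumes "N \<in> ext_plus" "u \<in> U" "u' \<in> U" "c \<in> Hom C u A" "e \<in> Ext u' u" "conf A N u' z z' (push c e)"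
  shows "Rplus A N z"
  using assms unfolding Rplus_def by blast

lemma RminusE:
  assumes "Rminus A N z"
  obtains v v' z' c e where "N \<in> ext_minus" "v \<in> V" "v' \<in> V" "c \<in> Hom C A v" "e \<in> Ext v v'"
    "conf v' N A z' z (pull e c)"
  using assms unfolding Rminus_def by blast

lemma RminusI:
  assumes "N \<in> ext_minus" "v \<in> V" "v' \<in> V" "c \<in> Hom C A v" "e \<in> Ext v v'" "conf v' N A z' z (pull e c)"
  shows "Rminus A N z"
  using assms unfolding Rminus_def by blast

lemma Rplus_Hom:
  assumes "Rplus A N z"
  shows "z \<in> Hom C A N" "N \<in> ext_plus"
  using assms confD(1) by (blast elim: RplusE)+

lemma Rminus_Hom:
  assumes "Rminus A N z"
  shows "z \<in> Hom C N A" "N \<in> ext_minus"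
  using assms confD(2) by (blast elim: RminusE)+

text \<open>The obstruction to extending \<open>t\<close> is the composite u' \<rightarrow> u[1]
  \<rightarrow> D[1], of exactly the kind that vanishes for \<open>D\<close> in
  \<open>ext_plus\<close>.\<close>

lemma Rplus_extend:
  assumes "Rplus A N z" "D \<in> ext_plus" "t \<in> Hom C A D"
  shows "\<exists>s\<in>Hom C N D. s \<cdot> z = t"
proof -
  obtain u u' z' c e where r: "N \<in> ext_plus" "u \<in> U" "u' \<in> U" "c \<in> Hom C u A" "e \<in> Ext u' u"
    "conf A N u' z z' (push c e)" by (rule RplusE[OF assms(1)])
  have "push t (push c e) = zer u' D"
    using push_Cmp[OF r(5,4) assms(3) U_Obj[OF r(3)]] plusD[OF assms(2) r(3,2,5)] Cmp_in_Hom[OF r(4) assms(3)]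
    by simp
  then show ?thesis using extend_iff[OF r(6) assms(3)] by blast
qed

lemma Rplus_null:
  assumes "Rplus A N z" "D \<in> ext_plus" "t \<in> Hom C N D" "null (t \<cdot> z)"
  shows "null t"
proof -
  obtain u u' z' c e where r: "u' \<in> U" "conf A N u' z z' (push c e)" by (rule RplusE[OF assms(1)])
  show ?thesis by (rule conf_U_null[OF r(2,1) assms(2-4)])
qed

lemma Rminus_lift:
  assumes "Rminus A N z" "D \<in> ext_minus" "t \<in> Hom C D A"
  shows "\<exists>s\<in>Hom C D N. z \<cdot> s = t"
  using cotorsion.Rplus_extend[OF dual_cotorsion, unfolded dual_plus dual_Rplus, of A N z D t] assms
  by simp

lemma Rminus_null:
  assumes "Rminus A N z" "D \<in> ext_minus" "t \<in> Hom C D N" "null (z \<cdot> t)"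
  shows "null t"
  using cotorsion.Rplus_null[OF dual_cotorsion, unfolded dual_plus dual_Rplus, of A N z D t] assms
  by simp

lemma Rplus_minus:
  assumes "Rplus A N z" "A \<in> ext_minus"
  shows "N \<in> ext_minus"
proof -
  obtain u u' z' c e where r: "u' \<in> U" "conf A N u' z z' (push c e)" by (rule RplusE[OF assms(1)])
  show ?thesis by (rule conf_U_minus[OF r(2,1) assms(2)])
qed

text \<open>From v \<rightarrow> u \<rightarrow> A and u \<rightarrow> v' \<rightarrow> u' one takes
  for \<open>N\<close> the cone of v \<rightarrow> v'. The octahedron puts it into A \<rightarrow> N
  \<rightarrow> u' with class u' \<rightarrow> u[1] \<rightarrow> A[1]. Maps from U to
  \<open>N\<close> lift to \<open>v'\<close> because Ext(U, v) = 0, and Ext(U, v') = 0 then gives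
  membership in \<open>ext_plus\<close>.\<close>

lemma Rplus_exists:
  assumes A: "A \<in> Obj C"
  shows "\<exists>N z. Rplus A N z"
proof -
  obtain v u f c e where v: "v \<in> V" "u \<in> U" and c1: "conf v u A f c e" using ex_VU A by blast
  obtain u' v' g g' x where u': "u' \<in> U" "v' \<in> V" and c2: "conf u v' u' g g' x"
    using ex_UV U_Obj v(2) by blast
  obtain N h y z z' where N: "conf v v' N (g \<cdot> f) h y" "conf A N u' z z' (push c x)"
    using ET4[OF c1 c2] by blast
  note cd = confD[OF N(1)]
  have "push t k = zer u1 N" if u: "u1 \<in> U" "u2 \<in> U" "k \<in> Ext u1 u2" "t \<in> Hom C u2 N" for u1 u2 k t
  proof -
    have "pull y t = zer u2 v" using UV_zer[OF u(2) v(1) pull_in[OF cd(3) u(4) cd(4)]] .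
    then obtain s where s: "s \<in> Hom C u2 v'" "h \<cdot> s = t" using lift_iff[OF N(1) u(4)] by blast
    have "push s k = zer u1 v'" using UV_zer[OF u(1) u'(2) push_in[OF u(3) s(1) U_Obj[OF u(1)]]] .
    then show ?thesis
      using push_Cmp[OF u(3) s(1) cd(2) U_Obj[OF u(1)]] push_zer[OF cd(2) U_Obj[OF u(1)]] s(2) by simp
  qed
  then have "N \<in> ext_plus" using cd(6) by (simp add: ext_plus_def)
  then show ?thesis using RplusI[OF _ v(2) u'(1) confD(2)[OF c1] confD(3)[OF c2] N(2)] by blast
qed

lemma Rminus_exists: "A \<in> Obj C \<Longrightarrow> \<exists>N z. Rminus A N z"
  using cotorsion.Rplus_exists[OF dual_cotorsion, unfolded dual_Rplus, of A] by simp

text \<open>With \<open>v'\<close> the fibre of \<open>m\<close>, the object \<open>N\<close> is the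
  cone of v' \<rightarrow> M \<rightarrow> P. Hence \<open>z\<close> has the same third term
  \<open>u'\<close> as \<open>z'\<close>, and \<open>n\<close> the same fibre \<open>v'\<close> as
  \<open>m\<close>. It remains to see that \<open>N\<close> is in \<open>ext_plus\<close> and that
  both classes factor as \<open>Rplus\<close> and \<open>Rminus\<close> demand.\<close>

lemma Rminus_Rplus_square:
  assumes A: "A \<in> Obj C"
  shows "\<exists>M P N m z z' n. Rminus A M m \<and> Rplus A N z \<and> Rplus M P z' \<and> Rminus N P n \<and> n \<cdot> z' = z \<cdot> m"
proof -
  obtain M m where m: "Rminus A M m" using Rminus_exists A by blast
  then have M: "M \<in> ext_minus" by (rule Rminus_Hom)
  obtain P z' where z': "Rplus M P z'" using Rplus_exists minus_Obj M by blast
  have P: "P \<in> ext_minus" by (rule Rplus_minus[OF z' M])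
  obtain v v' k c e where v: "v \<in> V" "v' \<in> V" "c \<in> Hom C A v" "e \<in> Ext v v'"
    and c1: "conf v' M A k m (pull e c)" by (rule RminusE[OF m])
  obtain u u' l b x where u: "P \<in> ext_plus" "u \<in> U" "u' \<in> U" "b \<in> Hom C u M" "x \<in> Ext u' u"
    and c2: "conf M P u' z' l (push b x)" by (rule RplusE[OF z'])
  obtain N n y z d where N: "conf v' P N (z' \<cdot> k) n y" "conf A N u' z d (push m (push b x))"
    "z \<cdot> m = n \<cdot> z'" "pull y z = pull e c"
    using ET4[OF c1 c2] by blast
  note cd = confD[OF N(1)] and cz = confD[OF N(2)] and mh = Rminus_Hom(1)[OF m]
  have Np: "N \<in> ext_plus"
  proof -
    have "push t k = zer u1 N" if t: "u1 \<in> U" "u2 \<in> U" "k \<in> Ext u1 u2" "t \<in> Hom C u2 N" for u1 u2 k t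
    proof -
      have "pull y t = zer u2 v'" using UV_zer[OF t(2) v(2) pull_in[OF cd(3) t(4) cd(4)]] .
      then obtain s where s: "s \<in> Hom C u2 P" "n \<cdot> s = t" using lift_iff[OF N(1) t(4)] by blast
      have "push s k = zer u1 P" using plusD[OF u(1) t(1-3) s(1)] .
      then show ?thesis
        using push_Cmp[OF t(3) s(1) cd(2) U_Obj[OF t(1)]] push_zer[OF cd(2) U_Obj[OF t(1)]] s(2) by simp
    qed
    then show ?thesis using cd(6) by (simp add: ext_plus_def)
  qed
  have pp: "push m (push b x) = push (m \<cdot> b) x" using push_Cmp[OF u(5,4) mh U_Obj[OF u(3)]] .
  have Rz: "Rplus A N z"
    using RplusI[OF Np u(2,3) Cmp_in_Hom[OF u(4) mh] u(5)] N(2) pp by simp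
  \<comment> \<open>The class \<open>y\<close> has to come from a map N \<rightarrow> v. The map
    \<open>c\<close> on \<open>A\<close> extends to one because the obstruction lies in Ext(u', v) =
    0; agreement with \<open>y\<close> may be checked after restriction along \<open>z\<close>
    because Ext(u', v') = 0.\<close>
  have "push c (push m (push b x)) = zer u' v"
    using UV_zer[OF u(3) v(1) push_in[OF cz(3) v(3) cz(6)]] .
  then obtain c' where c': "c' \<in> Hom C N v" "c' \<cdot> z = c" using extend_iff[OF N(2) v(3)] by blast
  have "pull (pull e c') z = pull y z"
    using pull_Cmp[OF v(4) c'(1) cz(1) V_Obj[OF v(2)]] c'(2) N(4) by simp
  then have "pull e c' = y"
    using ex4[OF N(2) pull_in[OF v(4) c'(1) cd(4)] cd(3) cd(4)] UV_zer[OF u(3) v(2)] by blast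
  then have "Rminus N P n" using RminusI[OF P v(1,2) c'(1) v(4)] N(1) by simp
  then show ?thesis using m Rz z' N(3) by metis
qed

end

section \<open>The heart is abelian\<close>

context cotorsion
begin

text \<open>\<open>M\<close> is a homotopy pushout of w \<leftarrow> A \<rightarrow> B, so m f
  factors through \<open>w\<close>. Conversely, if t f factors through some w' in W, then
  \<open>t\<close> sends the class of \<open>M\<close> into the image of Ext(u, w') = 0 and
  therefore extends to \<open>M\<close>.\<close>

lemma cokernel_conf:
  assumes a: "conf A w u a a' e" and w: "w \<in> W" and f: "f \<in> Hom C A B"
    and c: "conf B M u m m' (push f e)"
  shows "null (m \<cdot> f)"
    and "t \<in> Hom C B D \<Longrightarrow> null (t \<cdot> f) \<Longrightarrow> u \<in> U \<Longrightarrow> \<exists>s\<in>Hom C M D. s \<cdot> m = t"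
proof -
  note ad = confD[OF a] and cd = confD[OF c]
  have "push (m \<cdot> f) e = zer u M"
    using push_Cmp[OF ad(3) f cd(1) ad(6)] conf_push[OF c] by simp
  then obtain r where "r \<in> Hom C w M" "r \<cdot> a = m \<cdot> f"
    using extend_iff[OF a Cmp_in_Hom[OF f cd(1)]] by blast
  then show "null (m \<cdot> f)" using nullI[OF w ad(1)] by metis
  assume t: "t \<in> Hom C B D" and n: "null (t \<cdot> f)" and u: "u \<in> U"
  obtain w' x b where w': "w' \<in> W" "x \<in> Hom C A w'" "b \<in> Hom C w' D" "t \<cdot> f = b \<cdot> x"
    by (rule nullE[OF n Cmp_in_Hom[OF f t]])
  have "push x e = zer u w'" using UV_zer[OF u _ push_in[OF ad(3) w'(2) ad(6)]] w'(1) W_def by blast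
  then have "push t (push f e) = zer u D"
    using push_Cmp[OF ad(3) f t ad(6)] push_Cmp[OF ad(3) w'(2,3) ad(6)] w'(4) push_zer[OF w'(3) ad(6)]
    by simp
  then show "\<exists>s\<in>Hom C M D. s \<cdot> m = t" using extend_iff[OF c t] by blast
qed

text \<open>\<open>M\<close> has the extension property but is only known to lie in
  \<open>ext_minus\<close>. Its reflection lies in the heart; uniqueness passes through the two
  steps by \<open>Rplus_null\<close> and \<open>conf_U_null\<close>.\<close>

lemma heart_cokernel:
  assumes A: "A \<in> hrt" and B: "B \<in> hrt" and f: "f \<in> Hom C A B"
  shows "\<exists>N\<in>hrt. \<exists>c\<in>Hom C B N. null (c \<cdot> f) \<and>
    (\<forall>D\<in>hrt. \<forall>t\<in>Hom C B D. null (t \<cdot> f) \<longrightarrow> (\<exists>s\<in>Hom C N D. s \<cdot> c = t)) \<and>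
    (\<forall>D\<in>hrt. \<forall>s\<in>Hom C N D. null (s \<cdot> c) \<longrightarrow> null s)"
proof -
  obtain w u a a' e where w: "w \<in> W" and u: "u \<in> U" and a: "conf A w u a a' e"
    using minus_conf A by blast
  note ad = confD[OF a]
  note Bo = plus_Obj[OF IntD1[OF B]]
  obtain M m m' where c: "conf B M u m m' (push f e)"
    using realize[OF push_in[OF ad(3) f ad(6)] ad(6) Bo] by blast
  note cd = confD[OF c]
  have M: "M \<in> ext_minus" using conf_U_minus[OF c u] B by blast
  obtain N z where z: "Rplus M N z" using Rplus_exists cd(5) by blast
  note zh = Rplus_Hom[OF z]
  have N: "N \<in> hrt" using zh(2) Rplus_minus[OF z M] by blast
  have 1: "null ((z \<cdot> m) \<cdot> f)"
    using null_Cmp_left[OF cokernel_conf(1)[OF a w f c] Cmp_in_Hom[OF f cd(1)] zh(1)]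
      Cmp_assoc[OF f cd(1) zh(1)] by simp
  have 2: "\<exists>s\<in>Hom C N D. s \<cdot> (z \<cdot> m) = t"
    if t: "D \<in> hrt" "t \<in> Hom C B D" "null (t \<cdot> f)" for D t
  proof -
    obtain s where s: "s \<in> Hom C M D" "s \<cdot> m = t" using cokernel_conf(2)[OF a w f c t(2,3) u] by blast
    obtain s' where s': "s' \<in> Hom C N D" "s' \<cdot> z = s" using Rplus_extend[OF z _ s(1)] t(1) by blast
    then have "s' \<cdot> (z \<cdot> m) = t" using Cmp_assoc[OF cd(1) zh(1) s'(1)] s(2) by simp
    then show ?thesis using s'(1) by blast
  qed
  have 3: "null s" if s: "D \<in> hrt" "s \<in> Hom C N D" "null (s \<cdot> (z \<cdot> m))" for D s
  proof -
    have "null ((s \<cdot> z) \<cdot> m)" using s(3) Cmp_assoc[OF cd(1) zh(1) s(2)] by simp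
    then have "null (s \<cdot> z)" using conf_U_null[OF c u IntD1[OF s(1)] Cmp_in_Hom[OF zh(1) s(2)]] by blast
    then show ?thesis using Rplus_null[OF z IntD1[OF s(1)] s(2)] by blast
  qed
  show ?thesis using N Cmp_in_Hom[OF cd(1) zh(1)] 1 2 3 by blast
qed

text \<open>
  If \<open>f\<close> is an epimorphism of the heart, the object \<open>M\<close> whose reflection is its cokernel lies in \<open>U\<close>.
  This forces the dually constructed object \<open>L\<close> over \<open>A\<close>, a priori only in \<open>ext_plus\<close>, into the heart.
\<close>

lemma heart_epi:
  assumes A: "A \<in> hrt" and B: "B \<in> hrt" and f: "f \<in> Hom C A B"
    and epi: "\<And>D t. D \<in> hrt \<Longrightarrow> t \<in> Hom C B D \<Longrightarrow> null (t \<cdot> f) \<Longrightarrow> null t"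
  shows "\<exists>L\<in>hrt. \<exists>l\<in>Hom C L A. null (f \<cdot> l) \<and>
    (\<forall>D\<in>hrt. \<forall>t\<in>Hom C A D. null (t \<cdot> l) \<longrightarrow> (\<exists>s\<in>Hom C B D. null (Sub t (s \<cdot> f))))"
proof -
  obtain w u a a' e where w: "w \<in> W" and u: "u \<in> U" and a: "conf A w u a a' e"
    using minus_conf A by blast
  obtain w' v k b e' where w': "w' \<in> W" and v: "v \<in> V" and b: "conf v w' B k b e'"
    using plus_conf B by blast
  obtain G g x where g: "conf A B G f g x" using inflation[OF f] by blast
  note ad = confD[OF a] and bd = confD[OF b] and gd = confD[OF g]
  \<comment> \<open>B \<rightarrow> M \<rightarrow> u is the triangle used for cokernels, while w
    \<rightarrow> M \<rightarrow> G ties \<open>M\<close> to the cone of \<open>f\<close>.\<close>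
  obtain M m m' n n' where m: "conf B M u m m' (push f e)" and n: "conf w M G n n' (push a x)"
    using PO[OF g a] by blast
  \<comment> \<open>\<open>L\<close> is a homotopy pullback of A \<rightarrow> B \<leftarrow> w',
    dual to \<open>M\<close>. By \<open>push l d = x\<close> the connecting class of
    \<open>f\<close> comes from \<open>L\<close>.\<close>
  obtain L y d l h where l: "conf L w' G y (g \<cdot> b) d" "conf v L A h l (pull e' f)"
    "f \<cdot> l = b \<cdot> y" "push l d = x"
    using ET4'[OF g b] by blast
  note md = confD[OF m] and nd = confD[OF n] and ld = confD[OF l(1)]
  have lh: "l \<in> Hom C L A" using confD(2)[OF l(2)] .
  have MU: "M \<in> U"
  proof -
    have "M \<in> ext_minus" using conf_U_minus[OF m u] B by blast
    obtain N z where z: "Rplus M N z" using Rplus_exists md(5) by blast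
    obtain u1 u2 z' p q where r: "N \<in> ext_plus" "u1 \<in> U" "u2 \<in> U" "p \<in> Hom C u1 M" "q \<in> Ext u2 u1"
      and zc: "conf M N u2 z z' (push p q)" by (rule RplusE[OF z])
    note zh = Rplus_Hom[OF z]
    have N: "N \<in> hrt" using zh(2) Rplus_minus[OF z \<open>M \<in> ext_minus\<close>] by blast
    have "null ((z \<cdot> m) \<cdot> f)"
      using null_Cmp_left[OF cokernel_conf(1)[OF a w f m] Cmp_in_Hom[OF f md(1)] zh(1)]
        Cmp_assoc[OF f md(1) zh(1)] by simp
    then have "null (z \<cdot> m)" using epi[OF N Cmp_in_Hom[OF md(1) zh(1)]] by blast
    then have "null z" by (rule conf_U_null[OF m u r(1) zh(1)])
    then obtain w'' i j where w'': "w'' \<in> W" "i \<in> Hom C M w''" "j \<in> Hom C w'' N" "z = j \<cdot> i"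
      by (rule nullE[OF _ zh(1)])
    show ?thesis
    proof (rule U_perp[OF md(5)])
      fix v1 t assume v1: "v1 \<in> V" and t: "t \<in> Ext M v1"
      note o = V_Obj[OF v1]
      \<comment> \<open>Since Ext(u1, v1) = 0, the hypothesis of \<open>ex5\<close> holds and
        \<open>t\<close> comes from a class on \<open>N\<close>. Because \<open>z\<close> factors
        through \<open>w''\<close>, it then passes through Ext(w'', v1) = 0.\<close>
      obtain t' where t': "t' \<in> Ext N v1" "pull t' z = t"
        using ex5[OF zc r(4,5) t o] UV_zer[OF r(2) v1 pull_in[OF t r(4) o]] by blast
      have "pull t' j = zer w'' v1"
        using UV_zer[OF _ v1 pull_in[OF t'(1) w''(3) o]] w''(1) W_def by blast
      then have "pull t' z = zer M v1"
        using pull_Cmp[OF t'(1) w''(3,2) o] w''(4) pull_zer[OF w''(2) o] by simp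
      then show "t = zer M v1" using t'(2) by simp
    qed
  qed
  \<comment> \<open>Here \<open>M \<in> U\<close> enters: the class \<open>push t d\<close> dies on
    \<open>M\<close>, so it is induced by a map \<open>s\<close> out of \<open>w\<close>. By
    \<open>ex2\<close>, the maps \<open>t\<close> and \<open>s \<cdot> (a \<cdot> l)\<close> then
    differ by a map through \<open>y\<close>.\<close>
  have factor: "\<exists>s\<in>Hom C w D. push (s \<cdot> (a \<cdot> l)) d = push t d \<and> push (s \<cdot> a) x = push t d"
    if D: "D \<in> V" and t: "t \<in> Hom C L D" for D t
  proof -
    have p: "push t d \<in> Ext G D" using push_in[OF ld(3) t ld(6)] .
    then have "pull (push t d) n' = zer M D" using UV_zer[OF MU D pull_in[OF p nd(2) V_Obj[OF D]]] by blast
    then obtain s where s: "s \<in> Hom C w D" "push s (push a x) = push t d"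
      using ex3[OF n p V_Obj[OF D]] by blast
    have "push (s \<cdot> a) x = push t d" using push_Cmp[OF gd(3) ad(1) s(1) gd(6)] s(2) by simp
    moreover have "push (s \<cdot> (a \<cdot> l)) d = push (s \<cdot> a) x"
      using push_Cmp[OF ld(3) lh Cmp_in_Hom[OF ad(1) s(1)] ld(6)] Cmp_assoc[OF lh ad(1) s(1)] l(4) by simp
    ultimately have "push (s \<cdot> (a \<cdot> l)) d = push t d \<and> push (s \<cdot> a) x = push t d" by simp
    then show ?thesis using s(1) by blast
  qed
  \<comment> \<open>Every map L \<rightarrow> v2 is a sum of one through \<open>w\<close> and one
    through \<open>w'\<close>, and both Ext(w, v1) and Ext(w', v1) vanish.\<close>
  have Lm: "L \<in> ext_minus"
  proof -
    have "pull r t = zer L v1" if v1: "v1 \<in> V" "v2 \<in> V" "r \<in> Ext v2 v1" "t \<in> Hom C L v2" for v1 v2 r t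
    proof -
      note o = V_Obj[OF v1(1)] and o2 = V_Obj[OF v1(2)]
      obtain s where s: "s \<in> Hom C w v2" "push (s \<cdot> (a \<cdot> l)) d = push t d"
        using factor[OF v1(2,4)] by blast
      note al = Cmp_in_Hom[OF lh ad(1)]
      obtain q where q: "q \<in> Hom C w' v2" "t = Add C (s \<cdot> (a \<cdot> l)) (q \<cdot> y)"
        using ex2[OF l(1) v1(4) Cmp_in_Hom[OF al s(1)]] s(2) by metis
      have "pull r s = zer w v1" using UV_zer[OF _ v1(1) pull_in[OF v1(3) s(1) o]] w W_def by blast
      then have 1: "pull r (s \<cdot> (a \<cdot> l)) = zer L v1"
        using pull_Cmp[OF v1(3) s(1) al o] pull_zer[OF al o] by simp
      have "pull r q = zer w' v1" using UV_zer[OF _ v1(1) pull_in[OF v1(3) q(1) o]] w' W_def by blast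
      then have 2: "pull r (q \<cdot> y) = zer L v1"
        using pull_Cmp[OF v1(3) q(1) ld(1) o] pull_zer[OF ld(1) o] by simp
      show ?thesis unfolding q(2)
        by (rule pull_Add_zer[OF v1(3) o2 o Cmp_in_Hom[OF al s(1)] Cmp_in_Hom[OF ld(1) q(1)] 1 2])
    qed
    then show ?thesis using ld(4) by (simp add: ext_minus_def)
  qed
  have L: "L \<in> hrt" using Lm conf_V_plus[OF l(2) v] A by blast
  have 1: "null (f \<cdot> l)" unfolding l(3) by (rule nullI[OF w' ld(1) bd(2)])
  have 2: "\<exists>s\<in>Hom C B D. null (Sub t (s \<cdot> f))"
    if D: "D \<in> hrt" and t: "t \<in> Hom C A D" and nt: "null (t \<cdot> l)" for D t
  proof -
    obtain w2 i j where w2: "w2 \<in> W" "i \<in> Hom C L w2" "j \<in> Hom C w2 D" "t \<cdot> l = j \<cdot> i"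
      by (rule nullE[OF nt Cmp_in_Hom[OF lh t]])
    \<comment> \<open>Applied to the map \<open>i\<close> into \<open>w2\<close>,
      \<open>factor\<close> shows that \<open>t\<close> and \<open>j \<cdot> (s \<cdot> a)\<close>
      send \<open>x\<close> to the same class. Their difference thus factors through
      \<open>f\<close>, and the correction term is null since it passes through
      \<open>w2\<close>.\<close>
    obtain s where s: "s \<in> Hom C w w2" "push (s \<cdot> a) x = push i d"
      using factor[of w2 i] w2(1,2) W_def by blast
    note sa = Cmp_in_Hom[OF ad(1) s(1)]
    have "push t x = push (t \<cdot> l) d" using push_Cmp[OF ld(3) lh t ld(6)] l(4) by simp
    also have "\<dots> = push j (push i d)" using push_Cmp[OF ld(3) w2(2,3) ld(6)] w2(4) by simp
    also have "\<dots> = push (j \<cdot> (s \<cdot> a)) x" using push_Cmp[OF gd(3) sa w2(3) gd(6)] s(2) by simp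
    finally obtain q where q: "q \<in> Hom C B D" "t = Add C (j \<cdot> (s \<cdot> a)) (q \<cdot> f)"
      using ex2[OF g t Cmp_in_Hom[OF sa w2(3)]] by blast
    have "Sub t (q \<cdot> f) = j \<cdot> (s \<cdot> a)"
      unfolding q(2) by (rule Sub_Add(1)[OF Cmp_in_Hom[OF sa w2(3)] Cmp_in_Hom[OF f q(1)]])
    then have "null (Sub t (q \<cdot> f))" using nullI[OF w2(1) sa w2(3)] by simp
    then show ?thesis using q(1) by blast
  qed
  show ?thesis using L lh 1 2 by blast
qed

section \<open>Abelian structure of the quotient of the heart\<close>

abbreviation K :: "('o, 'm set) addcat" where "K \<equiv> full_subcategory Q hrt"

lemma Hom_K_E:
  assumes "F \<in> Hom K A B"
  obtains f where "f \<in> Hom C A B" "F = res f" "A \<in> hrt" "B \<in> hrt"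
  using assms Hom_Q_E by (auto simp: Hom_full split: if_splits)

lemma res_in_K: "f \<in> Hom C A B \<Longrightarrow> A \<in> hrt \<Longrightarrow> B \<in> hrt \<Longrightarrow> res f \<in> Hom K A B"
  by (simp add: Hom_full res_in_Hom)

text \<open>\<open>heart_cokernel\<close> yields strict factorizations, \<open>heart_epi\<close>
  only factorizations up to a null map; the existence hypothesis is phrased modulo null maps to
  serve both.\<close>

lemma is_cokernel_K:
  assumes A: "A \<in> hrt" and B: "B \<in> hrt" and N: "N \<in> hrt"
    and f: "f \<in> Hom C A B" and c: "c \<in> Hom C B N" and n: "null (c \<cdot> f)"
    and ex: "\<And>D t. D \<in> hrt \<Longrightarrow> t \<in> Hom C B D \<Longrightarrow> null (t \<cdot> f) \<Longrightarrow> \<exists>s\<in>Hom C N D. null (Sub t (s \<cdot> c))"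
    and un: "\<And>D s. D \<in> hrt \<Longrightarrow> s \<in> Hom C N D \<Longrightarrow> null (s \<cdot> c) \<Longrightarrow> null s"
  shows "is_cokernel K (res f) (res c)"
proof -
  have F: "res f \<in> Hom K A B" and Cc: "res c \<in> Hom K B N" using res_in_K f c A B N by blast+
  note oA = plus_Obj[OF IntD1[OF A]] and oN = plus_Obj[OF IntD1[OF N]]
  have z: "res c \<bullet> res f = res (Zero C A N)"
    using res_Cmp[OF f c] res_eq_Zero[OF Cmp_in_Hom[OF f c]] n by simp
  have "\<exists>!s. s \<in> Hom K N D \<and> s \<bullet> res c = T"
    if D: "D \<in> hrt" and T: "T \<in> Hom K B D" and Tz: "T \<bullet> res f = res (Zero C A D)" for D T
  proof -
    obtain t where t: "t \<in> Hom C B D" "T = res t" by (rule Hom_K_E[OF T])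
    have "null (t \<cdot> f)" using Tz res_Cmp[OF f t(1)] res_eq_Zero[OF Cmp_in_Hom[OF f t(1)]] t(2) by simp
    then obtain s where s: "s \<in> Hom C N D" "null (Sub t (s \<cdot> c))" using ex[OF D t(1)] by blast
    have e: "res s \<bullet> res c = T"
      using res_Cmp[OF c s(1)] res_eq_iff[OF t(1) Cmp_in_Hom[OF c s(1)]] s(2) t(2) by simp
    show ?thesis
    proof (rule ex1I[of _ "res s"])
      show "res s \<in> Hom K N D \<and> res s \<bullet> res c = T" using e res_in_K[OF s(1) N D] by blast
      fix S assume S: "S \<in> Hom K N D \<and> S \<bullet> res c = T"
      then obtain s' where s': "s' \<in> Hom C N D" "S = res s'" by (blast elim: Hom_K_E)
      have "res (s' \<cdot> c) = res (s \<cdot> c)" using S s'(2) e res_Cmp[OF c s'(1)] res_Cmp[OF c s(1)] by simp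
      then have "null (Sub s' s \<cdot> c)"
        using res_eq_iff[OF Cmp_in_Hom[OF c s'(1)] Cmp_in_Hom[OF c s(1)]] Cmp_Sub_left[OF c s'(1) s(1)] by simp
      then have "null (Sub s' s)" using un[OF D Sub_in_Hom[OF s'(1) s(1)]] by blast
      then show "S = res s" using res_eq_iff[OF s'(1) s(1)] s'(2) by simp
    qed
  qed
  then have "\<exists>!s. s \<in> Hom K N D \<and> s \<cdot>\<^bsub>K\<^esub> res c = T"
    if "D \<in> Obj K" "T \<in> Hom K B D" "T \<cdot>\<^bsub>K\<^esub> res f = Zero K A D" for D T
    using that by simp
  moreover have "res c \<cdot>\<^bsub>K\<^esub> res f = Zero K A N" using z by simp
  ultimately show ?thesis
    unfolding is_cokernel_def Hom_Dom[OF F] Hom_Cod[OF F] Hom_Dom[OF Cc] Hom_Cod[OF Cc]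
    using Hom_Arr[OF F] Hom_Arr[OF Cc] by blast
qed

lemma K_cokernel:
  assumes "F \<in> Arr K"
  shows "\<exists>c. is_cokernel K F c"
proof -
  obtain f where f: "f \<in> Hom C (Dom K F) (Cod K F)" "F = res f" "Dom K F \<in> hrt" "Cod K F \<in> hrt"
    by (rule Hom_K_E[of F "Dom K F" "Cod K F"]) (use assms in \<open>simp_all add: Hom_def\<close>)
  obtain N c where c: "N \<in> hrt" "c \<in> Hom C (Cod K F) N" "null (c \<cdot> f)"
    "\<And>D t. D \<in> hrt \<Longrightarrow> t \<in> Hom C (Cod K F) D \<Longrightarrow> null (t \<cdot> f) \<Longrightarrow> \<exists>s\<in>Hom C N D. s \<cdot> c = t"
    "\<And>D s. D \<in> hrt \<Longrightarrow> s \<in> Hom C N D \<Longrightarrow> null (s \<cdot> c) \<Longrightarrow> null s"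
    using heart_cokernel[OF f(3,4,1)] by blast
  have "is_cokernel K (res f) (res c)"
  proof (rule is_cokernel_K[OF f(3,4) c(1) f(1) c(2,3) _ c(5)])
    fix D t assume "D \<in> hrt" "t \<in> Hom C (Cod K F) D" "null (t \<cdot> f)"
    then show "\<exists>s\<in>Hom C N D. null (Sub t (s \<cdot> c))" using c(4) null_Sub_refl by metis
  qed
  then show ?thesis using f(2) by blast
qed

lemma K_epi_is_cokernel:
  assumes "is_epi K F"
  shows "\<exists>G. is_cokernel K G F"
proof -
  have "F \<in> Arr K" using assms by (simp add: is_epi_def)
  then have F: "F \<in> Hom K (Dom K F) (Cod K F)" by (simp add: Hom_def)
  define A where "A = Dom K F"
  define B where "B = Cod K F"
  obtain f where f: "f \<in> Hom C A B" "F = res f" "A \<in> hrt" "B \<in> hrt"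
    unfolding A_def B_def by (rule Hom_K_E[OF F])
  have epi: "null t" if D: "D \<in> hrt" and t: "t \<in> Hom C B D" and n: "null (t \<cdot> f)" for D t
  proof -
    note o = Hom_Obj[OF t]
    have "res t \<bullet> F = res (Zero C B D) \<bullet> F"
      using res_Cmp[OF f(1) t] res_Cmp[OF f(1) Zero_in_Hom[OF o]] Cmp_Zero(1)[OF f(1) o(2)]
        res_eq_Zero[OF Cmp_in_Hom[OF f(1) t]] n f(2) by simp
    moreover have "res t \<in> Hom K B D" "res (Zero C B D) \<in> Hom K B D"
      using res_in_K t Zero_in_Hom[OF o] f(4) D by blast+
    moreover have "D \<in> Obj K" using D o by simp
    ultimately have "res t = res (Zero C B D)"
      using assms unfolding is_epi_def B_def by (metis full_simps(5))
    then show ?thesis using res_eq_Zero[OF t] by simp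
  qed
  obtain L l where l: "L \<in> hrt" "l \<in> Hom C L A" "null (f \<cdot> l)"
    "\<And>D t. D \<in> hrt \<Longrightarrow> t \<in> Hom C A D \<Longrightarrow> null (t \<cdot> l) \<Longrightarrow> \<exists>s\<in>Hom C B D. null (Sub t (s \<cdot> f))"
    using heart_epi[OF f(3,4,1)] epi by blast
  have "is_cokernel K (res l) (res f)"
    by (rule is_cokernel_K[OF l(1) f(3,4) l(2) f(1) l(3,4) epi])
  then show ?thesis using f(2) by blast
qed

lemma plus_biproduct:
  assumes "biproduct C P A B" "A \<in> ext_plus" "B \<in> ext_plus"
  shows "P \<in> ext_plus"
proof -
  obtain i j p q where b: "P \<in> Obj C" "A \<in> Obj C" "B \<in> Obj C"
    "i \<in> Hom C A P" "j \<in> Hom C B P" "p \<in> Hom C P A" "q \<in> Hom C P B"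
    "p \<cdot> i = Idn C A" "q \<cdot> j = Idn C B" "q \<cdot> i = Zero C A B" "p \<cdot> j = Zero C B A"
    "Add C (i \<cdot> p) (j \<cdot> q) = Idn C P"
    by (rule biproductE[OF assms(1)])
  have "push c e = zer u1 P" if u: "u1 \<in> U" "u2 \<in> U" "e \<in> Ext u1 u2" "c \<in> Hom C u2 P" for u1 u2 e c
  proof -
    note o = U_Obj[OF u(1)]
    note pc = Cmp_in_Hom[OF u(4) b(6)] and qc = Cmp_in_Hom[OF u(4) b(7)]
    have 1: "push (i \<cdot> (p \<cdot> c)) e = zer u1 P"
      using push_Cmp[OF u(3) pc b(4) o] plusD[OF assms(2) u(1-3) pc] push_zer[OF b(4) o] by simp
    have 2: "push (j \<cdot> (q \<cdot> c)) e = zer u1 P"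
      using push_Cmp[OF u(3) qc b(5) o] plusD[OF assms(3) u(1-3) qc] push_zer[OF b(5) o] by simp
    have "Add C (i \<cdot> (p \<cdot> c)) (j \<cdot> (q \<cdot> c)) = c"
      using Cmp_assoc[OF u(4) b(6,4)] Cmp_assoc[OF u(4) b(7,5)]
        Cmp_Add_left[OF u(4) Cmp_in_Hom[OF b(6,4)] Cmp_in_Hom[OF b(7,5)]] b(12) Idn_left[OF u(4)] by simp
    then show ?thesis
      using push_Add_zer[OF u(3) o U_Obj[OF u(2)] Cmp_in_Hom[OF pc b(4)] Cmp_in_Hom[OF qc b(5)] 1 2] by simp
  qed
  then show ?thesis using b(1) by (simp add: ext_plus_def)
qed

lemma minus_biproduct:
  assumes "biproduct C P A B" "A \<in> ext_minus" "B \<in> ext_minus"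
  shows "P \<in> ext_minus"
  using cotorsion.plus_biproduct[OF dual_cotorsion, unfolded dual_plus, of P A B] assms by simp

lemma W_hrt:
  assumes "w \<in> W"
  shows "w \<in> hrt"
proof
  have w: "w \<in> U" "w \<in> V" using assms W_def by blast+
  show "w \<in> ext_plus"
    using UV_zer[OF _ w(2)] push_in U_Obj V_Obj w by (auto simp: ext_plus_def)
  show "w \<in> ext_minus"
    using UV_zer[OF w(1)] pull_in U_Obj V_Obj w by (auto simp: ext_minus_def)
qed

lemma K_op: "full_subcategory (additive_quotient (op_cat C) W) (ext_minus \<inter> ext_plus) = op_cat K"
  by (simp add: additive_quotient_op full_subcategory_op Int_commute)

text \<open>Kernels, and monomorphisms as kernels, are the cokernel results for the dual cotorsion
  pair: exchanging U and V exchanges \<open>ext_plus\<close> and \<open>ext_minus\<close>, so the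
  heart is the same set of objects.\<close>

lemma K_abelian: "abelian_category K"
proof -
  interpret K: additive_category K
  proof -
    obtain Z where Z: "Z \<in> W" "zero_object C Z" using W_zero by blast
    show "additive_category K"
    proof (rule full_additive[OF Q_additive W_hrt[OF Z(1)] zero_object_Q[OF Z(2)]])
      fix A B assume "A \<in> hrt" "B \<in> hrt" "A \<in> Obj Q" "B \<in> Obj Q"
      then show "\<exists>P\<in>hrt. biproduct Q P A B"
        using ex_biproduct[of A B] plus_biproduct minus_biproduct biproduct_Q by fastforce
    qed
  qed
  interpret op: cotorsion "op_cat C" "\<lambda>Z A. Ext A Z" "\<lambda>Z A. zer A Z" "\<lambda>f e. pull e f"
    "\<lambda>e f. push f e" "\<lambda>A B Z f g e. conf Z B A g f e" V U W
    by (rule dual_cotorsion)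
  show ?thesis
  proof unfold_locales
    fix F
    show "F \<in> Arr K \<Longrightarrow> \<exists>c. is_cokernel K F c" by (rule K_cokernel)
    show "is_epi K F \<Longrightarrow> \<exists>g. is_cokernel K g F" by (rule K_epi_is_cokernel)
    show "F \<in> Arr K \<Longrightarrow> \<exists>k. is_kernel K F k"
      using op.K_cokernel[unfolded dual_plus dual_minus K_op, of F] by simp
    show "is_mono K F \<Longrightarrow> \<exists>g. is_kernel K g F"
      using op.K_epi_is_cokernel[unfolded dual_plus dual_minus K_op, of F] by simp
  qed
qed

end

section \<open>Reflections and coreflections\<close>

context category
begin

definition reflects :: "'o set \<Rightarrow> 'o \<Rightarrow> 'o \<Rightarrow> 'm \<Rightarrow> bool" where
  "reflects S A N z \<longleftrightarrow> z \<in> Hom C A N \<and> N \<in> S \<and>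
     (\<forall>D\<in>S. \<forall>t\<in>Hom C A D. \<exists>!s. s \<in> Hom C N D \<and> s \<cdot> z = t)"

definition coreflects :: "'o set \<Rightarrow> 'o \<Rightarrow> 'o \<Rightarrow> 'm \<Rightarrow> bool" where
  "coreflects S A N z \<longleftrightarrow> z \<in> Hom C N A \<and> N \<in> S \<and>
     (\<forall>D\<in>S. \<forall>t\<in>Hom C D A. \<exists>!s. s \<in> Hom C D N \<and> z \<cdot> s = t)"

lemma op_category: "category (op_cat C)"
  by (rule category_op) unfold_locales

lemma reflects_op: "category.reflects (op_cat C) = coreflects"
  by (intro ext) (simp add: category.reflects_def[OF op_category] coreflects_def)

lemma coreflects_op: "category.coreflects (op_cat C) = reflects"
  by (intro ext) (simp add: category.coreflects_def[OF op_category] reflects_def)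

lemma reflectsD:
  assumes "reflects S A N z"
  shows "z \<in> Hom C A N" "N \<in> S"
    "D \<in> S \<Longrightarrow> t \<in> Hom C A D \<Longrightarrow> \<exists>s\<in>Hom C N D. s \<cdot> z = t"
    "D \<in> S \<Longrightarrow> f \<in> Hom C N D \<Longrightarrow> g \<in> Hom C N D \<Longrightarrow> f \<cdot> z = g \<cdot> z \<Longrightarrow> f = g"
proof -
  show z: "z \<in> Hom C A N" "N \<in> S" using assms by (auto simp: reflects_def)
  have *: "\<exists>!s. s \<in> Hom C N D \<and> s \<cdot> z = t" if "D \<in> S" "t \<in> Hom C A D" for D t
    using assms that by (simp add: reflects_def)
  show "D \<in> S \<Longrightarrow> t \<in> Hom C A D \<Longrightarrow> \<exists>s\<in>Hom C N D. s \<cdot> z = t" using * by blast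
  assume "D \<in> S" "f \<in> Hom C N D" "g \<in> Hom C N D" "f \<cdot> z = g \<cdot> z"
  then show "f = g" using *[of D "f \<cdot> z"] Cmp_in_Hom[OF z(1)] by metis
qed

lemma coreflectsD:
  assumes "coreflects S A N z"
  shows "z \<in> Hom C N A" "N \<in> S"
    "D \<in> S \<Longrightarrow> t \<in> Hom C D A \<Longrightarrow> \<exists>s\<in>Hom C D N. z \<cdot> s = t"
    "D \<in> S \<Longrightarrow> f \<in> Hom C D N \<Longrightarrow> g \<in> Hom C D N \<Longrightarrow> z \<cdot> f = z \<cdot> g \<Longrightarrow> f = g"
  using category.reflectsD[OF op_category, unfolded reflects_op, OF assms] by simp_all

lemma reflects_iso:
  assumes r: "reflects S A N z" and r': "reflects S A N' z'"
  shows "\<exists>j\<in>Hom C N N'. \<exists>j'\<in>Hom C N' N. j \<cdot> z = z' \<and> j' \<cdot> z' = z \<and> j' \<cdot> j = Idn C N \<and> j \<cdot> j' = Idn C N'"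
proof -
  note d = reflectsD[OF r] and d' = reflectsD[OF r']
  obtain j where j: "j \<in> Hom C N N'" "j \<cdot> z = z'" using d(3)[OF d'(2,1)] by blast
  obtain j' where j': "j' \<in> Hom C N' N" "j' \<cdot> z' = z" using d'(3)[OF d(2,1)] by blast
  have "(j' \<cdot> j) \<cdot> z = Idn C N \<cdot> z"
    using Cmp_assoc[OF d(1) j(1) j'(1)] j j' Idn_left[OF d(1)] by simp
  then have 1: "j' \<cdot> j = Idn C N"
    using d(4)[OF d(2) Cmp_in_Hom[OF j(1) j'(1)] Idn_in_Hom] Hom_Obj[OF d(1)] by blast
  have "(j \<cdot> j') \<cdot> z' = Idn C N' \<cdot> z'"
    using Cmp_assoc[OF d'(1) j'(1) j(1)] j j' Idn_left[OF d'(1)] by simp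
  then have "j \<cdot> j' = Idn C N'"
    using d'(4)[OF d'(2) Cmp_in_Hom[OF j'(1) j(1)] Idn_in_Hom] Hom_Obj[OF d'(1)] by blast
  then show ?thesis using 1 j j' by blast
qed

lemma coreflects_iso:
  assumes "coreflects S A N z" "coreflects S A N' z'"
  shows "\<exists>j\<in>Hom C N' N. \<exists>j'\<in>Hom C N N'. z \<cdot> j = z' \<and> z' \<cdot> j' = z \<and> j \<cdot> j' = Idn C N \<and> j' \<cdot> j = Idn C N'"
  using category.reflects_iso[OF op_category, unfolded reflects_op, OF assms] by simp

lemma reflects_Cmp_iso:
  assumes r: "reflects S A N z" and i: "i \<in> Hom C B A" "i' \<in> Hom C A B" "i' \<cdot> i = Idn C B" "i \<cdot> i' = Idn C A"
  shows "reflects S B N (z \<cdot> i)"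
  unfolding reflects_def
proof (intro conjI ballI)
  note d = reflectsD[OF r]
  show "z \<cdot> i \<in> Hom C B N" "N \<in> S" using Cmp_in_Hom[OF i(1) d(1)] d(2) by blast+
  fix D t assume D: "D \<in> S" and t: "t \<in> Hom C B D"
  obtain s where s: "s \<in> Hom C N D" "s \<cdot> z = t \<cdot> i'" using d(3)[OF D Cmp_in_Hom[OF i(2) t]] by blast
  have *: "s \<cdot> (z \<cdot> i) = t"
    using Cmp_assoc[OF i(1) d(1) s(1)] s(2) Cmp_assoc[OF i(1,2) t] i(3) Idn_right[OF t] by simp
  show "\<exists>!s. s \<in> Hom C N D \<and> s \<cdot> (z \<cdot> i) = t"
  proof (rule ex1I[of _ s])
    show "s \<in> Hom C N D \<and> s \<cdot> (z \<cdot> i) = t" using s(1) * by blast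
    fix s' assume s': "s' \<in> Hom C N D \<and> s' \<cdot> (z \<cdot> i) = t"
    have "s' \<cdot> z = ((s' \<cdot> z) \<cdot> i) \<cdot> i'"
      using Cmp_assoc[OF i(2,1) Cmp_in_Hom[OF d(1)]] s' i(4) Idn_right[OF Cmp_in_Hom[OF d(1)]] by metis
    also have "\<dots> = t \<cdot> i'" using Cmp_assoc[OF i(1) d(1)] s' by metis
    finally show "s' = s" using d(4)[OF D] s' s by metis
  qed
qed

lemma coreflects_Cmp_iso:
  assumes "coreflects S A N z" "i \<in> Hom C A B" "i' \<in> Hom C B A" "i' \<cdot> i = Idn C A" "i \<cdot> i' = Idn C B"
  shows "coreflects S B N (i \<cdot> z)"
  using category.reflects_Cmp_iso[OF op_category, unfolded reflects_op, of S A N z i B i'] assms by simp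

text \<open>
  Independence of the choice of reflections and coreflections: if for one choice a square of
  reflections and coreflections commutes, the canonical comparison is invertible for every choice.
\<close>

lemma reflection_comparison_iso:
  assumes m: "coreflects R A M m" and z: "reflects S A N z" and z': "reflects S M P z'"
    and n: "coreflects R N P n" and sq: "n \<cdot> z' = z \<cdot> m"
    and m1: "coreflects R A M1 m1" and z1: "reflects S A N1 z1" and e1: "reflects S M1 P1 e1"
    and e2: "coreflects R N1 P2 e2" and th: "\<theta> \<in> Hom C P1 P2" "(e2 \<cdot> \<theta>) \<cdot> e1 = z1 \<cdot> m1"
  shows "is_iso C \<theta>"
proof -
  note dm = coreflectsD[OF m] and dz = reflectsD[OF z] and dz' = reflectsD[OF z']
    and dn = coreflectsD[OF n] and dm1 = coreflectsD[OF m1] and dz1 = reflectsD[OF z1]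
    and de1 = reflectsD[OF e1] and de2 = coreflectsD[OF e2]
  obtain i i' where i: "i \<in> Hom C M M1" "i' \<in> Hom C M1 M" "m1 \<cdot> i = m" "i \<cdot> i' = Idn C M1" "i' \<cdot> i = Idn C M"
    using coreflects_iso[OF m1 m] by blast
  obtain k k' where k: "k \<in> Hom C N N1" "k' \<in> Hom C N1 N" "k \<cdot> z = z1" "k' \<cdot> k = Idn C N" "k \<cdot> k' = Idn C N1"
    using reflects_iso[OF z z1] by blast
  \<comment> \<open>\<open>e1 \<cdot> i\<close> is a second reflection of \<open>M\<close>, since
    \<open>i\<close> is invertible; uniqueness compares it with z'. The next step does the same for
    the coreflections of \<open>N1\<close>.\<close>
  obtain j j' where j: "j \<in> Hom C P P1" "j' \<in> Hom C P1 P" "j \<cdot> z' = e1 \<cdot> i" "j' \<cdot> j = Idn C P" "j \<cdot> j' = Idn C P1"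
    using reflects_iso[OF z' reflects_Cmp_iso[OF e1 i(1,2,5,4)]] by blast
  obtain l l' where l: "l \<in> Hom C P P2" "l' \<in> Hom C P2 P" "e2 \<cdot> l = k \<cdot> n" "l \<cdot> l' = Idn C P2" "l' \<cdot> l = Idn C P"
    using coreflects_iso[OF e2 coreflects_Cmp_iso[OF n k(1,2,4,5)]] by blast
  note e2t = Cmp_in_Hom[OF th(1) de2(1)] and tj = Cmp_in_Hom[OF j(1) th(1)]
  \<comment> \<open>The aim is \<theta> j = l with \<open>j\<close> and \<open>l\<close> invertible.
    First z' is cancelled, for maps into \<open>N1\<close> in \<open>S\<close>, then
    \<open>e2\<close>, for maps out of \<open>P\<close> in \<open>R\<close>.\<close>
  have "(e2 \<cdot> (\<theta> \<cdot> j)) \<cdot> z' = (e2 \<cdot> \<theta>) \<cdot> (e1 \<cdot> i)"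
    using Cmp_assoc[OF j(1) th(1) de2(1)] Cmp_assoc[OF dz'(1) j(1) e2t] j(3) by simp
  also have "\<dots> = z1 \<cdot> m"
    using Cmp_assoc[OF i(1) de1(1) e2t] th(2) Cmp_assoc[OF i(1) dm1(1) dz1(1)] i(3) by simp
  also have "\<dots> = k \<cdot> (n \<cdot> z')" using Cmp_assoc[OF dm(1) dz(1) k(1)] k(3) sq by simp
  also have "\<dots> = (e2 \<cdot> l) \<cdot> z'" using Cmp_assoc[OF dz'(1) dn(1) k(1)] l(3) by simp
  finally have "e2 \<cdot> (\<theta> \<cdot> j) = e2 \<cdot> l"
    using dz'(4)[OF dz1(2) Cmp_in_Hom[OF tj de2(1)] Cmp_in_Hom[OF l(1) de2(1)]] by blast
  then have tl: "\<theta> \<cdot> j = l" using de2(4)[OF dn(2) tj l(1)] by blast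
  note jl = Cmp_in_Hom[OF l(2) j(1)]
  have "\<theta> \<cdot> (j \<cdot> l') = Idn C P2" using Cmp_assoc[OF l(2) j(1) th(1)] tl l(4) by simp
  moreover have "(j \<cdot> l') \<cdot> \<theta> = Idn C P1"
  proof -
    have "\<theta> = l \<cdot> j'" using Cmp_assoc[OF j(2,1) th(1)] tl j(5) Idn_right[OF th(1)] by simp
    then have "(j \<cdot> l') \<cdot> \<theta> = j \<cdot> ((l' \<cdot> l) \<cdot> j')"
      using Cmp_assoc[OF th(1) l(2) j(1)] Cmp_assoc[OF j(2) l(1,2)] by simp
    then show ?thesis using l(5) Idn_left[OF j(2)] j(5) by simp
  qed
  ultimately show ?thesis using jl th(1) unfolding is_iso_def by (auto simp: Hom_def)
qed

end

section \<open>Explicit triangles as reflections and coreflections in the quotient\<close>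

context cotorsion
begin

interpretation quot: additive_category Q by (rule Q_additive)

text \<open>Strict extensions in C give existence, and \<open>Rplus_null\<close>, applied to a
  difference, gives uniqueness modulo W.\<close>

lemma Rplus_reflects:
  assumes "Rplus A N z"
  shows "quot.reflects ext_plus A N (res z)"
  unfolding quot.reflects_def
proof (intro conjI ballI)
  note z = Rplus_Hom[OF assms]
  show "res z \<in> Hom Q A N" "N \<in> ext_plus" using res_in_Hom z by blast+
  fix D T assume D: "D \<in> ext_plus" and T: "T \<in> Hom Q A D"
  obtain t where t: "t \<in> Hom C A D" "T = res t" by (rule Hom_Q_E[OF T])
  obtain s where s: "s \<in> Hom C N D" "s \<cdot> z = t" using Rplus_extend[OF assms D t(1)] by blast
  show "\<exists>!S. S \<in> Hom Q N D \<and> S \<bullet> res z = T"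
  proof (rule ex1I[of _ "res s"])
    show "res s \<in> Hom Q N D \<and> res s \<bullet> res z = T" using res_in_Hom s res_Cmp[OF z(1) s(1)] t by simp
    fix S assume S: "S \<in> Hom Q N D \<and> S \<bullet> res z = T"
    then obtain s' where s': "s' \<in> Hom C N D" "S = res s'" by (blast elim: Hom_Q_E)
    have "res (s' \<cdot> z) = res (s \<cdot> z)" using S s'(2) res_Cmp[OF z(1) s'(1)] t s(2) by simp
    then have "null (Sub s' s \<cdot> z)"
      using res_eq_iff[OF Cmp_in_Hom[OF z(1) s'(1)] Cmp_in_Hom[OF z(1) s(1)]]
        Cmp_Sub_left[OF z(1) s'(1) s(1)] by simp
    then have "null (Sub s' s)" by (rule Rplus_null[OF assms D Sub_in_Hom[OF s'(1) s(1)]])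
    then show "S = res s" using res_eq_iff[OF s'(1) s(1)] s'(2) by simp
  qed
qed

lemma Rminus_coreflects:
  assumes "Rminus A N z"
  shows "quot.coreflects ext_minus A N (res z)"
proof -
  have "category.reflects (op_cat Q) ext_minus A N (res z)"
    using cotorsion.Rplus_reflects[OF dual_cotorsion, unfolded dual_Rplus dual_plus
        additive_quotient_op residue_op, OF assms] .
  then show ?thesis by (simp only: quot.reflects_op)
qed

text \<open>In C the identity of \<open>N\<close> equals f g + j i with j i through W. For a map
  \<open>t\<close> from \<open>N\<close> into V, the first term is handled by the condition on
  \<open>A\<close>, the second by Ext(w, v1) = 0.\<close>

lemma minus_retract:
  assumes A: "A \<in> ext_minus" and F: "F \<in> Hom Q A N" and G: "G \<in> Hom Q N A"
    and FG: "F \<bullet> G = Idn Q N"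
  shows "N \<in> ext_minus"
proof -
  obtain f where f: "f \<in> Hom C A N" "F = res f" by (rule Hom_Q_E[OF F])
  obtain g where g: "g \<in> Hom C N A" "G = res g" by (rule Hom_Q_E[OF G])
  note N = Hom_Obj(2)[OF f(1)]
  note fg = Cmp_in_Hom[OF g(1) f(1)] and one = Idn_in_Hom[OF N]
  note d = Sub_in_Hom[OF one fg]
  have "res (Idn C N) = res (f \<cdot> g)" using FG f(2) g(2) res_Cmp[OF g(1) f(1)] by simp
  then have "null (Sub (Idn C N) (f \<cdot> g))" using res_eq_iff[OF one fg] by blast
  then obtain w i j where w: "w \<in> W" "i \<in> Hom C N w" "j \<in> Hom C w N" "Sub (Idn C N) (f \<cdot> g) = j \<cdot> i"
    by (rule nullE[OF _ d])
  have "pull x t = zer N v1" if v: "v1 \<in> V" "v2 \<in> V" "x \<in> Ext v2 v1" "t \<in> Hom C N v2" for v1 v2 x t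
  proof -
    note o = V_Obj[OF v(1)] and o2 = V_Obj[OF v(2)]
    have "pull x (t \<cdot> f) = zer A v1" using minusD[OF A v(1-3) Cmp_in_Hom[OF f(1) v(4)]] .
    then have 1: "pull x (t \<cdot> (f \<cdot> g)) = zer N v1"
      using pull_Cmp[OF v(3) Cmp_in_Hom[OF f(1) v(4)] g(1) o] pull_zer[OF g(1) o]
        Cmp_assoc[OF g(1) f(1) v(4)] by simp
    have "pull x (t \<cdot> j) = zer w v1"
      using UV_zer[OF _ v(1) pull_in[OF v(3) Cmp_in_Hom[OF w(3) v(4)] o]] w(1) W_def by blast
    then have 2: "pull x (t \<cdot> (j \<cdot> i)) = zer N v1"
      using pull_Cmp[OF v(3) Cmp_in_Hom[OF w(3) v(4)] w(2) o] pull_zer[OF w(2) o]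
        Cmp_assoc[OF w(2,3) v(4)] by simp
    have "Add C (f \<cdot> g) (j \<cdot> i) = Idn C N" using Add_Sub(1)[OF one fg] w(4) by simp
    then have "Add C (t \<cdot> (f \<cdot> g)) (t \<cdot> (j \<cdot> i)) = t"
      using Cmp_Add_right[OF fg Cmp_in_Hom[OF w(2,3)] v(4)] Idn_right[OF v(4)] by simp
    then show ?thesis
      using pull_Add_zer[OF v(3) o2 o Cmp_in_Hom[OF fg v(4)] Cmp_in_Hom[OF Cmp_in_Hom[OF w(2,3)] v(4)] 1 2]
      by simp
  qed
  then show ?thesis using N by (simp add: ext_minus_def)
qed

text \<open>Carries \<open>Rplus_minus\<close> from the constructed reflection to an arbitrary one,
  so that any choice of tau^+ preserves C^-.\<close>

lemma reflects_minus:
  assumes A: "A \<in> ext_minus" and r: "quot.reflects ext_plus A N Z"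
  shows "N \<in> ext_minus"
proof -
  obtain N' z where z: "Rplus A N' z" using Rplus_exists minus_Obj A by blast
  have N': "N' \<in> ext_minus" by (rule Rplus_minus[OF z A])
  obtain j j' where "j \<in> Hom Q N' N" "j' \<in> Hom Q N N'" "j \<bullet> j' = Idn Q N"
    using quot.reflects_iso[OF Rplus_reflects[OF z] r] by blast
  then show ?thesis by (rule minus_retract[OF N'])
qed

lemma coreflects_plus:
  assumes "A \<in> ext_plus" "quot.coreflects ext_minus A N Z"
  shows "N \<in> ext_plus"
  using cotorsion.reflects_minus[OF dual_cotorsion, unfolded dual_minus dual_plus
      additive_quotient_op quot.reflects_op, OF assms] .

text \<open>The dual octahedron for M' \<rightarrow> M \<rightarrow> u: the fibre \<open>E\<close>
  of the composite maps to \<open>B\<close> with the same fibre as \<mu>. It lies in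
  \<open>ext_minus\<close> because maps from \<open>E\<close> into V extend along \<open>h\<close>
  to M'. Coreflecting thus keeps the third term \<open>u\<close>.\<close>

lemma Rminus_conf_U:
  assumes c: "conf B M u m m' e" and u: "u \<in> U" and r: "Rminus M M' \<mu>"
  shows "\<exists>E h h' x \<beta>. conf E M' u h h' x \<and> Rminus B E \<beta> \<and> m \<cdot> \<beta> = \<mu> \<cdot> h \<and> push \<beta> x = e"
proof -
  obtain v v' k d y where v: "M' \<in> ext_minus" "v \<in> V" "v' \<in> V" "d \<in> Hom C M v" "y \<in> Ext v v'"
    and c': "conf v' M' M k \<mu> (pull y d)" by (rule RminusE[OF r])
  note cd = confD[OF c] and cd' = confD[OF c']
  obtain E h x \<beta> l where E: "conf E M' u h (m' \<cdot> \<mu>) x" "conf v' E B l \<beta> (pull (pull y d) m)"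
    "m \<cdot> \<beta> = \<mu> \<cdot> h" "push \<beta> x = e"
    using ET4'[OF c c'] by blast
  note ed = confD[OF E(1)]
  have "pull r t = zer E v1" if v1: "v1 \<in> V" "v2 \<in> V" "r \<in> Ext v2 v1" "t \<in> Hom C E v2" for v1 v2 r t
  proof -
    note o = V_Obj[OF v1(1)]
    have "push t x = zer u v2" using UV_zer[OF u v1(2) push_in[OF ed(3) v1(4) ed(6)]] .
    then obtain s where s: "s \<in> Hom C M' v2" "s \<cdot> h = t" using extend_iff[OF E(1) v1(4)] by blast
    have "pull r s = zer M' v1" using minusD[OF v(1) v1(1-3) s(1)] .
    then show ?thesis using pull_Cmp[OF v1(3) s(1) ed(1) o] pull_zer[OF ed(1) o] s(2) by simp
  qed
  then have "E \<in> ext_minus" using ed(4) by (simp add: ext_minus_def)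
  moreover have "pull (pull y d) m = pull y (d \<cdot> m)" using pull_Cmp[OF v(5,4) cd(1) V_Obj[OF v(3)]] .
  ultimately have "Rminus B E \<beta>"
    using RminusI[OF _ v(2,3) Cmp_in_Hom[OF cd(1) v(4)] v(5)] E(2) by simp
  then show ?thesis using E by blast
qed

end

section \<open>The two composites of reflection and coreflection\<close>

text \<open>\<open>et\<close> is the unit for tau^+ and \<open>ep\<close> the counit for tau^-.
  Recording universal property and naturality instead of an adjunction bijection lets duality simply
  exchange the two.\<close>

locale heart_functors = cotorsion C Ext zer push pull conf U V W
  for C :: "('o, 'm, 'x) addcat_scheme" (structure)
    and Ext :: "'o \<Rightarrow> 'o \<Rightarrow> 'e set" and zer push pull conf and U V W :: "'o set" +
  fixes tp tm :: "('o, 'm set, 'o, 'm set) func" and et ep :: "'o \<Rightarrow> 'm set"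
  assumes et: "A \<in> Obj C \<Longrightarrow> category.reflects (additive_quotient C W) ext_plus A (fobj tp A) (et A)"
    and ep: "A \<in> Obj C \<Longrightarrow> category.coreflects (additive_quotient C W) ext_minus A (fobj tm A) (ep A)"
    and tp_Hom: "F \<in> Hom (additive_quotient C W) A B
      \<Longrightarrow> farr tp F \<in> Hom (additive_quotient C W) (fobj tp A) (fobj tp B)"
    and tm_Hom: "F \<in> Hom (additive_quotient C W) A B
      \<Longrightarrow> farr tm F \<in> Hom (additive_quotient C W) (fobj tm A) (fobj tm B)"
    and et_nat: "F \<in> Hom (additive_quotient C W) A B
      \<Longrightarrow> farr tp F \<cdot>\<^bsub>additive_quotient C W\<^esub> et A = et B \<cdot>\<^bsub>additive_quotient C W\<^esub> F"
    and ep_nat: "F \<in> Hom (additive_quotient C W) A B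
      \<Longrightarrow> ep B \<cdot>\<^bsub>additive_quotient C W\<^esub> farr tm F = F \<cdot>\<^bsub>additive_quotient C W\<^esub> ep A"
begin

interpretation quot: additive_category Q by (rule Q_additive)

lemma dual_functors: "heart_functors (op_cat C) (\<lambda>Z A. Ext A Z) (\<lambda>Z A. zer A Z) (\<lambda>f e. pull e f)
  (\<lambda>e f. push f e) (\<lambda>A B Z f g e. conf Z B A g f e) V U W tm tp ep et"
  apply (intro heart_functors.intro dual_cotorsion heart_functors_axioms.intro)
  apply (simp_all only: dual_plus dual_minus additive_quotient_op quot.reflects_op quot.coreflects_op
      op_cat_simps Hom_op)
  apply (rule ep et tm_Hom tp_Hom ep_nat et_nat; assumption)+
  done

lemma etD:
  assumes "A \<in> Obj C"
  shows "et A \<in> Hom Q A (fobj tp A)" "fobj tp A \<in> ext_plus" "fobj tp A \<in> Obj C"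
    and "D \<in> ext_plus \<Longrightarrow> T \<in> Hom Q A D \<Longrightarrow> \<exists>S\<in>Hom Q (fobj tp A) D. S \<bullet> et A = T"
    and "\<lbrakk>D \<in> ext_plus; F \<in> Hom Q (fobj tp A) D; G \<in> Hom Q (fobj tp A) D; F \<bullet> et A = G \<bullet> et A\<rbrakk> \<Longrightarrow> F = G"
  using quot.reflectsD[OF et[OF assms]] plus_Obj by blast+

lemma epD:
  assumes "A \<in> Obj C"
  shows "ep A \<in> Hom Q (fobj tm A) A" "fobj tm A \<in> ext_minus" "fobj tm A \<in> Obj C"
    and "D \<in> ext_minus \<Longrightarrow> T \<in> Hom Q D A \<Longrightarrow> \<exists>S\<in>Hom Q D (fobj tm A). ep A \<bullet> S = T"
    and "\<lbrakk>D \<in> ext_minus; F \<in> Hom Q D (fobj tm A); G \<in> Hom Q D (fobj tm A); ep A \<bullet> F = ep A \<bullet> G\<rbrakk> \<Longrightarrow> F = G"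
  using quot.coreflectsD[OF ep[OF assms]] minus_Obj by blast+

abbreviation H1o where "H1o A \<equiv> fobj tp (fobj tm A)"
abbreviation H1 where "H1 F \<equiv> farr tp (farr tm F)"
abbreviation H2o where "H2o A \<equiv> fobj tm (fobj tp A)"
abbreviation H2 where "H2 F \<equiv> farr tm (farr tp F)"

lemma H1o_hrt: "A \<in> Obj C \<Longrightarrow> H1o A \<in> hrt"
  using reflects_minus[OF epD(2) et[OF epD(3)]] etD(2)[OF epD(3)] by blast

lemma H2o_hrt: "A \<in> Obj C \<Longrightarrow> H2o A \<in> hrt"
  using coreflects_plus[OF etD(2) ep[OF etD(3)]] epD(2)[OF etD(3)] by blast

lemma H1_Hom: "F \<in> Hom Q A B \<Longrightarrow> H1 F \<in> Hom Q (H1o A) (H1o B)"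
  using tp_Hom tm_Hom by blast

lemma H2_Hom: "F \<in> Hom Q A B \<Longrightarrow> H2 F \<in> Hom Q (H2o A) (H2o B)"
  using tp_Hom tm_Hom by blast

text \<open>Both sides agree after composition with \<open>ep M\<close>, which determines maps out
  of \<open>E\<close>. It identifies \<open>farr tm\<close> of a map with a lift of that map to
  explicitly constructed coreflections.\<close>

lemma tm_square:
  assumes m: "m \<in> Hom C B M" and b: "Rminus B E \<beta>" and mu: "Rminus M M' \<mu>"
    and h: "h \<in> Hom C E M'" and sq: "res (m \<cdot> \<beta>) = res (\<mu> \<cdot> h)"
    and j: "j \<in> Hom Q E (fobj tm B)" "ep B \<bullet> j = res \<beta>"
    and k: "k \<in> Hom Q M' (fobj tm M)" "ep M \<bullet> k = res \<mu>"
  shows "farr tm (res m) \<bullet> j = k \<bullet> res h"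
proof -
  note o = Hom_Obj[OF m]
  note mQ = res_in_Hom[OF m] and hQ = res_in_Hom[OF h]
  note t = tm_Hom[OF mQ]
  have "ep M \<bullet> (farr tm (res m) \<bullet> j) = res m \<bullet> res \<beta>"
    using quot.Cmp_assoc[OF j(1) t epD(1)[OF o(2)]] ep_nat[OF mQ]
      quot.Cmp_assoc[OF j(1) epD(1)[OF o(1)] mQ] j(2) by simp
  also have "\<dots> = res \<mu> \<bullet> res h"
    using res_Cmp[OF Rminus_Hom(1)[OF b] m] res_Cmp[OF h Rminus_Hom(1)[OF mu]] sq by simp
  also have "\<dots> = ep M \<bullet> (k \<bullet> res h)"
    using quot.Cmp_assoc[OF hQ k(1) epD(1)[OF o(2)]] k(2) by simp
  finally show ?thesis
    using epD(5)[OF o(2) Rminus_Hom(2)[OF b] quot.Cmp_in_Hom[OF j(1) t] quot.Cmp_in_Hom[OF hQ k(1)]] by blast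
qed

lemma tm_iso:
  assumes "Rminus A N z"
  shows "\<exists>j\<in>Hom Q N (fobj tm A). \<exists>j'\<in>Hom Q (fobj tm A) N. ep A \<bullet> j = res z
    \<and> j \<bullet> j' = Idn Q (fobj tm A) \<and> j' \<bullet> j = Idn Q N"
  using quot.coreflects_iso[OF ep[OF Hom_Obj(2)[OF Rminus_Hom(1)[OF assms]]] Rminus_coreflects[OF assms]]
  by blast

lemma iso_cancel_right:
  assumes "j \<in> Hom Q A B" "j' \<in> Hom Q B A" "j \<bullet> j' = Idn Q B" "F \<in> Hom Q B D" "G \<in> Hom Q B D"
    "F \<bullet> j = G \<bullet> j"
  shows "F = G"
  using quot.Cmp_assoc[OF assms(2,1,4)] quot.Cmp_assoc[OF assms(2,1,5)] assms(3,6)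
    quot.Idn_right[OF assms(4)] quot.Idn_right[OF assms(5)] by simp

lemma H1_nat:
  assumes F: "F \<in> Hom Q A B"
  shows "H1 F \<bullet> et (fobj tm A) = et (fobj tm B) \<bullet> farr tm F"
  using et_nat[OF tm_Hom[OF F]] .

text \<open>After coreflecting, \<open>m\<close> becomes the first map of a triangle E \<rightarrow>
  M' \<rightarrow> u. A map from M' into \<open>ext_plus\<close> whose composite with it is null is
  itself null by \<open>conf_U_null\<close>; the units \<open>et\<close> carry this to the
  reflections.\<close>

lemma H1_epi:
  assumes c: "conf B M u m m' e" and u: "u \<in> U" and D: "D \<in> ext_plus"
    and S: "S \<in> Hom Q (H1o M) D" and z: "S \<bullet> H1 (res m) = Zero Q (H1o B) D"
  shows "S = Zero Q (H1o M) D"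
proof -
  note cd = confD[OF c]
  note mQ = res_in_Hom[OF cd(1)]
  note D' = plus_Obj[OF D]
  obtain M' \<mu> where mu: "Rminus M M' \<mu>" using Rminus_exists cd(5) by blast
  obtain E h h' x \<beta> where E: "conf E M' u h h' x" "Rminus B E \<beta>" "m \<cdot> \<beta> = \<mu> \<cdot> h"
    using Rminus_conf_U[OF c u mu] by blast
  obtain j where j: "j \<in> Hom Q E (fobj tm B)" "ep B \<bullet> j = res \<beta>"
    using tm_iso[OF E(2)] by blast
  obtain k k' where k: "k \<in> Hom Q M' (fobj tm M)" "k' \<in> Hom Q (fobj tm M) M'"
    "ep M \<bullet> k = res \<mu>" "k \<bullet> k' = Idn Q (fobj tm M)" using tm_iso[OF mu] by blast
  note eB = etD[OF epD(3)[OF cd(4)]] and eM = etD[OF epD(3)[OF cd(5)]]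
  note h = confD(1)[OF E(1)]
  have sq: "farr tm (res m) \<bullet> j = k \<bullet> res h"
    by (rule tm_square[OF cd(1) E(2) mu h _ j k(1,3)]) (simp only: E(3))
  note Se = quot.Cmp_in_Hom[OF eM(1) S] and tmm = tm_Hom[OF mQ]
  note Sek = quot.Cmp_in_Hom[OF k(1) Se]
  have "(S \<bullet> et (fobj tm M)) \<bullet> farr tm (res m) = Zero Q (fobj tm B) D"
    using quot.Cmp_assoc[OF tmm eM(1) S] H1_nat[OF mQ] quot.Cmp_assoc[OF eB(1) H1_Hom[OF mQ] S] z
      quot.Cmp_Zero(1)[OF eB(1)] D' by simp
  then have "((S \<bullet> et (fobj tm M)) \<bullet> k) \<bullet> res h = Zero Q E D"
    using quot.Cmp_assoc[OF res_in_Hom[OF h] k(1) Se] sq quot.Cmp_assoc[OF j(1) tmm Se]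
      quot.Cmp_Zero(1)[OF j(1)] D' by simp
  moreover obtain s where s: "s \<in> Hom C M' D" "(S \<bullet> et (fobj tm M)) \<bullet> k = res s"
    by (rule Hom_Q_E[OF Sek])
  ultimately have "null (s \<cdot> h)"
    using res_Cmp[OF h s(1)] res_eq_Zero[OF Cmp_in_Hom[OF h s(1)]] by simp
  then have "null s" by (rule conf_U_null[OF E(1) u D s(1)])
  then have "(S \<bullet> et (fobj tm M)) \<bullet> k = Zero Q (fobj tm M) D \<bullet> k"
    using s(2) res_eq_Zero[OF s(1)] quot.Cmp_Zero(1)[OF k(1)] D' by simp
  then have "S \<bullet> et (fobj tm M) = Zero Q (fobj tm M) D"
    using iso_cancel_right[OF k(1,2,4) Se] quot.Zero_in_Hom epD(3)[OF cd(5)] D' by simp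
  then have "S \<bullet> et (fobj tm M) = Zero Q (H1o M) D \<bullet> et (fobj tm M)"
    using quot.Cmp_Zero(1)[OF eM(1)] D' by simp
  then show ?thesis using eM(5)[OF D S] quot.Zero_in_Hom eM(3) D' by simp
qed

lemma H2_mono:
  assumes "conf v M N n n' e" "v \<in> V" "D \<in> ext_minus"
    "S \<in> Hom Q D (H2o M)" "H2 (res n') \<bullet> S = Zero Q D (H2o N)"
  shows "S = Zero Q D (H2o M)"
  using heart_functors.H1_epi[OF dual_functors, unfolded dual_plus additive_quotient_op residue_op
      op_cat_simps Hom_op, OF assms] .

text \<open>Everything is moved to coreflections: \<open>f\<close> becomes f' : A' \<rightarrow> E,
  \<open>m\<close> becomes h : E \<rightarrow> M', and the class of E \<rightarrow> M' \<rightarrow>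
  u is again pushed forward from A'. The extension argument of \<open>cokernel_conf\<close> then
  applies, and tau^+ is reached through the universal property of \<open>et\<close>.\<close>

lemma H1_cokernel:
  assumes f: "f \<in> Hom C A B" and a: "conf A v u a a' e" and v: "v \<in> V" and u: "u \<in> U"
    and c: "conf B M u m m' (push f e)"
  shows "H1 (res m) \<bullet> H1 (res f) = Zero Q (H1o A) (H1o M)"
    and "\<lbrakk>D \<in> ext_plus; T \<in> Hom Q (H1o B) D; T \<bullet> H1 (res f) = Zero Q (H1o A) D\<rbrakk>
      \<Longrightarrow> \<exists>S\<in>Hom Q (H1o M) D. S \<bullet> H1 (res m) = T"
proof -
  note cd = confD[OF c] and ad = confD[OF a]
  note mQ = res_in_Hom[OF cd(1)] and fQ = res_in_Hom[OF f]
  obtain M' \<mu> where mu: "Rminus M M' \<mu>" using Rminus_exists cd(5) by blast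
  obtain E h h' x \<beta> where E: "conf E M' u h h' x" "Rminus B E \<beta>" "m \<cdot> \<beta> = \<mu> \<cdot> h" "push \<beta> x = push f e"
    using Rminus_conf_U[OF c u mu] by blast
  obtain A' \<alpha> where al: "Rminus A A' \<alpha>" using Rminus_exists ad(4) by blast
  note ah = Rminus_Hom[OF al] and bh = Rminus_Hom[OF E(2)] and muh = Rminus_Hom[OF mu]
  note ed = confD[OF E(1)]
  \<comment> \<open>The class \<open>e\<close> comes from A' because its image in Ext(u, v1) is
    zero, which is the condition in \<open>ex5'\<close>.\<close>
  obtain e' where e': "e' \<in> Ext u A'" "push \<alpha> e' = e"
  proof -
    obtain v1 v2 k d y where r: "v1 \<in> V" "v2 \<in> V" "d \<in> Hom C A v1" "y \<in> Ext v1 v2"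
      "conf v2 A' A k \<alpha> (pull y d)" by (rule RminusE[OF al])
    have "push d e = zer u v1" using UV_zer[OF u r(1) push_in[OF ad(3) r(3) ad(6)]] .
    then show ?thesis using ex5'[OF r(5,3,4) ad(3) ad(6)] that by blast
  qed
  obtain f' where f': "f' \<in> Hom C A' E" "\<beta> \<cdot> f' = f \<cdot> \<alpha>"
    using Rminus_lift[OF E(2) ah(2) Cmp_in_Hom[OF ah(1) f]] by blast
  \<comment> \<open>\<beta> is injective on Ext(u, -), as Ext(u, v2) = 0, so both classes may be
    compared in Ext(u, B).\<close>
  have x: "x = push f' e'"
  proof -
    obtain v1 v2 k d y where r: "v2 \<in> V" "conf v2 E B k \<beta> (pull y d)" by (rule RminusE[OF E(2)])
    have "push \<beta> x = push \<beta> (push f' e')"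
      using E(4) e'(2) push_Cmp[OF e'(1) f'(1) bh(1) ad(6)] push_Cmp[OF e'(1) ah(1) f ad(6)] f'(2) by simp
    then show ?thesis
      using ex4'[OF r(2) ed(3) push_in[OF e'(1) f'(1) ad(6)] ad(6)] UV_zer[OF u r(1)] by blast
  qed
  \<comment> \<open>m f factors through \<open>a\<close>, whose target is in V but perhaps not in W.
    On A', which lies in \<open>ext_minus\<close>, the composite with \<open>a\<close> is null
    nevertheless, and \<open>Rminus_null\<close> then removes \<mu>.\<close>
  have hf: "null (h \<cdot> f')"
  proof -
    have "push (m \<cdot> f) e = zer u M"
      using push_Cmp[OF ad(3) f cd(1) ad(6)] conf_push[OF c] by simp
    then obtain r where r: "r \<in> Hom C v M" "r \<cdot> a = m \<cdot> f"
      using extend_iff[OF a Cmp_in_Hom[OF f cd(1)]] by blast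
    have "null (a \<cdot> \<alpha>)" using minus_to_V_null[OF v ah(2) Cmp_in_Hom[OF ah(1) ad(1)]] .
    then have "null (r \<cdot> (a \<cdot> \<alpha>))" by (rule null_Cmp_left[OF _ Cmp_in_Hom[OF ah(1) ad(1)] r(1)])
    moreover have "r \<cdot> (a \<cdot> \<alpha>) = \<mu> \<cdot> (h \<cdot> f')"
      using Cmp_assoc[OF ah(1) ad(1) r(1)] r(2) Cmp_assoc[OF ah(1) f cd(1)] f'(2)
        Cmp_assoc[OF f'(1) bh(1) cd(1)] E(3) Cmp_assoc[OF f'(1) ed(1) muh(1)] by simp
    ultimately show ?thesis using Rminus_null[OF mu ah(2) Cmp_in_Hom[OF f'(1) ed(1)]] by simp
  qed
  obtain i i' where i: "i \<in> Hom Q A' (fobj tm A)" "i' \<in> Hom Q (fobj tm A) A'"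
    "ep A \<bullet> i = res \<alpha>" "i \<bullet> i' = Idn Q (fobj tm A)" using tm_iso[OF al] by blast
  obtain j j' where j: "j \<in> Hom Q E (fobj tm B)" "j' \<in> Hom Q (fobj tm B) E"
    "ep B \<bullet> j = res \<beta>" "j \<bullet> j' = Idn Q (fobj tm B)" using tm_iso[OF E(2)] by blast
  obtain k k' where k: "k \<in> Hom Q M' (fobj tm M)" "k' \<in> Hom Q (fobj tm M) M'"
    "ep M \<bullet> k = res \<mu>" "k' \<bullet> k = Idn Q M'" using tm_iso[OF mu] by blast
  note eA = etD[OF epD(3)[OF ad(4)]] and eB = etD[OF epD(3)[OF cd(4)]] and eM = etD[OF epD(3)[OF cd(5)]]
  note tmm = tm_Hom[OF mQ] and tmf = tm_Hom[OF fQ] and hQ = res_in_Hom[OF ed(1)] and f'Q = res_in_Hom[OF f'(1)]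
  note H1m = H1_Hom[OF mQ] and H1f = H1_Hom[OF fQ]
  have sqm: "farr tm (res m) \<bullet> j = k \<bullet> res h"
    by (rule tm_square[OF cd(1) E(2) mu ed(1) _ j(1,3) k(1,3)]) (simp only: E(3))
  have sqf: "farr tm (res f) \<bullet> i = j \<bullet> res f'"
    by (rule tm_square[OF f al E(2) f'(1) _ i(1,3) j(1,3)]) (simp only: f'(2))
  show "H1 (res m) \<bullet> H1 (res f) = Zero Q (H1o A) (H1o M)"
  proof (rule eA(5)[OF eM(2)])
    show "H1 (res m) \<bullet> H1 (res f) \<in> Hom Q (H1o A) (H1o M)" using quot.Cmp_in_Hom[OF H1f H1m] .
    show "Zero Q (H1o A) (H1o M) \<in> Hom Q (H1o A) (H1o M)" using quot.Zero_in_Hom eA(3) eM(3) by simp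
    have "(farr tm (res m) \<bullet> farr tm (res f)) \<bullet> i = k \<bullet> (res h \<bullet> res f')"
      using quot.Cmp_assoc[OF i(1) tmf tmm] sqf quot.Cmp_assoc[OF f'Q j(1) tmm] sqm
        quot.Cmp_assoc[OF f'Q hQ k(1)] by simp
    also have "res h \<bullet> res f' = Zero Q A' M'"
      using res_Cmp[OF f'(1) ed(1)] res_eq_Zero[OF Cmp_in_Hom[OF f'(1) ed(1)]] hf by simp
    also have "k \<bullet> Zero Q A' M' = Zero Q (fobj tm A) (fobj tm M) \<bullet> i"
      using quot.Cmp_Zero(2)[OF k(1)] quot.Cmp_Zero(1)[OF i(1)] Hom_Obj[OF f'(1)] epD(3)[OF cd(5)] by simp
    finally have 0: "farr tm (res m) \<bullet> farr tm (res f) = Zero Q (fobj tm A) (fobj tm M)"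
      using iso_cancel_right[OF i(1,2,4) quot.Cmp_in_Hom[OF tmf tmm]] quot.Zero_in_Hom
        epD(3)[OF cd(5)] epD(3)[OF ad(4)] by simp
    have "(H1 (res m) \<bullet> H1 (res f)) \<bullet> et (fobj tm A)
        = et (fobj tm M) \<bullet> (farr tm (res m) \<bullet> farr tm (res f))"
      using quot.Cmp_assoc[OF eA(1) H1f H1m] H1_nat[OF fQ] quot.Cmp_assoc[OF tmf eB(1) H1m] H1_nat[OF mQ]
        quot.Cmp_assoc[OF tmf tmm eM(1)] by simp
    then show "(H1 (res m) \<bullet> H1 (res f)) \<bullet> et (fobj tm A)
        = Zero Q (H1o A) (H1o M) \<bullet> et (fobj tm A)"
      using 0 quot.Cmp_Zero(2)[OF eM(1)] quot.Cmp_Zero(1)[OF eA(1)] eM(3) epD(3)[OF ad(4)] by simp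
  qed
  assume D: "D \<in> ext_plus" and T: "T \<in> Hom Q (H1o B) D"
    and z: "T \<bullet> H1 (res f) = Zero Q (H1o A) D"
  note D' = plus_Obj[OF D]
  note Te = quot.Cmp_in_Hom[OF eB(1) T]
  obtain t where t: "t \<in> Hom C E D" "(T \<bullet> et (fobj tm B)) \<bullet> j = res t"
    by (rule Hom_Q_E[OF quot.Cmp_in_Hom[OF j(1) Te]])
  have "(T \<bullet> et (fobj tm B)) \<bullet> farr tm (res f) = Zero Q (fobj tm A) D"
    using quot.Cmp_assoc[OF tmf eB(1) T] H1_nat[OF fQ] quot.Cmp_assoc[OF eA(1) H1f T] z
      quot.Cmp_Zero(1)[OF eA(1)] D' by simp
  then have "res t \<bullet> res f' = Zero Q A' D"
    using quot.Cmp_assoc[OF f'Q j(1) Te] sqf quot.Cmp_assoc[OF i(1) tmf Te] t(2)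
      quot.Cmp_Zero(1)[OF i(1)] D' by simp
  then have "null (t \<cdot> f')"
    using res_Cmp[OF f'(1) t(1)] res_eq_Zero[OF Cmp_in_Hom[OF f'(1) t(1)]] by simp
  then obtain w p q where w: "w \<in> W" "p \<in> Hom C A' w" "q \<in> Hom C w D" "t \<cdot> f' = q \<cdot> p"
    by (rule nullE[OF _ Cmp_in_Hom[OF f'(1) t(1)]])
  \<comment> \<open>The null composite t f' kills e' because its middle object is in V; hence
    \<open>t\<close> kills \<open>x\<close> and extends along \<open>h\<close>.\<close>
  have "push p e' = zer u w" using UV_zer[OF u _ push_in[OF e'(1) w(2) ad(6)]] w(1) W_def by blast
  then have "push t x = zer u D"
    unfolding x using push_Cmp[OF e'(1) f'(1) t(1) ad(6)] push_Cmp[OF e'(1) w(2,3) ad(6)] w(4)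
      push_zer[OF w(3) ad(6)] by simp
  then obtain s where s: "s \<in> Hom C M' D" "s \<cdot> h = t" using extend_iff[OF E(1) t(1)] by blast
  note sQ = res_in_Hom[OF s(1)]
  note sk = quot.Cmp_in_Hom[OF k(2) sQ]
  obtain S where S: "S \<in> Hom Q (H1o M) D" "S \<bullet> et (fobj tm M) = res s \<bullet> k'"
    using eM(4)[OF D sk] by blast
  note Sm = quot.Cmp_in_Hom[OF H1m S(1)]
  have "((S \<bullet> H1 (res m)) \<bullet> et (fobj tm B)) \<bullet> j = ((res s \<bullet> k') \<bullet> farr tm (res m)) \<bullet> j"
    using quot.Cmp_assoc[OF eB(1) H1m S(1)] H1_nat[OF mQ] quot.Cmp_assoc[OF tmm eM(1) S(1)] S(2) by simp
  also have "\<dots> = ((res s \<bullet> k') \<bullet> k) \<bullet> res h"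
    using quot.Cmp_assoc[OF j(1) tmm sk] sqm quot.Cmp_assoc[OF hQ k(1) sk] by simp
  also have "(res s \<bullet> k') \<bullet> k = res s"
    using quot.Cmp_assoc[OF k(1,2) sQ] k(4) quot.Idn_right[OF sQ] by simp
  also have "res s \<bullet> res h = (T \<bullet> et (fobj tm B)) \<bullet> j"
    using res_Cmp[OF ed(1) s(1)] s(2) t(2) by simp
  finally have "(S \<bullet> H1 (res m)) \<bullet> et (fobj tm B) = T \<bullet> et (fobj tm B)"
    by (rule iso_cancel_right[OF j(1,2,4) quot.Cmp_in_Hom[OF eB(1) Sm] Te])
  then have "S \<bullet> H1 (res m) = T" by (rule eB(5)[OF D Sm T])
  then show "\<exists>S\<in>Hom Q (H1o M) D. S \<bullet> H1 (res m) = T" using S(1) by blast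
qed

text \<open>The map \<open>et A \<bullet> ep A\<close> extends over the reflection of
  \<open>fobj tm A\<close> because its target is in \<open>ext_plus\<close>; the extension lifts
  through the coreflection of \<open>fobj tp A\<close> because \<open>H1o A\<close> is in
  \<open>ext_minus\<close>.\<close>

lemma comparison_exists:
  assumes A: "A \<in> Obj C"
  shows "\<exists>\<theta>\<in>Hom Q (H1o A) (H2o A).
    (ep (fobj tp A) \<bullet> \<theta>) \<bullet> et (fobj tm A) = et A \<bullet> ep A"
proof -
  note e = etD[OF A] and p = epD[OF A]
  obtain x where x: "x \<in> Hom Q (H1o A) (fobj tp A)" "x \<bullet> et (fobj tm A) = et A \<bullet> ep A"
    using etD(4)[OF p(3) e(2) quot.Cmp_in_Hom[OF p(1) e(1)]] by blast
  obtain \<theta> where "\<theta> \<in> Hom Q (H1o A) (H2o A)" "ep (fobj tp A) \<bullet> \<theta> = x"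
    using epD(4)[OF e(3) _ x(1)] H1o_hrt[OF A] by blast
  then show ?thesis using x(2) by blast
qed

definition cmpr :: "'o \<Rightarrow> 'm set" where
  "cmpr A = (SOME \<theta>. \<theta> \<in> Hom Q (H1o A) (H2o A) \<and>
     (ep (fobj tp A) \<bullet> \<theta>) \<bullet> et (fobj tm A) = et A \<bullet> ep A)"

lemma cmpr:
  assumes "A \<in> Obj C"
  shows "cmpr A \<in> Hom Q (H1o A) (H2o A)"
    "(ep (fobj tp A) \<bullet> cmpr A) \<bullet> et (fobj tm A) = et A \<bullet> ep A"
proof -
  have "\<exists>\<theta>. \<theta> \<in> Hom Q (H1o A) (H2o A) \<and>
     (ep (fobj tp A) \<bullet> \<theta>) \<bullet> et (fobj tm A) = et A \<bullet> ep A"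
    using comparison_exists[OF assms] by blast
  from someI_ex[OF this] show "cmpr A \<in> Hom Q (H1o A) (H2o A)"
    "(ep (fobj tp A) \<bullet> cmpr A) \<bullet> et (fobj tm A) = et A \<bullet> ep A"
    unfolding cmpr_def by blast+
qed

lemma cmpr_iso:
  assumes A: "A \<in> Obj C"
  shows "is_iso Q (cmpr A)"
proof -
  obtain M P N m z z' n where s: "Rminus A M m" "Rplus A N z" "Rplus M P z'" "Rminus N P n" "n \<cdot> z' = z \<cdot> m"
    using Rminus_Rplus_square[OF A] by blast
  have sq: "res n \<bullet> res z' = res z \<bullet> res m"
    using res_Cmp[OF Rplus_Hom(1)[OF s(3)] Rminus_Hom(1)[OF s(4)]]
      res_Cmp[OF Rminus_Hom(1)[OF s(1)] Rplus_Hom(1)[OF s(2)]] s(5) by simp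
  show ?thesis
    by (rule quot.reflection_comparison_iso[OF Rminus_coreflects[OF s(1)] Rplus_reflects[OF s(2)]
          Rplus_reflects[OF s(3)] Rminus_coreflects[OF s(4)] sq ep[OF A] et[OF A]
          et[OF epD(3)[OF A]] ep[OF etD(3)[OF A]] cmpr[OF A]])
qed

lemma cmpr_nat:
  assumes F: "F \<in> Hom Q A B"
  shows "cmpr B \<bullet> H1 F = H2 F \<bullet> cmpr A"
proof -
  have o: "A \<in> Obj C" "B \<in> Obj C" using quot.Hom_Obj[OF F] by simp_all
  note eA = etD[OF o(1)] and pA = epD[OF o(1)] and eB = etD[OF o(2)] and pB = epD[OF o(2)]
  note e1A = etD[OF pA(3)] and e1B = etD[OF pB(3)] and p2A = epD[OF eA(3)] and p2B = epD[OF eB(3)]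
  note tmF = tm_Hom[OF F] and tpF = tp_Hom[OF F] and H1F = H1_Hom[OF F] and H2F = H2_Hom[OF F]
  note cA = cmpr[OF o(1)] and cB = cmpr[OF o(2)]
  note x = quot.Cmp_in_Hom[OF H1F cB(1)] and y = quot.Cmp_in_Hom[OF cA(1) H2F]
  note pc = quot.Cmp_in_Hom[OF cB(1) p2B(1)] and pcA = quot.Cmp_in_Hom[OF cA(1) p2A(1)]
  have "(ep (fobj tp B) \<bullet> (cmpr B \<bullet> H1 F)) \<bullet> et (fobj tm A)
      = ((ep (fobj tp B) \<bullet> cmpr B) \<bullet> et (fobj tm B)) \<bullet> farr tm F"
    using quot.Cmp_assoc[OF H1F cB(1) p2B(1)] quot.Cmp_assoc[OF e1A(1) H1F pc] H1_nat[OF F]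
      quot.Cmp_assoc[OF tmF e1B(1) pc] by simp
  also have "\<dots> = et B \<bullet> (F \<bullet> ep A)"
    using cB(2) quot.Cmp_assoc[OF tmF pB(1) eB(1)] ep_nat[OF F] by simp
  also have "\<dots> = farr tp F \<bullet> (et A \<bullet> ep A)"
    using quot.Cmp_assoc[OF pA(1) F eB(1)] et_nat[OF F] quot.Cmp_assoc[OF pA(1) eA(1) tpF] by simp
  also have "\<dots> = (farr tp F \<bullet> (ep (fobj tp A) \<bullet> cmpr A)) \<bullet> et (fobj tm A)"
    using cA(2) quot.Cmp_assoc[OF e1A(1) pcA tpF] by simp
  also have "farr tp F \<bullet> (ep (fobj tp A) \<bullet> cmpr A) = ep (fobj tp B) \<bullet> (H2 F \<bullet> cmpr A)"
    using quot.Cmp_assoc[OF cA(1) p2A(1) tpF] ep_nat[OF tpF] quot.Cmp_assoc[OF cA(1) H2F p2B(1)] by simp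
  finally have "ep (fobj tp B) \<bullet> (cmpr B \<bullet> H1 F) = ep (fobj tp B) \<bullet> (H2 F \<bullet> cmpr A)"
    by (rule e1A(5)[OF eB(2) quot.Cmp_in_Hom[OF x p2B(1)] quot.Cmp_in_Hom[OF y p2B(1)]])
  then show ?thesis using p2B(5)[OF _ x y] H1o_hrt[OF o(1)] by blast
qed

text \<open>The dual of \<open>H1_epi\<close> speaks about \<open>H2\<close>; naturality and
  invertibility of \<open>cmpr\<close> carry it over to \<open>H1\<close>.\<close>

lemma H1_mono:
  assumes c: "conf v M N n n' e" and v: "v \<in> V" and D: "D \<in> ext_minus"
    and S: "S \<in> Hom Q D (H1o M)" and z: "H1 (res n') \<bullet> S = Zero Q D (H1o N)"
  shows "S = Zero Q D (H1o M)"
proof -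
  note cd = confD[OF c]
  note nQ = res_in_Hom[OF cd(2)] and D' = minus_Obj[OF D]
  note cM = cmpr(1)[OF cd(5)] and cN = cmpr(1)[OF cd(6)]
  note H1n = H1_Hom[OF nQ] and H2n = H2_Hom[OF nQ]
  have oH: "H1o M \<in> Obj C" "H2o M \<in> Obj C" "H2o N \<in> Obj C"
    using H1o_hrt H2o_hrt cd(5,6) plus_Obj by blast+
  have "H2 (res n') \<bullet> (cmpr M \<bullet> S) = cmpr N \<bullet> (H1 (res n') \<bullet> S)"
    using quot.Cmp_assoc[OF S cM H2n] cmpr_nat[OF nQ] quot.Cmp_assoc[OF S H1n cN] by simp
  also have "\<dots> = Zero Q D (H2o N)" using z quot.Cmp_Zero(2)[OF cN] D' by simp
  finally have 0: "cmpr M \<bullet> S = Zero Q D (H2o M)"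
    by (rule H2_mono[OF c v D quot.Cmp_in_Hom[OF S cM]])
  obtain i where i: "i \<in> Hom Q (H2o M) (H1o M)" "i \<bullet> cmpr M = Idn Q (H1o M)"
    using cmpr_iso[OF cd(5)] Hom_Dom[OF cM] Hom_Cod[OF cM] unfolding is_iso_def by metis
  have "S = i \<bullet> (cmpr M \<bullet> S)"
    using quot.Cmp_assoc[OF S cM i(1)] i(2) quot.Idn_left[OF S] by simp
  then show ?thesis using 0 quot.Cmp_Zero(2)[OF i(1)] D' by simp
qed

end

section \<open>Triangulated categories\<close>

context triangulated_category
begin

lemma S_functor: "is_functor T T (Shift T)"
  using Shift_additive by (simp add: additive_functor_def)

lemma S_Obj: "A \<in> Obj T \<Longrightarrow> sobj T A \<in> Obj T"
  using S_functor by (simp add: is_functor_def)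

lemma S_Hom:
  assumes "f \<in> Hom T A B"
  shows "sarr T f \<in> Hom T (sobj T A) (sobj T B)"
  using S_functor assms Hom_Obj[OF assms] unfolding is_functor_def by blast

lemma S_Idn: "A \<in> Obj T \<Longrightarrow> sarr T (Idn T A) = Idn T (sobj T A)"
  using S_functor unfolding is_functor_def by blast

lemma functor_Cmp:
  assumes "is_functor D E F" "f \<in> Hom D A B" "g \<in> Hom D B B'"
  shows "farr F (g \<cdot>\<^bsub>D\<^esub> f) = farr F g \<cdot>\<^bsub>E\<^esub> farr F f"
  using assms unfolding is_functor_def Hom_def by auto

lemma S_Cmp: "f \<in> Hom T A B \<Longrightarrow> g \<in> Hom T B D \<Longrightarrow> sarr T (g \<cdot> f) = sarr T g \<cdot> sarr T f"
  using functor_Cmp[OF S_functor] .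

lemma S_Add:
  assumes "f \<in> Hom T A B" "g \<in> Hom T A B"
  shows "sarr T (Add T f g) = Add T (sarr T f) (sarr T g)"
  using Shift_additive assms Hom_Obj[OF assms(1)] unfolding additive_functor_def by blast

lemma S_Zero:
  assumes "A \<in> Obj T" "B \<in> Obj T"
  shows "sarr T (Zero T A B) = Zero T (sobj T A) (sobj T B)"
proof -
  note z = Zero_in_Hom[OF assms]
  show ?thesis
    by (rule Add_idem_Zero[OF S_Hom[OF z]]) (simp only: S_Add[OF z z, symmetric] Add_Zero[OF z])
qed

lemma S_Neg:
  assumes "f \<in> Hom T A B"
  shows "sarr T (Neg T f) = Neg T (sarr T f)"
proof (rule Neg_unique[OF S_Hom[OF assms] S_Hom[OF Neg_in_Hom[OF assms]]])
  show "Add T (sarr T f) (sarr T (Neg T f)) = Zero T (sobj T A) (sobj T B)"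
    using S_Add[OF assms Neg_in_Hom[OF assms]] Add_Neg(1)[OF assms] S_Zero Hom_Obj[OF assms] by simp
qed

lemma S_Sub:
  assumes "f \<in> Hom T A B" "g \<in> Hom T A B"
  shows "sarr T (Sub f g) = Sub (sarr T f) (sarr T g)"
  unfolding Sub_def using S_Add[OF assms(1) Neg_in_Hom[OF assms(2)]] S_Neg[OF assms(2)] by simp

lemma iso_D:
  assumes "is_iso T f" "f \<in> Hom T A B"
  obtains g where "g \<in> Hom T B A" "g \<cdot> f = Idn T A" "f \<cdot> g = Idn T B"
  using assms by (auto simp: is_iso_def Hom_def)

lemma iso_I:
  assumes "f \<in> Hom T A B" "g \<in> Hom T B A" "g \<cdot> f = Idn T A" "f \<cdot> g = Idn T B"
  shows "is_iso T f"
  using assms by (auto simp: is_iso_def Hom_def)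

lemma iso_epi_cancel:
  assumes "is_iso T i" "i \<in> Hom T A B" "f \<in> Hom T B D" "g \<in> Hom T B D" "f \<cdot> i = g \<cdot> i"
  shows "f = g"
proof -
  obtain j where j: "j \<in> Hom T B A" "i \<cdot> j = Idn T B" using iso_D[OF assms(1,2)] by blast
  show ?thesis
    using Cmp_assoc[OF j(1) assms(2,3)] Cmp_assoc[OF j(1) assms(2,4)] j(2) assms(5)
      Idn_right[OF assms(3)] Idn_right[OF assms(4)] by simp
qed

text \<open>Naturality expresses \<open>f\<close> preceded by an isomorphism through the value of
  \<open>F\<close> at \<open>f\<close>.\<close>

lemma naturally_id_faithful:
  assumes n: "naturally_isomorphic T T F id_func" and f: "f \<in> Hom T A B" and g: "g \<in> Hom T A B"
    and e: "farr F f = farr F g"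
  shows "f = g"
proof -
  obtain \<theta> where th: "\<forall>A\<in>Obj T. \<theta> A \<in> Hom T (fobj F A) A \<and> is_iso T (\<theta> A)"
    "\<forall>f\<in>Arr T. \<theta> (Cod T f) \<cdot> farr F f = f \<cdot> \<theta> (Dom T f)"
    using n unfolding naturally_isomorphic_def id_func_def by auto
  have "f \<cdot> \<theta> A = g \<cdot> \<theta> A"
    using th(2) Hom_Arr[OF f] Hom_Arr[OF g] e
    unfolding Hom_Dom[OF f, symmetric] by (metis Hom_Dom[OF f] Hom_Dom[OF g] Hom_Cod[OF f] Hom_Cod[OF g])
  then show ?thesis using iso_epi_cancel th(1) Hom_Obj[OF f] f g by blast
qed

lemma S_equivalence:
  obtains G where "is_functor T T G" "naturally_isomorphic T T (G \<circ>\<^sub>F Shift T) id_func"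
    "naturally_isomorphic T T (Shift T \<circ>\<^sub>F G) id_func"
  using Shift_equivalence unfolding is_equivalence_def by blast

lemma S_faithful:
  assumes "f \<in> Hom T A B" "g \<in> Hom T A B" "sarr T f = sarr T g"
  shows "f = g"
proof -
  obtain G where G: "naturally_isomorphic T T (G \<circ>\<^sub>F Shift T) id_func" by (rule S_equivalence)
  show ?thesis
    by (rule naturally_id_faithful[OF G assms(1,2)]) (simp add: comp_func_def assms(3))
qed

lemma S_surj:
  assumes "B \<in> Obj T"
  obtains A \<phi> \<phi>' where "A \<in> Obj T" "\<phi> \<in> Hom T (sobj T A) B" "\<phi>' \<in> Hom T B (sobj T A)"
    "\<phi>' \<cdot> \<phi> = Idn T (sobj T A)" "\<phi> \<cdot> \<phi>' = Idn T B"
proof -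
  obtain G where G: "is_functor T T G" "naturally_isomorphic T T (Shift T \<circ>\<^sub>F G) id_func"
    by (rule S_equivalence)
  obtain \<theta> where th: "\<theta> \<in> Hom T (sobj T (fobj G B)) B" "is_iso T \<theta>"
    using G(2) assms unfolding naturally_isomorphic_def id_func_def comp_func_def by auto
  obtain g where "g \<in> Hom T B (sobj T (fobj G B))" "g \<cdot> \<theta> = Idn T (sobj T (fobj G B))" "\<theta> \<cdot> g = Idn T B"
    by (rule iso_D[OF th(2,1)])
  moreover have "fobj G B \<in> Obj T" using G(1) assms by (simp add: is_functor_def)
  ultimately show ?thesis using that th(1) by blast
qed

text \<open>Conjugating \<open>farr G h\<close> for a quasi-inverse \<open>G\<close> produces
  \<open>f\<close> with the same image under \<open>G\<close> as its shift and \<open>h\<close>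
  require; \<open>G\<close> is faithful on these maps because the shift after \<open>G\<close> is
  isomorphic to the identity.\<close>

lemma S_full:
  assumes h: "h \<in> Hom T (sobj T A) (sobj T B)" and A: "A \<in> Obj T" and B: "B \<in> Obj T"
  obtains f where "f \<in> Hom T A B" "sarr T f = h"
proof -
  obtain G where G: "is_functor T T G" "naturally_isomorphic T T (G \<circ>\<^sub>F Shift T) id_func"
    "naturally_isomorphic T T (Shift T \<circ>\<^sub>F G) id_func"
    by (rule S_equivalence)
  obtain \<theta> where th: "\<forall>A\<in>Obj T. \<theta> A \<in> Hom T (fobj G (sobj T A)) A \<and> is_iso T (\<theta> A)"
    "\<forall>f\<in>Arr T. \<theta> (Cod T f) \<cdot> farr G (sarr T f) = f \<cdot> \<theta> (Dom T f)"
    using G(2) unfolding naturally_isomorphic_def id_func_def comp_func_def by auto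
  have G_Hom: "farr G f \<in> Hom T (fobj G A) (fobj G B)" if f: "f \<in> Hom T A B" for f A B
    using G(1) f Hom_Obj[OF f] unfolding is_functor_def by blast
  have tA: "\<theta> A \<in> Hom T (fobj G (sobj T A)) A" "is_iso T (\<theta> A)"
    and tB: "\<theta> B \<in> Hom T (fobj G (sobj T B)) B" "is_iso T (\<theta> B)" using th(1) A B by blast+
  obtain i where i: "i \<in> Hom T A (fobj G (sobj T A))" "i \<cdot> \<theta> A = Idn T (fobj G (sobj T A))" "\<theta> A \<cdot> i = Idn T A"
    by (rule iso_D[OF tA(2,1)])
  obtain k where k: "k \<in> Hom T B (fobj G (sobj T B))" "k \<cdot> \<theta> B = Idn T (fobj G (sobj T B))"
    by (rule iso_D[OF tB(2,1)])
  note Gh = G_Hom[OF h]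
  note Ghi = Cmp_in_Hom[OF i(1) Gh]
  define f where "f = \<theta> B \<cdot> (farr G h \<cdot> i)"
  have f: "f \<in> Hom T A B" unfolding f_def using Cmp_in_Hom[OF Ghi tB(1)] .
  have "\<theta> B \<cdot> farr G (sarr T f) = f \<cdot> \<theta> A"
    using th(2) Hom_Arr[OF f] Hom_Dom[OF f] Hom_Cod[OF f] by metis
  also have "\<dots> = \<theta> B \<cdot> farr G h"
    unfolding f_def using Cmp_assoc[OF tA(1) Ghi tB(1)] Cmp_assoc[OF tA(1) i(1) Gh] i(2) Idn_right[OF Gh]
    by simp
  finally have "k \<cdot> (\<theta> B \<cdot> farr G (sarr T f)) = k \<cdot> (\<theta> B \<cdot> farr G h)" by simp
  then have e: "farr G (sarr T f) = farr G h"
    using Cmp_assoc[OF G_Hom[OF S_Hom[OF f]] tB(1) k(1)] Cmp_assoc[OF Gh tB(1) k(1)] k(2)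
      Idn_left[OF G_Hom[OF S_Hom[OF f]]] Idn_left[OF Gh] by simp
  have "sarr T f = h"
    by (rule naturally_id_faithful[OF G(3) S_Hom[OF f] h]) (simp add: comp_func_def e)
  then show ?thesis using that f by blast
qed

section \<open>Distinguished triangles with named objects, and exactness of Hom\<close>

definition dconf :: "'o \<Rightarrow> 'o \<Rightarrow> 'o \<Rightarrow> 'm \<Rightarrow> 'm \<Rightarrow> 'm \<Rightarrow> bool" where
  "dconf A B D f g h \<longleftrightarrow> f \<in> Hom T A B \<and> g \<in> Hom T B D \<and> h \<in> Hom T D (sobj T A) \<and> (f, g, h) \<in> Dist T"

lemma dconfI: "\<lbrakk>f \<in> Hom T A B; g \<in> Hom T B D; h \<in> Hom T D (sobj T A); (f, g, h) \<in> Dist T\<rbrakk> \<Longrightarrow> dconf A B D f g h"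
  by (simp add: dconf_def)

lemma dconfD:
  assumes "dconf A B D f g h"
  shows "f \<in> Hom T A B" "g \<in> Hom T B D" "h \<in> Hom T D (sobj T A)" "(f, g, h) \<in> Dist T"
    "A \<in> Obj T" "B \<in> Obj T" "D \<in> Obj T"
  using assms Hom_Obj[of f A B] Hom_Obj[of g B D] by (auto simp: dconf_def)

lemma Dist_dconf:
  assumes "(f, g, h) \<in> Dist T"
  shows "dconf (Dom T f) (Dom T g) (Cod T g) f g h"
  using Dist_triangle[OF assms] assms by (simp add: dconf_def triangle_def Hom_def)

lemma triangleI:
  assumes "f \<in> Hom T A B" "g \<in> Hom T B D" "h \<in> Hom T D (sobj T A)"
  shows "triangle T f g h"
  using assms by (simp add: triangle_def Hom_def)

lemma dconf_cone:
  assumes "f \<in> Hom T A B"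
  obtains D g h where "dconf A B D f g h"
proof -
  obtain g h where gh: "(f, g, h) \<in> Dist T" using Dist_cone Hom_Arr[OF assms] by blast
  have "Dom T g = B" using Dist_triangle[OF gh] Hom_Cod[OF assms] by (simp add: triangle_def)
  then show ?thesis using that Dist_dconf[OF gh] Hom_Dom[OF assms] by simp
qed

lemma dconf_rotate:
  assumes "dconf A B D f g h"
  shows "dconf B D (sobj T A) g h (Neg T (sarr T f))"
proof -
  note d = dconfD[OF assms]
  show ?thesis
    using Dist_rotate[OF triangleI[OF d(1-3)]] d Neg_in_Hom[OF S_Hom[OF d(1)]] by (simp add: dconf_def)
qed

lemma dconf_rotate_back:
  assumes f: "f \<in> Hom T A B" and d: "dconf B D (sobj T A) g h (Neg T (sarr T f))"
  shows "dconf A B D f g h"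
  using Dist_rotate[OF triangleI[OF f dconfD(1,2)[OF d]]] f dconfD[OF d] by (simp add: dconf_def)

lemma dconf_iso:
  assumes d: "dconf A B D f g h"
    and h: "f' \<in> Hom T A' B'" "g' \<in> Hom T B' D'" "h' \<in> Hom T D' (sobj T A')"
    and i: "a \<in> Hom T A A'" "b \<in> Hom T B B'" "c \<in> Hom T D D'" "is_iso T a" "is_iso T b" "is_iso T c"
    and s: "b \<cdot> f = f' \<cdot> a" "c \<cdot> g = g' \<cdot> b" "sarr T a \<cdot> h = h' \<cdot> c"
  shows "dconf A' B' D' f' g' h'"
proof (rule dconfI[OF h])
  note dd = dconfD[OF d]
  show "(f', g', h') \<in> Dist T"
    by (rule Dist_iso[OF dd(4) triangleI[OF h] _ _ _ i(4-6) s])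
      (simp_all only: i(1-3) Hom_Dom[OF dd(1)] Hom_Dom[OF dd(2)] Hom_Dom[OF dd(3)]
        Hom_Dom[OF h(1)] Hom_Dom[OF h(2)] Hom_Dom[OF h(3)])
qed

lemma is_iso_Idn: "A \<in> Obj T \<Longrightarrow> is_iso T (Idn T A)"
  using iso_I[OF Idn_in_Hom Idn_in_Hom] Idn_left[OF Idn_in_Hom] by simp

lemma dconf_iso_end:
  assumes d: "dconf A B D f g h" and i: "\<phi> \<in> Hom T D D'" "\<psi> \<in> Hom T D' D" "\<psi> \<cdot> \<phi> = Idn T D" "\<phi> \<cdot> \<psi> = Idn T D'"
  shows "dconf A B D' f (\<phi> \<cdot> g) (h \<cdot> \<psi>)"
proof -
  note dd = dconfD[OF d]
  note pg = Cmp_in_Hom[OF dd(2) i(1)] and hp = Cmp_in_Hom[OF i(2) dd(3)]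
  show ?thesis
  proof (rule dconf_iso[OF d dd(1) pg hp Idn_in_Hom[OF dd(5)] Idn_in_Hom[OF dd(6)] i(1) is_iso_Idn[OF dd(5)] is_iso_Idn[OF dd(6)]])
    show "is_iso T \<phi>" by (rule iso_I[OF i])
    show "Idn T B \<cdot> f = f \<cdot> Idn T A" using Idn_left[OF dd(1)] Idn_right[OF dd(1)] by simp
    show "\<phi> \<cdot> g = \<phi> \<cdot> g \<cdot> Idn T B" using Idn_right[OF pg] by simp
    show "sarr T (Idn T A) \<cdot> h = h \<cdot> \<psi> \<cdot> \<phi>"
      using S_Idn[OF dd(5)] Idn_left[OF dd(3)] Cmp_assoc[OF i(1,2) dd(3)] i(3) Idn_right[OF dd(3)] by simp
  qed
qed

lemma dconf_complete:
  assumes d: "dconf A B D f g h" and d': "dconf A' B' D' f' g' h'"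
    and i: "a \<in> Hom T A A'" "b \<in> Hom T B B'" "b \<cdot> f = f' \<cdot> a"
  obtains c where "c \<in> Hom T D D'" "c \<cdot> g = g' \<cdot> b" "sarr T a \<cdot> h = h' \<cdot> c"
proof -
  note dd = dconfD[OF d] and dd' = dconfD[OF d']
  have "\<exists>c\<in>Hom T (Dom T h) (Dom T h'). c \<cdot> g = g' \<cdot> b \<and> sarr T a \<cdot> h = h' \<cdot> c"
    by (rule Dist_complete[OF dd(4) dd'(4) _ _ i(3)])
      (simp_all only: i(1,2) Hom_Dom[OF dd(1)] Hom_Dom[OF dd(2)] Hom_Dom[OF dd'(1)] Hom_Dom[OF dd'(2)])
  then show ?thesis using that Hom_Dom[OF dd(3)] Hom_Dom[OF dd'(3)] by auto
qed

lemma dconf_octahedral: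
  assumes d1: "dconf A B D f f' f''" and d2: "dconf B B' E g g' g''" and d3: "dconf A B' M (g \<cdot> f) h' h''"
  obtains u v where "dconf D M E u v (sarr T f' \<cdot> g'')"
    "u \<cdot> f' = h' \<cdot> g" "h'' \<cdot> u = f''" "v \<cdot> h' = g'" "g'' \<cdot> v = sarr T f \<cdot> h''"
proof -
  note d = dconfD[OF d1] and e = dconfD[OF d2] and k = dconfD[OF d3]
  have "Cod T f = Dom T g" using Hom_Cod[OF d(1)] Hom_Dom[OF e(1)] by simp
  from Dist_octahedral[OF d(4) e(4) this k(4)]
  obtain u v where uv: "u \<in> Hom T D M" "v \<in> Hom T M E" "(u, v, sarr T f' \<cdot> g'') \<in> Dist T"
    "u \<cdot> f' = h' \<cdot> g" "h'' \<cdot> u = f''" "v \<cdot> h' = g'" "g'' \<cdot> v = sarr T f \<cdot> h''"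
    unfolding Hom_Cod[OF d(2)] Hom_Cod[OF e(2)] Hom_Cod[OF k(2)] by blast
  have "sarr T f' \<cdot> g'' \<in> Hom T E (sobj T D)" using Cmp_in_Hom[OF e(3) S_Hom[OF d(2)]] .
  then show ?thesis using that dconfI[OF uv(1,2) _ uv(3)] uv(4-7) by blast
qed

lemma zero_object_Hom:
  assumes "zero_object T Z" "f \<in> Hom T Z A" "g \<in> Hom T Z A"
  shows "f = g"
  using assms Hom_Obj[OF assms(2)] unfolding zero_object_def by blast

lemma zero_object_S:
  assumes "zero_object T Z"
  shows "zero_object T (sobj T Z)"
proof -
  have Z: "Z \<in> Obj T" using assms by (simp add: zero_object_def)
  note s = S_Obj[OF Z]
  have "Idn T Z = Zero T Z Z" using zero_object_Hom[OF assms Idn_in_Hom Zero_in_Hom] Z by blast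
  then have i: "Idn T (sobj T Z) = Zero T (sobj T Z) (sobj T Z)" using S_Idn[OF Z] S_Zero[OF Z Z] by simp
  have 1: "f = Zero T (sobj T Z) A" if f: "f \<in> Hom T (sobj T Z) A" for f A
    using Idn_right[OF f] i Cmp_Zero(2)[OF f s] by simp
  have 2: "f = Zero T A (sobj T Z)" if f: "f \<in> Hom T A (sobj T Z)" for f A
    using Idn_left[OF f] i Cmp_Zero(1)[OF f s] by simp
  show ?thesis
    unfolding zero_object_def using s 1 2 Zero_in_Hom by blast
qed

text \<open>The pair of the identity of \<open>A\<close> and \<open>f\<close> completes to a
  morphism from A = A \<rightarrow> 0, so g f factors through a zero object.\<close>

lemma dist_zero:
  assumes d: "dconf A B D f g h"
  shows "g \<cdot> f = Zero T A D"
proof -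
  note dd = dconfD[OF d]
  obtain Z where Z: "zero_object T Z" using ex_zero_object by blast
  then have Zo: "Z \<in> Obj T" by (simp add: zero_object_def)
  have 1: "dconf A A Z (Idn T A) (Zero T A Z) (Zero T Z (sobj T A))"
    using Dist_Idn[OF dd(5) Z] Idn_in_Hom Zero_in_Hom S_Obj Zo dd(5) by (simp add: dconf_def)
  obtain c where c: "c \<in> Hom T Z D" "c \<cdot> Zero T A Z = g \<cdot> f"
    by (rule dconf_complete[OF 1 d Idn_in_Hom[OF dd(5)] dd(1)]) (auto simp: Idn_right[OF dd(1)])
  then show ?thesis using Cmp_Zero(2)[OF c(1) dd(5)] by simp
qed

text \<open>Completion against Z \<rightarrow> E = E \<rightarrow> Z[1] with Z zero. That triangle
  is the identity triangle of \<open>E\<close> with zero object Z[1], rotated back, which is where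
  \<open>zero_object_S\<close> enters.\<close>

lemma dist_cokernel:
  assumes d: "dconf A B D f g h" and t: "t \<in> Hom T B E" "t \<cdot> f = Zero T A E"
  obtains s where "s \<in> Hom T D E" "s \<cdot> g = t"
proof -
  note dd = dconfD[OF d]
  note E = Hom_Obj(2)[OF t(1)]
  obtain Z where Z: "zero_object T Z" using ex_zero_object by blast
  then have Zo: "Z \<in> Obj T" by (simp add: zero_object_def)
  note sZ = zero_object_S[OF Z]
  have "Neg T (sarr T (Zero T Z E)) = Zero T (sobj T Z) (sobj T E)"
    using S_Zero[OF Zo E] Neg_Zero S_Obj Zo E by simp
  then have "dconf E E (sobj T Z) (Idn T E) (Zero T E (sobj T Z)) (Neg T (sarr T (Zero T Z E)))"
    using Dist_Idn[OF E sZ] Idn_in_Hom Zero_in_Hom S_Obj Zo E by (simp add: dconf_def)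
  then have 1: "dconf Z E E (Zero T Z E) (Idn T E) (Zero T E (sobj T Z))"
    by (rule dconf_rotate_back[OF Zero_in_Hom[OF Zo E]])
  note z = Zero_in_Hom[OF dd(5) Zo]
  have "t \<cdot> f = Zero T Z E \<cdot> Zero T A Z" using t(2) Cmp_Zero(1)[OF z E] by simp
  from dconf_complete[OF d 1 z t(1) this]
  obtain c where "c \<in> Hom T D E" "c \<cdot> g = Idn T E \<cdot> t" by blast
  then show ?thesis using that Idn_left[OF t(1)] by simp
qed

text \<open>The completion axiom only supplies third maps. Both triangles are therefore rotated, the
  lift appears as a map E[1] \<rightarrow> A[1], and fullness and faithfulness of the shift bring it
  back.\<close>

lemma dist_kernel:
  assumes d: "dconf A B D f g h" and t: "t \<in> Hom T E B" "g \<cdot> t = Zero T E D"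
  obtains s where "s \<in> Hom T E A" "f \<cdot> s = t"
proof -
  note dd = dconfD[OF d]
  note E = Hom_Obj(1)[OF t(1)]
  obtain Z where Z: "zero_object T Z" using ex_zero_object by blast
  then have Zo: "Z \<in> Obj T" by (simp add: zero_object_def)
  note i = Idn_in_Hom[OF E] and si = Idn_in_Hom[OF S_Obj[OF E]]
  have "dconf E E Z (Idn T E) (Zero T E Z) (Zero T Z (sobj T E))"
    using Dist_Idn[OF E Z] Idn_in_Hom Zero_in_Hom S_Obj Zo E by (simp add: dconf_def)
  then have 1: "dconf E Z (sobj T E) (Zero T E Z) (Zero T Z (sobj T E)) (Neg T (sarr T (Idn T E)))"
    by (rule dconf_rotate)
  note z = Zero_in_Hom[OF Zo dd(7)]
  have sq: "Zero T Z D \<cdot> Zero T E Z = g \<cdot> t" using t(2) Cmp_Zero(2)[OF z E] by simp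
  note sf = S_Hom[OF dd(1)] and st = S_Hom[OF t(1)]
  from dconf_complete[OF 1 dconf_rotate[OF d] t(1) z sq]
  obtain c where c: "c \<in> Hom T (sobj T E) (sobj T A)"
    "sarr T t \<cdot> Neg T (sarr T (Idn T E)) = Neg T (sarr T f) \<cdot> c" by blast
  then have "Neg T (sarr T t) = Neg T (sarr T f \<cdot> c)"
    using Cmp_Neg(2)[OF si st] Cmp_Neg(1)[OF c(1) sf] S_Idn[OF E] Idn_right[OF st] by simp
  then have "sarr T t = sarr T f \<cdot> c"
    using Neg_Neg[OF st] Neg_Neg[OF Cmp_in_Hom[OF c(1) sf]] by metis
  moreover obtain s where s: "s \<in> Hom T E A" "sarr T s = c" by (rule S_full[OF c(1) E dd(5)])
  ultimately have "sarr T (f \<cdot> s) = sarr T t" using S_Cmp[OF s(1) dd(1)] by simp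
  then have "f \<cdot> s = t" using S_faithful[OF Cmp_in_Hom[OF s(1) dd(1)] t(1)] by blast
  then show ?thesis using that s(1) by blast
qed

lemma Neg_zeroD:
  assumes "f \<in> Hom T A B" "Neg T f = Zero T A B"
  shows "f = Zero T A B"
  using Neg_Neg[OF assms(1)] assms(2) Neg_Zero[OF Hom_Obj[OF assms(1)]] by simp

lemma Neg_Cmp_zero:
  assumes "f \<in> Hom T A B" "g \<in> Hom T B D" "g \<cdot> f = Zero T A D"
  shows "Neg T g \<cdot> f = Zero T A D" "g \<cdot> Neg T f = Zero T A D"
  using Cmp_Neg[OF assms(1,2)] assms(3) Neg_Zero[OF Hom_Obj(1)[OF assms(1)] Hom_Obj(2)[OF assms(2)]] by simp_all

section \<open>Exactness for shifted maps, with the rotation signs absorbed\<close>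

context
  fixes A B D f g h
  assumes d: "dconf A B D f g h"
begin

lemma dconf_Homs: "f \<in> Hom T A B" "g \<in> Hom T B D" "h \<in> Hom T D (sobj T A)"
    "sarr T f \<in> Hom T (sobj T A) (sobj T B)" "sarr T g \<in> Hom T (sobj T B) (sobj T D)"
    "sarr T h \<in> Hom T (sobj T D) (sobj T (sobj T A))"
  using dconfD[OF d] S_Hom by blast+

lemma dconf_rotate1: "dconf B D (sobj T A) g h (Neg T (sarr T f))"
  by (rule dconf_rotate[OF d])

lemma dconf_rotate2: "dconf D (sobj T A) (sobj T B) h (Neg T (sarr T f)) (Neg T (sarr T g))"
  by (rule dconf_rotate[OF dconf_rotate1])

lemma dconf_rotate3:
  "dconf (sobj T A) (sobj T B) (sobj T D) (Neg T (sarr T f)) (Neg T (sarr T g)) (Neg T (sarr T h))"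
  by (rule dconf_rotate[OF dconf_rotate2])

lemma dist_pull_zero: "h \<cdot> g = Zero T B (sobj T A)"
  by (rule dist_zero[OF dconf_rotate1])

lemma dist_push_zero: "sarr T f \<cdot> h = Zero T D (sobj T B)"
  using Neg_zeroD[OF Cmp_in_Hom[OF dconf_Homs(3,4)]] dist_zero[OF dconf_rotate2] Cmp_Neg(1)[OF dconf_Homs(3,4)] by simp

lemma dist_lift2:
  assumes "t \<in> Hom T E D" "h \<cdot> t = Zero T E (sobj T A)"
  obtains s where "s \<in> Hom T E B" "g \<cdot> s = t"
  using dist_kernel[OF dconf_rotate1 assms] by blast

lemma dist_lift3:
  assumes "t \<in> Hom T E (sobj T A)" "sarr T f \<cdot> t = Zero T E (sobj T B)"
  obtains s where "s \<in> Hom T E D" "h \<cdot> s = t"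
  using dist_kernel[OF dconf_rotate2 assms(1) Neg_Cmp_zero(1)[OF assms(1) dconf_Homs(4) assms(2)]] by blast

lemma dist_lift4:
  assumes t: "t \<in> Hom T E (sobj T B)" "sarr T g \<cdot> t = Zero T E (sobj T D)"
  obtains s where "s \<in> Hom T E (sobj T A)" "sarr T f \<cdot> s = t"
proof -
  obtain s where s: "s \<in> Hom T E (sobj T A)" "Neg T (sarr T f) \<cdot> s = t"
    by (rule dist_kernel[OF dconf_rotate3 t(1) Neg_Cmp_zero(1)[OF t(1) dconf_Homs(5) t(2)]])
  have "sarr T f \<cdot> Neg T s = t" using s(2) Cmp_Neg[OF s(1) dconf_Homs(4)] by simp
  then show ?thesis using that Neg_in_Hom[OF s(1)] by blast
qed

lemma dist_lift5:
  assumes t: "t \<in> Hom T E (sobj T D)" "sarr T h \<cdot> t = Zero T E (sobj T (sobj T A))"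
  obtains s where "s \<in> Hom T E (sobj T B)" "sarr T g \<cdot> s = t"
proof -
  obtain s where s: "s \<in> Hom T E (sobj T B)" "Neg T (sarr T g) \<cdot> s = t"
    by (rule dist_kernel[OF dconf_rotate[OF dconf_rotate3] t(1) Neg_Cmp_zero(1)[OF t(1) dconf_Homs(6) t(2)]])
  have "sarr T g \<cdot> Neg T s = t" using s(2) Cmp_Neg[OF s(1) dconf_Homs(5)] by simp
  then show ?thesis using that Neg_in_Hom[OF s(1)] by blast
qed

lemma dist_extend3:
  assumes t: "t \<in> Hom T (sobj T A) E" "t \<cdot> h = Zero T D E"
  obtains s where "s \<in> Hom T (sobj T B) E" "s \<cdot> sarr T f = t"
proof -
  obtain s where s: "s \<in> Hom T (sobj T B) E" "s \<cdot> Neg T (sarr T f) = t"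
    by (rule dist_cokernel[OF dconf_rotate2 t])
  have "Neg T s \<cdot> sarr T f = t" using s(2) Cmp_Neg[OF dconf_Homs(4) s(1)] by simp
  then show ?thesis using that Neg_in_Hom[OF s(1)] by blast
qed

lemma dist_extend2:
  assumes "t \<in> Hom T D E" "t \<cdot> g = Zero T B E"
  obtains s where "s \<in> Hom T (sobj T A) E" "s \<cdot> h = t"
  by (rule dist_cokernel[OF dconf_rotate1 assms])

end

text \<open>Three rotations backwards need signs on all three shifted maps, while the hypothesis has
  one on the last only. The isomorphism (1, -1, 1) of triangles adds the other two.\<close>

lemma dconf_unshift:
  assumes f: "f \<in> Hom T A B" and g: "g \<in> Hom T B D" and h: "h \<in> Hom T D (sobj T A)"
    and d: "dconf (sobj T A) (sobj T B) (sobj T D) (sarr T f) (sarr T g) (Neg T (sarr T h))"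
  shows "dconf A B D f g h"
proof (rule dconf_rotate_back[OF f], rule dconf_rotate_back[OF g], rule dconf_rotate_back[OF h])
  note sf = S_Hom[OF f] and sg = S_Hom[OF g] and sh = S_Hom[OF h]
  have o: "sobj T A \<in> Obj T" "sobj T B \<in> Obj T" "sobj T D \<in> Obj T" "sobj T (sobj T A) \<in> Obj T"
    using Hom_Obj sf sg sh by blast+
  note i = Idn_in_Hom[OF o(2)]
  have iso: "is_iso T (Neg T (Idn T (sobj T B)))"
    by (rule iso_I[OF Neg_in_Hom[OF i] Neg_in_Hom[OF i]])
      (simp_all add: Cmp_Neg[OF i Neg_in_Hom[OF i]] Cmp_Neg[OF i i] Cmp_Neg[OF Neg_in_Hom[OF i] i]
        Neg_Neg[OF i] Idn_left[OF i])
  show "dconf (sobj T A) (sobj T B) (sobj T D) (Neg T (sarr T f)) (Neg T (sarr T g)) (Neg T (sarr T h))"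
    by (rule dconf_iso[OF d Neg_in_Hom[OF sf] Neg_in_Hom[OF sg] Neg_in_Hom[OF sh] Idn_in_Hom[OF o(1)]
          Neg_in_Hom[OF i] Idn_in_Hom[OF o(3)] is_iso_Idn[OF o(1)] iso is_iso_Idn[OF o(3)]])
      (simp_all add: Cmp_Neg[OF sf i] Idn_left[OF sf] Idn_right[OF Neg_in_Hom[OF sf]]
        Idn_left[OF sg] Cmp_Neg[OF Neg_in_Hom[OF i] sg] Cmp_Neg[OF i sg] Cmp_Neg[OF i Neg_in_Hom[OF sg]] Neg_Neg[OF sg] Idn_right[OF sg]
        Idn_right[OF Neg_in_Hom[OF sg]]
        S_Idn[OF o(1)] Idn_left[OF Neg_in_Hom[OF sh]] Idn_right[OF Neg_in_Hom[OF sh]])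
qed

text \<open>Up to isomorphism, every object and morphism is a shift; this replaces the inverse shift.\<close>

lemma dconf_from_connecting:
  assumes e: "e \<in> Hom T D (sobj T A)" and A: "A \<in> Obj T"
  obtains B f g where "dconf A B D f g e"
proof -
  have D: "D \<in> Obj T" using Hom_Obj e by blast
  obtain K p q where c: "dconf D (sobj T A) K e p q" by (rule dconf_cone[OF e])
  note cd = dconfD[OF c]
  obtain B \<phi> \<psi> where B: "B \<in> Obj T" "\<phi> \<in> Hom T (sobj T B) K" "\<psi> \<in> Hom T K (sobj T B)"
    "\<psi> \<cdot> \<phi> = Idn T (sobj T B)" "\<phi> \<cdot> \<psi> = Idn T K" by (rule S_surj[OF cd(7)])
  note sp = Cmp_in_Hom[OF cd(2) B(3)] and qp = Cmp_in_Hom[OF B(2) cd(3)]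
  obtain f where f: "f \<in> Hom T A B" "sarr T f = Neg T (\<psi> \<cdot> p)" by (rule S_full[OF Neg_in_Hom[OF sp] A B(1)])
  obtain g where g: "g \<in> Hom T B D" "sarr T g = Neg T (q \<cdot> \<phi>)" by (rule S_full[OF Neg_in_Hom[OF qp] B(1) D])
  have "dconf A B D f g e"
  proof (rule dconf_rotate_back[OF f(1)], rule dconf_rotate_back[OF g(1)])
    have "dconf D (sobj T A) (sobj T B) e (\<psi> \<cdot> p) (q \<cdot> \<phi>)"
      by (rule dconf_iso_end[OF c B(3,2,5,4)])
    then show "dconf D (sobj T A) (sobj T B) e (Neg T (sarr T f)) (Neg T (sarr T g))"
      using f(2) g(2) Neg_Neg[OF sp] Neg_Neg[OF qp] by simp
  qed
  then show ?thesis using that by blast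
qed

lemma dconf_fibre:
  assumes g: "g \<in> Hom T B D"
  obtains A f e where "dconf A B D f g e"
proof -
  obtain K p q where c: "dconf B D K g p q" by (rule dconf_cone[OF g])
  note cd = dconfD[OF c]
  obtain A \<phi> \<psi> where A: "A \<in> Obj T" "\<phi> \<in> Hom T (sobj T A) K" "\<psi> \<in> Hom T K (sobj T A)"
    "\<psi> \<cdot> \<phi> = Idn T (sobj T A)" "\<phi> \<cdot> \<psi> = Idn T K" by (rule S_surj[OF cd(7)])
  note sp = Cmp_in_Hom[OF cd(2) A(3)] and qp = Cmp_in_Hom[OF A(2) cd(3)]
  obtain f where f: "f \<in> Hom T A B" "sarr T f = Neg T (q \<cdot> \<phi>)" by (rule S_full[OF Neg_in_Hom[OF qp] A(1) cd(5)])
  have "dconf A B D f g (\<psi> \<cdot> p)"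
  proof (rule dconf_rotate_back[OF f(1)])
    have "dconf B D (sobj T A) g (\<psi> \<cdot> p) (q \<cdot> \<phi>)"
      by (rule dconf_iso_end[OF c A(3,2,5,4)])
    then show "dconf B D (sobj T A) g (\<psi> \<cdot> p) (Neg T (sarr T f))"
      using f(2) Neg_Neg[OF qp] by simp
  qed
  then show ?thesis using that by blast
qed

lemma dconf_rotate_left:
  assumes c: "dconf A B D f g e"
  obtains F k \<phi> \<psi> where "\<phi> \<in> Hom T (sobj T F) D" "\<psi> \<in> Hom T D (sobj T F)"
    "\<psi> \<cdot> \<phi> = Idn T (sobj T F)" "\<phi> \<cdot> \<psi> = Idn T D" "dconf F A B k f (\<psi> \<cdot> g)"
    "Neg T (sarr T k) = e \<cdot> \<phi>"
proof -
  note cd = dconfD[OF c]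
  obtain F \<phi> \<psi> where F: "F \<in> Obj T" "\<phi> \<in> Hom T (sobj T F) D" "\<psi> \<in> Hom T D (sobj T F)"
    "\<psi> \<cdot> \<phi> = Idn T (sobj T F)" "\<phi> \<cdot> \<psi> = Idn T D" by (rule S_surj[OF cd(7)])
  note pg = Cmp_in_Hom[OF cd(2) F(3)] and ep = Cmp_in_Hom[OF F(2) cd(3)]
  obtain k where k: "k \<in> Hom T F A" "sarr T k = Neg T (e \<cdot> \<phi>)" by (rule S_full[OF Neg_in_Hom[OF ep] F(1) cd(5)])
  have nk: "Neg T (sarr T k) = e \<cdot> \<phi>" using k(2) Neg_Neg[OF ep] by simp
  have "dconf F A B k f (\<psi> \<cdot> g)"
  proof (rule dconf_rotate_back[OF k(1)], unfold nk)
    show "dconf A B (sobj T F) f (\<psi> \<cdot> g) (e \<cdot> \<phi>)"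
      by (rule dconf_iso_end[OF c F(3,2,5,4)])
  qed
  then show ?thesis using that F(2-5) nk by blast
qed

text \<open>The octahedron is applied to B' \<rightarrow> B \<rightarrow> A in once rotated
  triangles, whose cones are E[1], D[1] and M[1]. Fullness gives maps between E, M and D themselves,
  and \<open>dconf_unshift\<close> repairs the sign.\<close>

lemma dconf_composite_fibre:
  assumes c1: "dconf D B A f' f e" and c2: "dconf E B' B g' g x"
  shows "\<exists>M h y u v. dconf M B' A h (f \<cdot> g) y \<and> dconf E M D v u (x \<cdot> f') \<and> f' \<cdot> u = g \<cdot> h \<and> sarr T u \<cdot> y = e"
proof -
  note d = dconfD[OF c1] and k = dconfD[OF c2]
  obtain M h y where c3: "dconf M B' A h (f \<cdot> g) y" by (rule dconf_fibre[OF Cmp_in_Hom[OF k(2) d(2)]])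
  note m = dconfD[OF c3]
  note sf' = S_Hom[OF d(1)] and sg' = S_Hom[OF k(1)] and sh = S_Hom[OF m(1)] and sx = S_Hom[OF k(3)] and sg = S_Hom[OF k(2)]
  obtain u' v' where uv: "dconf (sobj T E) (sobj T M) (sobj T D) u' v' (sarr T x \<cdot> Neg T (sarr T f'))"
    "u' \<cdot> x = y \<cdot> f" "Neg T (sarr T h) \<cdot> u' = Neg T (sarr T g')" "v' \<cdot> y = e"
    "Neg T (sarr T f') \<cdot> v' = sarr T g \<cdot> Neg T (sarr T h)"
    by (rule dconf_octahedral[OF dconf_rotate[OF c2] dconf_rotate[OF c1] dconf_rotate[OF c3]])
  note uvd = dconfD[OF uv(1)]
  obtain v where v: "v \<in> Hom T E M" "sarr T v = u'" by (rule S_full[OF uvd(1) k(5) m(5)])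
  obtain u where u: "u \<in> Hom T M D" "sarr T u = v'" by (rule S_full[OF uvd(2) m(5) d(5)])
  have xf: "x \<cdot> f' \<in> Hom T D (sobj T E)" using Cmp_in_Hom[OF d(1) k(3)] .
  have 1: "dconf E M D v u (x \<cdot> f')"
    by (rule dconf_unshift[OF v(1) u(1) xf]) (use uv(1) v(2) u(2) S_Cmp[OF d(1) k(3)] Cmp_Neg(2)[OF sf' sx] in simp)
  have "Neg T (sarr T f' \<cdot> v') = Neg T (sarr T g \<cdot> sarr T h)"
    using uv(5) Cmp_Neg(1)[OF uvd(2) sf'] Cmp_Neg(2)[OF sh sg] by simp
  then have "sarr T f' \<cdot> v' = sarr T g \<cdot> sarr T h"
    using Neg_Neg[OF Cmp_in_Hom[OF uvd(2) sf']] Neg_Neg[OF Cmp_in_Hom[OF sh sg]] by metis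
  then have "sarr T (f' \<cdot> u) = sarr T (g \<cdot> h)"
    using S_Cmp[OF u(1) d(1)] S_Cmp[OF m(1) k(2)] u(2) by simp
  then have 2: "f' \<cdot> u = g \<cdot> h"
    using S_faithful[OF Cmp_in_Hom[OF u(1) d(1)] Cmp_in_Hom[OF m(1) k(2)]] by blast
  show ?thesis using c3 1 2 uv(4) u(2) by blast
qed

text \<open>With F[1] isomorphic to \<open>D\<close>, the object \<open>B\<close> is the cone of F
  \<rightarrow> A. The octahedron for F \<rightarrow> A \<rightarrow> B' gives B \<rightarrow> M
  \<rightarrow> E, and rotating F \<rightarrow> B' \<rightarrow> M gives B' \<rightarrow> M
  \<rightarrow> D.\<close>

lemma dconf_pushout:
  assumes c1: "dconf A B D f f' e" and c2: "dconf A B' E g g' x"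
  shows "\<exists>M m m' n n'. dconf B M E m m' (sarr T f \<cdot> x) \<and> dconf B' M D n n' (sarr T g \<cdot> e) \<and> m \<cdot> f = n \<cdot> g \<and> n' \<cdot> m = f'"
proof -
  note d = dconfD[OF c1] and k = dconfD[OF c2]
  obtain F l \<phi> \<psi> where F: "\<phi> \<in> Hom T (sobj T F) D" "\<psi> \<in> Hom T D (sobj T F)"
    "\<psi> \<cdot> \<phi> = Idn T (sobj T F)" "\<phi> \<cdot> \<psi> = Idn T D" "dconf F A B l f (\<psi> \<cdot> f')"
    "Neg T (sarr T l) = e \<cdot> \<phi>" by (rule dconf_rotate_left[OF c1])
  note fd = dconfD[OF F(5)]
  obtain M n y where c3: "dconf F B' M (g \<cdot> l) n y" by (rule dconf_cone[OF Cmp_in_Hom[OF fd(1) k(1)]])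
  note md = dconfD[OF c3]
  obtain m m' where m: "dconf B M E m m' (sarr T f \<cdot> x)" "m \<cdot> f = n \<cdot> g" "y \<cdot> m = \<psi> \<cdot> f'"
    by (rule dconf_octahedral[OF F(5) c2 c3])
  note mm = dconfD[OF m(1)]
  note sg = S_Hom[OF k(1)] and sl = S_Hom[OF fd(1)]
  note py = Cmp_in_Hom[OF md(3) F(1)] and ge = Cmp_in_Hom[OF d(3) sg]
  have "Neg T (sarr T (g \<cdot> l)) \<cdot> \<psi> = sarr T g \<cdot> e"
    using S_Cmp[OF fd(1) k(1)] Cmp_Neg(2)[OF sl sg] F(6) Cmp_assoc[OF F(1) d(3) sg]
      Cmp_assoc[OF F(2,1) ge] F(4) Idn_right[OF ge] by simp
  then have "dconf B' M D n (\<phi> \<cdot> y) (sarr T g \<cdot> e)"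
    using dconf_iso_end[OF dconf_rotate[OF c3] F(1-4)] by simp
  moreover have "(\<phi> \<cdot> y) \<cdot> m = f'"
    using Cmp_assoc[OF mm(1) md(3) F(1)] m(3) Cmp_assoc[OF d(2) F(2,1)] F(4) Idn_left[OF d(2)] by simp
  ultimately show ?thesis using m(1,2) by blast
qed

text \<open>\<open>M\<close> realizes the class x f. The octahedron for B \<rightarrow> A
  \<rightarrow> E[1], with cones D[1], B'[1] and M[1], yields the second triangle in shifted form,
  which is then descended.\<close>

lemma dconf_pullback:
  assumes c1: "dconf D B A f' f e" and c2: "dconf E B' A g' g x"
  shows "\<exists>M m m' n n'. dconf E M B m' m (x \<cdot> f) \<and> dconf D M B' n' n (e \<cdot> g) \<and> f \<cdot> m = g \<cdot> n \<and> m \<cdot> n' = f'"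
proof -
  note d = dconfD[OF c1] and k = dconfD[OF c2]
  note xf = Cmp_in_Hom[OF d(2) k(3)] and eg = Cmp_in_Hom[OF k(2) d(3)]
  obtain M m' m where c3: "dconf E M B m' m (x \<cdot> f)" by (rule dconf_from_connecting[OF xf k(5)])
  note md = dconfD[OF c3]
  note sf = S_Hom[OF d(2)] and sf' = S_Hom[OF d(1)] and sg = S_Hom[OF k(2)] and se = S_Hom[OF d(3)] and sm = S_Hom[OF md(2)]
  obtain u v where uv: "dconf (sobj T D) (sobj T M) (sobj T B') u v (sarr T e \<cdot> Neg T (sarr T g))"
    "u \<cdot> e = Neg T (sarr T m') \<cdot> x" "Neg T (sarr T m) \<cdot> u = Neg T (sarr T f')"
    "v \<cdot> Neg T (sarr T m') = Neg T (sarr T g')" "Neg T (sarr T g) \<cdot> v = sarr T f \<cdot> Neg T (sarr T m)"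
    by (rule dconf_octahedral[OF dconf_rotate[OF c1] dconf_rotate[OF dconf_rotate[OF c2]] dconf_rotate[OF dconf_rotate[OF c3]]])
  note uvd = dconfD[OF uv(1)]
  obtain n' where n': "n' \<in> Hom T D M" "sarr T n' = u" by (rule S_full[OF uvd(1) d(5) md(6)])
  obtain n where n: "n \<in> Hom T M B'" "sarr T n = v" by (rule S_full[OF uvd(2) md(6) k(6)])
  have 1: "dconf D M B' n' n (e \<cdot> g)"
    by (rule dconf_unshift[OF n'(1) n(1) eg]) (use uv(1) n'(2) n(2) S_Cmp[OF k(2) d(3)] Cmp_Neg(2)[OF sg se] in simp)
  have "Neg T (sarr T m \<cdot> u) = Neg T (sarr T f')" using uv(3) Cmp_Neg(1)[OF uvd(1) sm] by simp
  then have "sarr T m \<cdot> u = sarr T f'" using Neg_Neg[OF Cmp_in_Hom[OF uvd(1) sm]] Neg_Neg[OF sf'] by metis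
  then have "sarr T (m \<cdot> n') = sarr T f'" using S_Cmp[OF n'(1) md(2)] n'(2) by simp
  then have 2: "m \<cdot> n' = f'" using S_faithful[OF Cmp_in_Hom[OF n'(1) md(2)] d(1)] by blast
  have "Neg T (sarr T g \<cdot> v) = Neg T (sarr T f \<cdot> sarr T m)"
    using uv(5) Cmp_Neg(1)[OF uvd(2) sg] Cmp_Neg(2)[OF sm sf] by simp
  then have "sarr T g \<cdot> v = sarr T f \<cdot> sarr T m"
    using Neg_Neg[OF Cmp_in_Hom[OF uvd(2) sg]] Neg_Neg[OF Cmp_in_Hom[OF sm sf]] by metis
  then have "sarr T (f \<cdot> m) = sarr T (g \<cdot> n)"
    using S_Cmp[OF md(2) d(2)] S_Cmp[OF n(1) k(2)] n(2) by simp
  then have 3: "f \<cdot> m = g \<cdot> n"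
    using S_faithful[OF Cmp_in_Hom[OF md(2) d(2)] Cmp_in_Hom[OF n(1) k(2)]] by blast
  show ?thesis using c3 1 2 3 by blast
qed

end

context triangulated_category
begin

lemma Hom_diff_zero:
  assumes "s \<in> Hom T A B" "t \<in> Hom T A B" "h \<in> Hom T B D" "h \<cdot> s = h \<cdot> t"
  shows "h \<cdot> Sub s t = Zero T A D"
  using Cmp_Sub_right[OF assms(1-3)] assms(4) Sub_eq_Zero[OF Cmp_in_Hom[OF assms(2,3)] Cmp_in_Hom[OF assms(2,3)]]
  by simp

lemma Hom_diff_zero':
  assumes "s \<in> Hom T B D" "t \<in> Hom T B D" "h \<in> Hom T A B" "s \<cdot> h = t \<cdot> h"
  shows "Sub s t \<cdot> h = Zero T A D"
  using Cmp_Sub_left[OF assms(3,1,2)] assms(4) Sub_eq_Zero[OF Cmp_in_Hom[OF assms(3,2)] Cmp_in_Hom[OF assms(3,2)]]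
  by simp

text \<open>The \<open>Ext\<close> axioms are exactness of Hom on rotated triangles; where a
  conclusion asks for an unshifted map, fullness and faithfulness of the shift supply it.
  \<open>ET4\<close> is the octahedron itself.\<close>

lemma ext_category: "ext_category T (\<lambda>Z A. Hom T Z (sobj T A)) (\<lambda>Z A. Zero T Z (sobj T A))
  (\<lambda>f e. sarr T f \<cdot> e) (\<lambda>e f. e \<cdot> f) dconf"
proof (intro ext_category.intro ext_category_axioms.intro)
  show "additive_category T" by unfold_locales
next
  fix Z A assume "Z \<in> Obj T" "A \<in> Obj T"
  then show "Zero T Z (sobj T A) \<in> Hom T Z (sobj T A)" using Zero_in_Hom S_Obj by blast
next
  fix e f Z A B assume "e \<in> Hom T Z (sobj T A)" "f \<in> Hom T A B"
  then show "sarr T f \<cdot> e \<in> Hom T Z (sobj T B)" using Cmp_in_Hom S_Hom by blast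
next
  fix e f Z A B assume "e \<in> Hom T Z (sobj T A)" "f \<in> Hom T B Z"
  then show "e \<cdot> f \<in> Hom T B (sobj T A)" using Cmp_in_Hom by blast
next
  fix e Z A assume "e \<in> Hom T Z (sobj T A)" "A \<in> Obj T"
  then show "sarr T (Idn T A) \<cdot> e = e" "e \<cdot> Idn T Z = e" using S_Idn Idn_left Idn_right by simp_all
next
  fix e f g Z A B D
  assume h: "e \<in> Hom T Z (sobj T A)" "f \<in> Hom T A B" "g \<in> Hom T B D"
  then show "sarr T g \<cdot> (sarr T f \<cdot> e) = sarr T (g \<cdot> f) \<cdot> e"
    using Cmp_assoc[OF h(1) S_Hom[OF h(2)] S_Hom[OF h(3)]] S_Cmp[OF h(2,3)] by simp
next
  fix e f g Z A B D
  assume h: "e \<in> Hom T Z (sobj T A)" "f \<in> Hom T B Z" "g \<in> Hom T D B"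
  then show "e \<cdot> f \<cdot> g = e \<cdot> (f \<cdot> g)" using Cmp_assoc[OF h(3,2,1)] by simp
next
  fix e f g Z A B D
  assume h: "e \<in> Hom T Z (sobj T A)" "f \<in> Hom T A B" "g \<in> Hom T D Z"
  then show "sarr T f \<cdot> e \<cdot> g = sarr T f \<cdot> (e \<cdot> g)" using Cmp_assoc[OF h(3,1) S_Hom[OF h(2)]] by simp
next
  fix f A B Z assume "f \<in> Hom T A B" "Z \<in> Obj T"
  then show "sarr T f \<cdot> Zero T Z (sobj T A) = Zero T Z (sobj T B)" using Cmp_Zero(2)[OF S_Hom] by blast
next
  fix f B Z A assume "f \<in> Hom T B Z" "A \<in> Obj T"
  then show "Zero T Z (sobj T A) \<cdot> f = Zero T B (sobj T A)" using Cmp_Zero(1) S_Obj by blast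
next
  fix A B Z f g e assume "dconf A B Z f g e"
  then show "f \<in> Hom T A B \<and> g \<in> Hom T B Z \<and> e \<in> Hom T Z (sobj T A)" using dconfD by blast
next
  fix e Z A assume "e \<in> Hom T Z (sobj T A)" "A \<in> Obj T"
  then show "\<exists>B f g. dconf A B Z f g e" using dconf_from_connecting by metis
next
  fix f A B assume "f \<in> Hom T A B"
  then show "\<exists>Z g e. dconf A B Z f g e" using dconf_cone by metis
next
  fix g B Z assume "g \<in> Hom T B Z"
  then show "\<exists>A f e. dconf A B Z f g e" using dconf_fibre by metis
next
  fix A B Z f g e assume d: "dconf A B Z f g e"
  show "g \<cdot> f = Zero T A Z" by (rule dist_zero[OF d])
  show "sarr T f \<cdot> e = Zero T Z (sobj T B)" by (rule dist_push_zero[OF d])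
  show "e \<cdot> g = Zero T B (sobj T A)" by (rule dist_pull_zero[OF d])
next
  fix A B Z f g e t D assume d: "dconf A B Z f g e" and t: "t \<in> Hom T B D" "t \<cdot> f = Zero T A D"
  show "\<exists>s\<in>Hom T Z D. s \<cdot> g = t" using dist_cokernel[OF d t] by metis
next
  fix A B Z f g e t D assume d: "dconf A B Z f g e" and t: "t \<in> Hom T D B" "g \<cdot> t = Zero T D Z"
  show "\<exists>s\<in>Hom T D A. f \<cdot> s = t" using dist_kernel[OF d t] by metis
next
  fix A B Z f g e s t D
  assume d: "dconf A B Z f g e" and h: "s \<in> Hom T A D" "t \<in> Hom T A D" and e: "sarr T s \<cdot> e = sarr T t \<cdot> e"
  note dd = dconfD[OF d] and D = Hom_Obj(2)[OF h(1)]
  note st = Sub_in_Hom[OF h]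
  have "sarr T (Sub s t) \<cdot> e = Zero T Z (sobj T D)"
    unfolding S_Sub[OF h] by (rule Hom_diff_zero'[OF S_Hom[OF h(1)] S_Hom[OF h(2)] dd(3) e])
  from dist_extend3[OF d S_Hom[OF st] this]
  obtain r' where r': "r' \<in> Hom T (sobj T B) (sobj T D)" "r' \<cdot> sarr T f = sarr T (Sub s t)" by blast
  obtain r where r: "r \<in> Hom T B D" "sarr T r = r'" by (rule S_full[OF r'(1) dd(6) D])
  have "sarr T (r \<cdot> f) = sarr T (Sub s t)" using S_Cmp[OF dd(1) r(1)] r(2) r'(2) by simp
  then have "r \<cdot> f = Sub s t" by (rule S_faithful[OF Cmp_in_Hom[OF dd(1) r(1)] st])
  then have "s = Add T t (r \<cdot> f)" using Add_Sub(1)[OF h] by simp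
  then show "\<exists>r\<in>Hom T B D. s = Add T t (r \<cdot> f)" using r(1) by blast
next
  fix A B Z f g e s t D
  assume d: "dconf A B Z f g e" and h: "s \<in> Hom T D Z" "t \<in> Hom T D Z" and e: "e \<cdot> s = e \<cdot> t"
  from dist_lift2[OF d Sub_in_Hom[OF h] Hom_diff_zero[OF h dconfD(3)[OF d] e]]
  obtain r where r: "r \<in> Hom T D B" "g \<cdot> r = Sub s t" by blast
  then have "s = Add T t (g \<cdot> r)" using Add_Sub(1)[OF h] by simp
  then show "\<exists>r\<in>Hom T D B. s = Add T t (g \<cdot> r)" using r(1) by blast
next
  fix A B Z f g e x D
  assume d: "dconf A B Z f g e" and x: "x \<in> Hom T Z (sobj T D)" "D \<in> Obj T" "x \<cdot> g = Zero T B (sobj T D)"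
  from dist_extend2[OF d x(1,3)]
  obtain s where s: "s \<in> Hom T (sobj T A) (sobj T D)" "s \<cdot> e = x" by blast
  obtain t where "t \<in> Hom T A D" "sarr T t = s" by (rule S_full[OF s(1) dconfD(5)[OF d] x(2)])
  then show "\<exists>t\<in>Hom T A D. sarr T t \<cdot> e = x" using s(2) by blast
next
  fix A B Z f g e x D
  assume d: "dconf A B Z f g e" and x: "x \<in> Hom T D (sobj T A)" "sarr T f \<cdot> x = Zero T D (sobj T B)"
  show "\<exists>t\<in>Hom T D Z. e \<cdot> t = x" using dist_lift3[OF d x] by metis
next
  fix A B Z f g e x y D
  assume d: "dconf A B Z f g e" and h: "x \<in> Hom T B (sobj T D)" "y \<in> Hom T B (sobj T D)"
    and e: "x \<cdot> f = y \<cdot> f" and z: "\<forall>z\<in>Hom T Z (sobj T D). z = Zero T Z (sobj T D)"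
  from dist_cokernel[OF d Sub_in_Hom[OF h] Hom_diff_zero'[OF h dconfD(1)[OF d] e]]
  obtain s where s: "s \<in> Hom T Z (sobj T D)" "s \<cdot> g = Sub x y" by blast
  then have "Sub x y = Zero T B (sobj T D)"
    using z Cmp_Zero(1)[OF dconfD(2)[OF d] Hom_Obj(2)[OF s(1)]] by metis
  then show "x = y" using Sub_eq_Zero[OF h] by simp
next
  fix A B Z f g e x y D
  assume d: "dconf A B Z f g e" and h: "x \<in> Hom T D (sobj T B)" "y \<in> Hom T D (sobj T B)"
    and e: "sarr T g \<cdot> x = sarr T g \<cdot> y" and z: "\<forall>z\<in>Hom T D (sobj T A). z = Zero T D (sobj T A)"
  from dist_lift4[OF d Sub_in_Hom[OF h] Hom_diff_zero[OF h S_Hom[OF dconfD(2)[OF d]] e]]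
  obtain s where s: "s \<in> Hom T D (sobj T A)" "sarr T f \<cdot> s = Sub x y" by blast
  then have "Sub x y = Zero T D (sobj T B)"
    using z Cmp_Zero(2)[OF S_Hom[OF dconfD(1)[OF d]] Hom_Obj(1)[OF s(1)]] by metis
  then show "x = y" using Sub_eq_Zero[OF h] by simp
next
  fix A B Z f g c e P x D
  assume d: "dconf A B Z f g (sarr T c \<cdot> e)" and c: "c \<in> Hom T P A" and e: "e \<in> Hom T Z (sobj T P)"
    and x: "x \<in> Hom T A (sobj T D)" and D: "D \<in> Obj T" and z: "x \<cdot> c = Zero T P (sobj T D)"
  note sx = S_Hom[OF x]
  have "sarr T x \<cdot> (sarr T c \<cdot> e) = Zero T Z (sobj T (sobj T D))"
    using Cmp_assoc[OF e S_Hom[OF c] sx] S_Cmp[OF c x] z S_Zero[OF Hom_Obj(1)[OF c] S_Obj[OF D]]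
      Cmp_Zero(1)[OF e S_Obj[OF S_Obj[OF D]]] by simp
  from dist_extend3[OF d sx this]
  obtain s where s: "s \<in> Hom T (sobj T B) (sobj T (sobj T D))" "s \<cdot> sarr T f = sarr T x" by blast
  obtain y where y: "y \<in> Hom T B (sobj T D)" "sarr T y = s" by (rule S_full[OF s(1) dconfD(6)[OF d] S_Obj[OF D]])
  have "sarr T (y \<cdot> f) = sarr T x" using S_Cmp[OF dconfD(1)[OF d] y(1)] y(2) s(2) by simp
  then have "y \<cdot> f = x" by (rule S_faithful[OF Cmp_in_Hom[OF dconfD(1)[OF d] y(1)] x])
  then show "\<exists>y\<in>Hom T B (sobj T D). y \<cdot> f = x" using y(1) by blast
next
  fix A B Z f g e c P x D
  assume d: "dconf A B Z f g (e \<cdot> c)" and c: "c \<in> Hom T Z P" and e: "e \<in> Hom T P (sobj T A)"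
    and x: "x \<in> Hom T D (sobj T Z)" and D: "D \<in> Obj T" and z: "sarr T c \<cdot> x = Zero T D (sobj T P)"
  have "sarr T (e \<cdot> c) \<cdot> x = Zero T D (sobj T (sobj T A))"
    using S_Cmp[OF c e] Cmp_assoc[OF x S_Hom[OF c] S_Hom[OF e]] z Cmp_Zero(2)[OF S_Hom[OF e] D] by simp
  from dist_lift5[OF d x this]
  show "\<exists>y\<in>Hom T D (sobj T B). sarr T g \<cdot> y = x" by blast
next
  fix A B D f f' e B' E g g' x
  assume c: "dconf A B D f f' e" "dconf B B' E g g' x"
  note cd = dconfD[OF c(1)] and cd' = dconfD[OF c(2)]
  obtain M h y where m: "dconf A B' M (g \<cdot> f) h y" by (rule dconf_cone[OF Cmp_in_Hom[OF cd(1) cd'(1)]])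
  obtain u v where "dconf D M E u v (sarr T f' \<cdot> x)" "u \<cdot> f' = h \<cdot> g" "y \<cdot> u = e"
    by (rule dconf_octahedral[OF c m])
  then show "\<exists>M h y u v. dconf A B' M (g \<cdot> f) h y \<and> dconf D M E u v (sarr T f' \<cdot> x) \<and> u \<cdot> f' = h \<cdot> g \<and> y \<cdot> u = e"
    using m by blast
qed (rule dconf_composite_fibre dconf_pushout dconf_pullback; assumption)+

end

text \<open>Thickness speaks of the first summand, whereas the splitting used to show that U is
  determined by Ext-vanishing produces the wanted object as the second.\<close>

lemma biproduct_swap:
  assumes "preadditive_category C" "biproduct C P A B"
  shows "biproduct C P B A"
proof -
  interpret preadditive_category C by fact
  obtain i j p q where b: "P \<in> Obj C" "A \<in> Obj C" "B \<in> Obj C"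
    "i \<in> Hom C A P" "j \<in> Hom C B P" "p \<in> Hom C P A" "q \<in> Hom C P B"
    "p \<cdot>\<^bsub>C\<^esub> i = Idn C A" "q \<cdot>\<^bsub>C\<^esub> j = Idn C B" "q \<cdot>\<^bsub>C\<^esub> i = Zero C A B" "p \<cdot>\<^bsub>C\<^esub> j = Zero C B A"
    "Add C (i \<cdot>\<^bsub>C\<^esub> p) (j \<cdot>\<^bsub>C\<^esub> q) = Idn C P"
    by (rule biproductE[OF assms(2)])
  show ?thesis
    by (rule biproductI[OF b(1,3,2,5,4,7,6,9,8,11,10)])
      (simp add: Add_commute[OF Cmp_in_Hom[OF b(7,5)] Cmp_in_Hom[OF b(6,4)]] b(12))
qed

section \<open>From the torsion pair to the cotorsion pair\<close>

locale torsion = triangulated_category T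
  for T :: "('o, 'm) tricat" (structure) +
  fixes X Y :: "'o set"
  assumes torsion: "torsion_pair T X Y"
begin

abbreviation "U \<equiv> shifted T X"
abbreviation "W \<equiv> core T X Y"
abbreviation "extT \<equiv> (\<lambda>Z A. Hom T Z (sobj T A))"
abbreviation "zerT \<equiv> (\<lambda>Z A. Zero T Z (sobj T A))"
abbreviation "pushT \<equiv> (\<lambda>f e. sarr T f \<cdot> e)"
abbreviation "pullT \<equiv> (\<lambda>e f. e \<cdot> f)"

lemma thick: "additive_thick T X" "additive_thick T Y"
  using torsion by (simp_all add: torsion_pair_def)

lemma X_Obj: "x \<in> X \<Longrightarrow> x \<in> Obj T"
  by (rule subsetD[OF conjunct1[OF thick(1)[unfolded additive_thick_def]]])

lemma Y_Obj: "y \<in> Y \<Longrightarrow> y \<in> Obj T"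
  by (rule subsetD[OF conjunct1[OF thick(2)[unfolded additive_thick_def]]])

lemma XY_zero:
  assumes "x \<in> X" "y \<in> Y" "f \<in> Hom T x y"
  shows "f = Zero T x y"
proof -
  have "\<forall>A\<in>X. \<forall>B\<in>Y. Hom T A B = {Zero T A B}"
    using torsion unfolding torsion_pair_def by (elim conjE)
  from bspec[OF bspec[OF this assms(1)] assms(2)] have "Hom T x y = {Zero T x y}" .
  then show ?thesis using assms(3) by simp
qed

lemma X_summand:
  assumes "biproduct T P A B" "P \<in> X"
  shows "A \<in> X"
proof -
  have "\<forall>P A B. biproduct T P A B \<and> P \<in> X \<longrightarrow> A \<in> X"
    using thick(1) unfolding additive_thick_def by (elim conjE)
  then show ?thesis using conjI[OF assms] by (elim allE impE)
qed

lemma Y_summand: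
  assumes "biproduct T P A B" "P \<in> Y"
  shows "A \<in> Y"
proof -
  have "\<forall>P A B. biproduct T P A B \<and> P \<in> Y \<longrightarrow> A \<in> Y"
    using thick(2) unfolding additive_thick_def by (elim conjE)
  then show ?thesis using conjI[OF assms] by (elim allE impE)
qed

lemma decomposition:
  assumes "A \<in> Obj T"
  obtains x y f g h where "x \<in> X" "y \<in> Y" "dconf x A y f g h"
proof -
  obtain f g h where d: "(f, g, h) \<in> Dist T" "Dom T f \<in> X" "Cod T f = A" "Cod T g \<in> Y"
  proof -
    have "\<forall>C\<in>Obj T. \<exists>(f, g, h)\<in>Dist T. Dom T f \<in> X \<and> Cod T f = C \<and> Cod T g \<in> Y"
      using torsion unfolding torsion_pair_def by (elim conjE)
    from bspec[OF this assms] show ?thesis using that by blast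
  qed
  have "Dom T g = A" using Dist_triangle[OF d(1)] d(3) by (simp add: triangle_def)
  then show ?thesis using that[OF d(2,4)] Dist_dconf[OF d(1)] by simp
qed

lemma shift_in_U: "x \<in> X \<Longrightarrow> sobj T x \<in> U"
  using is_iso_Idn[OF S_Obj[OF X_Obj]] Idn_in_Hom[OF S_Obj[OF X_Obj]] S_Obj[OF X_Obj]
  unfolding shifted_def isomorphic_def by blast

lemma U_E:
  assumes "u \<in> U"
  obtains x \<phi> \<psi> where "x \<in> X" "u \<in> Obj T" "\<phi> \<in> Hom T (sobj T x) u" "\<psi> \<in> Hom T u (sobj T x)"
    "\<phi> \<cdot> \<psi> = Idn T u"
proof -
  obtain x \<phi> where x: "x \<in> X" "u \<in> Obj T" "\<phi> \<in> Hom T (sobj T x) u" "is_iso T \<phi>"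
    using assms unfolding shifted_def isomorphic_def by blast
  show ?thesis using iso_D[OF x(4,3)] that x by metis
qed

lemma cotorsion: "cotorsion T extT zerT pushT pullT dconf U Y W"
proof (intro cotorsion.intro ext_category cotorsion_axioms.intro)
  interpret ext_category T extT zerT pushT pullT dconf by (rule ext_category)
  show "W = U \<inter> Y" by (simp add: core_def)
  show "A \<in> Obj T" if "A \<in> U" for A using that by (simp add: shifted_def)
  show "A \<in> Obj T" if "A \<in> Y" for A using that Y_Obj by blast
  show "e = Zero T u (sobj T v)" if u: "u \<in> U" and v: "v \<in> Y" and e: "e \<in> Hom T u (sobj T v)" for u v e
  proof -
    obtain x \<phi> \<psi> where x: "x \<in> X" "\<phi> \<in> Hom T (sobj T x) u" "\<psi> \<in> Hom T u (sobj T x)" "\<phi> \<cdot> \<psi> = Idn T u"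
      by (rule U_E[OF u])
    obtain t where t: "t \<in> Hom T x v" "sarr T t = e \<cdot> \<phi>"
      by (rule S_full[OF Cmp_in_Hom[OF x(2) e] X_Obj[OF x(1)] Y_Obj[OF v]])
    have "e \<cdot> \<phi> = Zero T (sobj T x) (sobj T v)"
      using XY_zero[OF x(1) v t(1)] t(2) S_Zero[OF X_Obj[OF x(1)] Y_Obj[OF v]] by simp
    moreover have "e = e \<cdot> \<phi> \<cdot> \<psi>" using Cmp_assoc[OF x(3,2) e] x(4) Idn_right[OF e] by simp
    ultimately show ?thesis using Cmp_Zero(1)[OF x(3) S_Obj[OF Y_Obj[OF v]]] by simp
  qed
  \<comment> \<open>With A'[1] isomorphic to \<open>A\<close>, the decomposition x \<rightarrow> A'
    \<rightarrow> y rotates twice to y \<rightarrow> x[1] \<rightarrow> A.\<close>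
  show "\<exists>v\<in>Y. \<exists>u\<in>U. \<exists>f g e. dconf v u A f g e" if A: "A \<in> Obj T" for A
  proof -
    obtain A' \<phi> \<psi> where s: "A' \<in> Obj T" "\<phi> \<in> Hom T (sobj T A') A" "\<psi> \<in> Hom T A (sobj T A')"
      "\<psi> \<cdot> \<phi> = Idn T (sobj T A')" "\<phi> \<cdot> \<psi> = Idn T A" by (rule S_surj[OF A])
    obtain x y f g h where d: "x \<in> X" "y \<in> Y" "dconf x A' y f g h" by (rule decomposition[OF s(1)])
    show ?thesis
      using dconf_iso_end[OF dconf_rotate[OF dconf_rotate[OF d(3)]] s(2-5)] d(2) shift_in_U[OF d(1)] by blast
  qed
  show "\<exists>u\<in>U. \<exists>v\<in>Y. \<exists>f g e. dconf A v u f g e" if A: "A \<in> Obj T" for A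
  proof -
    obtain x y f g h where d: "x \<in> X" "y \<in> Y" "dconf x A y f g h" by (rule decomposition[OF A])
    show ?thesis using dconf_rotate[OF d(3)] d(2) shift_in_U[OF d(1)] by blast
  qed
  \<comment> \<open>On an unshifted model A' of \<open>A\<close>, vanishing of Ext(A, y) forces the
    map to \<open>y\<close> to be zero. The identity of A' then factors through \<open>x\<close>,
    and the fibre sequence of x \<rightarrow> A' splits, making A' a summand of
    \<open>x\<close>.\<close>
  show "A \<in> U" if A: "A \<in> Obj T" and z: "\<And>v e. v \<in> Y \<Longrightarrow> e \<in> Hom T A (sobj T v) \<Longrightarrow> e = Zero T A (sobj T v)" for A
  proof -
    obtain A' \<phi> \<psi> where s: "A' \<in> Obj T" "\<phi> \<in> Hom T (sobj T A') A" "\<psi> \<in> Hom T A (sobj T A')"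
      "\<psi> \<cdot> \<phi> = Idn T (sobj T A')" "\<phi> \<cdot> \<psi> = Idn T A" by (rule S_surj[OF A])
    obtain x y f g h where d: "x \<in> X" "y \<in> Y" "dconf x A' y f g h" by (rule decomposition[OF s(1)])
    note dd = dconfD[OF d(3)]
    note sg = S_Hom[OF dd(2)]
    have "sarr T g \<cdot> \<psi> = Zero T A (sobj T y)" using z[OF d(2) Cmp_in_Hom[OF s(3) sg]] .
    then have "sarr T g \<cdot> \<psi> \<cdot> \<phi> = Zero T (sobj T A') (sobj T y)"
      using Cmp_Zero(1)[OF s(2) S_Obj[OF dd(7)]] by simp
    then have "sarr T g = sarr T (Zero T A' y)"
      using Cmp_assoc[OF s(2,3) sg] s(4) Idn_right[OF sg] S_Zero[OF dd(6,7)] by simp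
    then have g0: "g = Zero T A' y" by (rule S_faithful[OF dd(2) Zero_in_Hom[OF dd(6,7)]])
    have i: "Idn T A' \<in> Hom T A' A'" by (rule Idn_in_Hom[OF s(1)])
    have "g \<cdot> Idn T A' = Zero T A' y" using Idn_right[OF dd(2)] g0 by simp
    then obtain r where r: "r \<in> Hom T A' x" "f \<cdot> r = Idn T A'" using dist_kernel[OF d(3) i] by blast
    obtain K k e where K: "dconf K x A' k f e" by (rule dconf_fibre[OF dd(1)])
    note kd = dconfD[OF K]
    have "e = e \<cdot> f \<cdot> r" using Cmp_assoc[OF r(1) dd(1) kd(3)] r(2) Idn_right[OF kd(3)] by simp
    then have "e = Zero T A' (sobj T K)"
      using dist_pull_zero[OF K] Cmp_Zero(1)[OF r(1) S_Obj[OF kd(5)]] by simp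
    then have "biproduct T x K A'" using split_biproduct K by blast
    then have "A' \<in> X" using X_summand[OF biproduct_swap d(1)] preadditive_category_axioms by blast
    then show ?thesis using A s(2) iso_I[OF s(2-5)] unfolding shifted_def isomorphic_def by blast
  qed
  \<comment> \<open>Here f[1] is itself a class in Ext(U, A), so \<open>f\<close> is zero and
    \<open>A\<close> is a summand of \<open>y\<close>.\<close>
  show "A \<in> Y" if A: "A \<in> Obj T" and z: "\<And>u e. u \<in> U \<Longrightarrow> e \<in> Hom T u (sobj T A) \<Longrightarrow> e = Zero T u (sobj T A)" for A
  proof -
    obtain x y f g h where d: "x \<in> X" "y \<in> Y" "dconf x A y f g h" by (rule decomposition[OF A])
    note dd = dconfD[OF d(3)]
    have "sarr T f = sarr T (Zero T x A)"
      using z[OF shift_in_U[OF d(1)] S_Hom[OF dd(1)]] S_Zero[OF dd(5) A] by simp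
    then have f0: "f = Zero T x A" by (rule S_faithful[OF dd(1) Zero_in_Hom[OF dd(5) A]])
    have i: "Idn T A \<in> Hom T A A" by (rule Idn_in_Hom[OF A])
    have "Idn T A \<cdot> f = Zero T x A" using Idn_left[OF dd(1)] f0 by simp
    then obtain r where r: "r \<in> Hom T y A" "r \<cdot> g = Idn T A" using dist_cokernel[OF d(3) i] by blast
    obtain K k e where K: "dconf A y K g k e" by (rule dconf_cone[OF dd(2)])
    note kd = dconfD[OF K]
    have "e = sarr T r \<cdot> (sarr T g \<cdot> e)"
      using Cmp_assoc[OF kd(3) S_Hom[OF dd(2)] S_Hom[OF r(1)]] S_Cmp[OF dd(2) r(1)] r(2) S_Idn[OF A]
        Idn_left[OF kd(3)] by simp
    then have "e = Zero T K (sobj T A)"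
      using dist_push_zero[OF K] Cmp_Zero(2)[OF S_Hom[OF r(1)] kd(7)] by simp
    then have "biproduct T y A K" using split_biproduct K by blast
    then show ?thesis using Y_summand d(2) by blast
  qed
qed

sublocale cotorsion T extT zerT pushT pullT dconf U Y W
  by (rule cotorsion)

lemma Cplus_eq: "Cplus T X Y = ext_plus"
proof (intro equalityI subsetI)
  fix A assume "A \<in> Cplus T X Y"
  then obtain f g h where d: "(f, g, h) \<in> Dist T" "Dom T f \<in> Y" "Cod T f \<in> W" "Cod T g = A"
    unfolding Cplus_def by blast
  have "Dom T g = Cod T f" using Dist_triangle[OF d(1)] by (simp add: triangle_def)
  then show "A \<in> ext_plus" using plusI_conf[OF d(3,2)] Dist_dconf[OF d(1)] d(4) by simp
next
  fix A assume A: "A \<in> ext_plus"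
  obtain w v f g h where w: "w \<in> W" "v \<in> Y" "dconf v w A f g h" using plus_conf[OF A] by blast
  note dd = dconfD[OF w(3)]
  show "A \<in> Cplus T X Y"
    unfolding Cplus_def using dd(4,7) w(1,2) Hom_Dom[OF dd(1)] Hom_Cod[OF dd(1)] Hom_Cod[OF dd(2)] by auto
qed

text \<open>\<open>minus_conf\<close> gives a triangle ending in an object of U, the definition one
  starting in X. So \<open>u\<close> is replaced by an isomorphic x[1], and the triangle is rotated
  back with its new first map obtained by fullness.\<close>

lemma Cminus_eq: "Cminus T X Y = ext_minus"
proof (intro equalityI subsetI)
  fix A assume "A \<in> Cminus T X Y"
  then obtain f g h where d: "(f, g, h) \<in> Dist T" "Dom T f \<in> X" "Cod T f = A" "Cod T g \<in> W"
    unfolding Cminus_def by blast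
  have "Dom T g = A" using Dist_triangle[OF d(1)] d(3) by (simp add: triangle_def)
  then have "dconf (Dom T f) A (Cod T g) f g h" using Dist_dconf[OF d(1)] by simp
  from minusI_conf[OF d(4) shift_in_U[OF d(2)] dconf_rotate[OF this]] show "A \<in> ext_minus" .
next
  fix A assume A: "A \<in> ext_minus"
  obtain w u f g h where w: "w \<in> W" "u \<in> U" "dconf A w u f g h" using minus_conf[OF A] by blast
  obtain x \<phi> where x: "x \<in> X" "\<phi> \<in> Hom T (sobj T x) u" "is_iso T \<phi>"
    using w(2) unfolding shifted_def isomorphic_def by blast
  obtain \<psi> where p: "\<psi> \<in> Hom T u (sobj T x)" "\<psi> \<cdot> \<phi> = Idn T (sobj T x)" "\<phi> \<cdot> \<psi> = Idn T u"
    by (rule iso_D[OF x(3,2)])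
  have d: "dconf A w (sobj T x) f (\<psi> \<cdot> g) (h \<cdot> \<phi>)" by (rule dconf_iso_end[OF w(3) p(1) x(2) p(3,2)])
  note dd = dconfD[OF d]
  obtain k where k: "k \<in> Hom T x A" "sarr T k = Neg T (h \<cdot> \<phi>)"
    by (rule S_full[OF Neg_in_Hom[OF dd(3)] X_Obj[OF x(1)] dd(5)])
  have "dconf x A w k f (\<psi> \<cdot> g)"
    by (rule dconf_rotate_back[OF k(1)]) (use d k(2) Neg_Neg[OF dd(3)] in simp)
  note kd = dconfD[OF this]
  show "A \<in> Cminus T X Y"
    unfolding Cminus_def using kd(4,6) w(1) x(1) Hom_Dom[OF kd(1)] Hom_Cod[OF kd(1)] Hom_Cod[OF kd(2)] by auto
qed

lemma under_eq: "under T X Y = Q" "under_plus T X Y = full_subcategory Q ext_plus"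
  "under_minus T X Y = full_subcategory Q ext_minus" "heart T X Y = K"
  by (simp_all add: under_def under_plus_def under_minus_def heart_def Cplus_eq Cminus_eq)

end

section \<open>Adjoints of full inclusions as reflections and coreflections\<close>

text \<open>The unit \<eta> is the transpose of an identity. Naturality turns the adjunction
  bijection into composition with \<eta>, whose bijectivity is the universal property.\<close>

lemma left_adjoint_reflects:
  fixes D :: "('o, 'm, 'x) addcat_scheme"
  assumes "category D" and S: "S \<subseteq> Obj D" and F: "is_functor D (full_subcategory D S) F"
    and ad: "adjoint D (full_subcategory D S) F id_func"
  shows "\<exists>\<eta>. (\<forall>A\<in>Obj D. category.reflects D S A (fobj F A) (\<eta> A)) \<and>
    (\<forall>A B. \<forall>f\<in>Hom D A B. farr F f \<cdot>\<^bsub>D\<^esub> \<eta> A = \<eta> B \<cdot>\<^bsub>D\<^esub> f)"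
proof -
  interpret category D by fact
  let ?S = "full_subcategory D S"
  let ?I = "id_func :: ('o, 'm, 'o, 'm) func"
  obtain \<phi> where ad1: "\<forall>A\<in>Obj D. \<forall>B\<in>Obj ?S. bij_betw (\<phi> A B) (Hom ?S (fobj F A) B) (Hom D A (fobj ?I B))"
    and ad2: "\<forall>A\<in>Obj D. \<forall>A'\<in>Obj D. \<forall>B\<in>Obj ?S. \<forall>B'\<in>Obj ?S. \<forall>a\<in>Hom D A' A. \<forall>f\<in>Hom ?S (fobj F A) B.
      \<forall>b\<in>Hom ?S B B'. \<phi> A' B' (b \<cdot>\<^bsub>?S\<^esub> f \<cdot>\<^bsub>?S\<^esub> farr F a) = farr ?I b \<cdot>\<^bsub>D\<^esub> \<phi> A B f \<cdot>\<^bsub>D\<^esub> a"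
    using ad unfolding adjoint_def by (elim conjE exE) (rule that; assumption)
  have bij: "bij_betw (\<phi> A B) (Hom ?S (fobj F A) B) (Hom D A B)" if "A \<in> Obj D" "B \<in> S" for A B
    using ad1 that S by (auto simp: id_func_def)
  have nat: "\<phi> A' B' (b \<cdot>\<^bsub>D\<^esub> f \<cdot>\<^bsub>D\<^esub> farr F a) = b \<cdot>\<^bsub>D\<^esub> \<phi> A B f \<cdot>\<^bsub>D\<^esub> a"
    if "A \<in> Obj D" "A' \<in> Obj D" "B \<in> S" "B' \<in> S" "a \<in> Hom D A' A" "f \<in> Hom ?S (fobj F A) B" "b \<in> Hom ?S B B'"
    for A A' B B' a f b
  proof -
    have "B \<in> Obj ?S" "B' \<in> Obj ?S" using that(3,4) S by auto
    from ad2[rule_format, OF that(1,2) this that(5-7)] show ?thesis by (simp add: id_func_def)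
  qed
  have FO: "fobj F A \<in> S" "fobj F A \<in> Obj D" if "A \<in> Obj D" for A
    using F that unfolding is_functor_def by auto
  have FH: "farr F f \<in> Hom (full_subcategory D S) (fobj F A) (fobj F B)" if "f \<in> Hom D A B" for A B f
    using F that Hom_Obj[OF that] unfolding is_functor_def by blast
  have FI: "farr F (Idn D A) = Idn D (fobj F A)" if "A \<in> Obj D" for A
    using F that unfolding is_functor_def by auto
  have inS: "f \<in> Hom (full_subcategory D S) A B \<longleftrightarrow> f \<in> Hom D A B" if "A \<in> S" "B \<in> S" for f A B
    using that by (simp add: Hom_full)
  define \<eta> where "\<eta> A = \<phi> A (fobj F A) (Idn D (fobj F A))" for A
  have \<eta>: "\<eta> A \<in> Hom D A (fobj F A)" if A: "A \<in> Obj D" for A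
    unfolding \<eta>_def
    by (rule bspec[OF bij_betwE[OF bij[OF A FO(1)[OF A]]]])
      (simp add: inS[OF FO(1)[OF A] FO(1)[OF A]] Idn_in_Hom[OF FO(2)[OF A]])
  have \<phi>: "\<phi> A B b = b \<cdot>\<^bsub>D\<^esub> \<eta> A" if A: "A \<in> Obj D" and B: "B \<in> S" and b: "b \<in> Hom D (fobj F A) B" for A B b
  proof -
    note i = Idn_in_Hom[OF FO(2)[OF A]]
    have "\<phi> A B (b \<cdot>\<^bsub>D\<^esub> Idn D (fobj F A) \<cdot>\<^bsub>D\<^esub> farr F (Idn D A)) = b \<cdot>\<^bsub>D\<^esub> \<eta> A \<cdot>\<^bsub>D\<^esub> Idn D A"
      unfolding \<eta>_def
      by (rule nat[OF A A FO(1)[OF A] B Idn_in_Hom[OF A]]) (simp_all add: inS FO(1)[OF A] B i b)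
    then show ?thesis
      using FI[OF A] Idn_right[OF b] Idn_right[OF Cmp_in_Hom[OF \<eta>[OF A] b]] by simp
  qed
  have "reflects S A (fobj F A) (\<eta> A)" if A: "A \<in> Obj D" for A
    unfolding reflects_def
  proof (intro conjI ballI)
    show "\<eta> A \<in> Hom D A (fobj F A)" "fobj F A \<in> S" using \<eta>[OF A] FO(1)[OF A] by auto
    fix B t assume B: "B \<in> S" and t: "t \<in> Hom D A B"
    have bj: "bij_betw (\<phi> A B) (Hom D (fobj F A) B) (Hom D A B)"
      using bij[OF A B] FO(1)[OF A] B by (simp add: Hom_full)
    have "t \<in> \<phi> A B ` Hom D (fobj F A) B" unfolding bij_betw_imp_surj_on[OF bj] by (rule t)
    then obtain s where s: "s \<in> Hom D (fobj F A) B" "\<phi> A B s = t" by (rule imageE) (rule that, simp_all)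
    show "\<exists>!s. s \<in> Hom D (fobj F A) B \<and> s \<cdot>\<^bsub>D\<^esub> \<eta> A = t"
    proof (rule ex1I[of _ s])
      show "s \<in> Hom D (fobj F A) B \<and> s \<cdot>\<^bsub>D\<^esub> \<eta> A = t" using s \<phi>[OF A B s(1)] by simp
      fix s' assume s': "s' \<in> Hom D (fobj F A) B \<and> s' \<cdot>\<^bsub>D\<^esub> \<eta> A = t"
      have "\<phi> A B s' = \<phi> A B s" using \<phi>[OF A B conjunct1[OF s']] conjunct2[OF s'] s(2) by simp
      then show "s' = s" by (rule inj_onD[OF bij_betw_imp_inj_on[OF bj] _ conjunct1[OF s'] s(1)])
    qed
  qed
  moreover have "farr F f \<cdot>\<^bsub>D\<^esub> \<eta> A = \<eta> B \<cdot>\<^bsub>D\<^esub> f" if f: "f \<in> Hom D A B" for A B f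
  proof -
    note A = Hom_Obj(1)[OF f] and B = Hom_Obj(2)[OF f]
    note i = Idn_in_Hom[OF FO(2)[OF B]]
    have Ff: "farr F f \<in> Hom D (fobj F A) (fobj F B)" using FH[OF f] inS FO(1) A B by blast
    have "\<phi> A (fobj F B) (Idn D (fobj F B) \<cdot>\<^bsub>D\<^esub> Idn D (fobj F B) \<cdot>\<^bsub>D\<^esub> farr F f) = Idn D (fobj F B) \<cdot>\<^bsub>D\<^esub> \<eta> B \<cdot>\<^bsub>D\<^esub> f"
      unfolding \<eta>_def
      by (rule nat[OF B A FO(1)[OF B] FO(1)[OF B] f]) (simp_all add: inS FO(1)[OF B] i)
    then show ?thesis
      using Idn_left[OF i] Idn_left[OF Ff] Idn_left[OF \<eta>[OF B]] \<phi>[OF A FO(1)[OF B] Ff] by simp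
  qed
  ultimately show ?thesis by blast
qed

text \<open>The bijection now runs from the large category to the subcategory, so the counit
  \<epsilon> is the preimage of an identity, and composition with \<epsilon> is the inverse of the
  bijection.\<close>

lemma right_adjoint_coreflects:
  fixes D :: "('o, 'm, 'x) addcat_scheme"
  assumes "category D" and S: "S \<subseteq> Obj D" and F: "is_functor D (full_subcategory D S) F"
    and ad: "adjoint (full_subcategory D S) D id_func F"
  shows "\<exists>\<epsilon>. (\<forall>A\<in>Obj D. category.coreflects D S A (fobj F A) (\<epsilon> A)) \<and>
    (\<forall>A B. \<forall>f\<in>Hom D A B. \<epsilon> B \<cdot>\<^bsub>D\<^esub> farr F f = f \<cdot>\<^bsub>D\<^esub> \<epsilon> A)"
proof -
  interpret category D by fact
  let ?S = "full_subcategory D S"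
  let ?I = "id_func :: ('o, 'm, 'o, 'm) func"
  obtain \<phi> where ad1: "\<forall>A\<in>Obj ?S. \<forall>B\<in>Obj D. bij_betw (\<phi> A B) (Hom D (fobj ?I A) B) (Hom ?S A (fobj F B))"
    and ad2: "\<forall>A\<in>Obj ?S. \<forall>A'\<in>Obj ?S. \<forall>B\<in>Obj D. \<forall>B'\<in>Obj D. \<forall>a\<in>Hom ?S A' A. \<forall>f\<in>Hom D (fobj ?I A) B.
      \<forall>b\<in>Hom D B B'. \<phi> A' B' (b \<cdot>\<^bsub>D\<^esub> f \<cdot>\<^bsub>D\<^esub> farr ?I a) = farr F b \<cdot>\<^bsub>?S\<^esub> \<phi> A B f \<cdot>\<^bsub>?S\<^esub> a"
    using ad unfolding adjoint_def by (elim conjE exE) (rule that; assumption)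
  have bij': "bij_betw (\<phi> A B) (Hom D A B) (Hom ?S A (fobj F B))" if "A \<in> S" "B \<in> Obj D" for A B
    using ad1 that S by (auto simp: id_func_def)
  have nat: "\<phi> A' B' (b \<cdot>\<^bsub>D\<^esub> f \<cdot>\<^bsub>D\<^esub> a) = farr F b \<cdot>\<^bsub>D\<^esub> \<phi> A B f \<cdot>\<^bsub>D\<^esub> a"
    if "A \<in> S" "A' \<in> S" "B \<in> Obj D" "B' \<in> Obj D" "a \<in> Hom ?S A' A" "f \<in> Hom D A B" "b \<in> Hom D B B'"
    for A A' B B' a f b
  proof -
    have "A \<in> Obj ?S" "A' \<in> Obj ?S" using that(1,2) S by auto
    from ad2[rule_format, OF this that(3-5) _ that(7)] that(6) show ?thesis by (simp add: id_func_def)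
  qed
  have FO: "fobj F A \<in> S" "fobj F A \<in> Obj D" if "A \<in> Obj D" for A
    using F that unfolding is_functor_def by auto
  have FI: "farr F (Idn D A) = Idn D (fobj F A)" if "A \<in> Obj D" for A
    using F that unfolding is_functor_def by auto
  have inS: "f \<in> Hom (full_subcategory D S) A B \<longleftrightarrow> f \<in> Hom D A B" if "A \<in> S" "B \<in> S" for f A B
    using that by (simp add: Hom_full)
  have FH: "farr F f \<in> Hom D (fobj F A) (fobj F B)" if "f \<in> Hom D A B" for A B f
    using F that Hom_Obj[OF that] inS FO unfolding is_functor_def by blast
  have bij: "bij_betw (\<phi> A B) (Hom D A B) (Hom D A (fobj F B))" if "A \<in> S" "B \<in> Obj D" for A B
    using bij'[OF that] that FO(1) by (simp add: Hom_full)
  define \<epsilon> where "\<epsilon> B = inv_into (Hom D (fobj F B) B) (\<phi> (fobj F B) B) (Idn D (fobj F B))" for B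
  have \<epsilon>: "\<epsilon> B \<in> Hom D (fobj F B) B" "\<phi> (fobj F B) B (\<epsilon> B) = Idn D (fobj F B)" if B: "B \<in> Obj D" for B
  proof -
    have "Idn D (fobj F B) \<in> \<phi> (fobj F B) B ` Hom D (fobj F B) B"
      unfolding bij_betw_imp_surj_on[OF bij[OF FO(1)[OF B] B]] by (rule Idn_in_Hom[OF FO(2)[OF B]])
    then show "\<epsilon> B \<in> Hom D (fobj F B) B" "\<phi> (fobj F B) B (\<epsilon> B) = Idn D (fobj F B)"
      unfolding \<epsilon>_def by (rule inv_into_into, rule f_inv_into_f)
  qed
  have \<phi>: "\<phi> A B (\<epsilon> B \<cdot>\<^bsub>D\<^esub> a) = a" if A: "A \<in> S" and B: "B \<in> Obj D" and a: "a \<in> Hom D A (fobj F B)" for A B a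
  proof -
    note i = Idn_in_Hom[OF B] and e = \<epsilon>[OF B]
    have "\<phi> A B (Idn D B \<cdot>\<^bsub>D\<^esub> \<epsilon> B \<cdot>\<^bsub>D\<^esub> a) = farr F (Idn D B) \<cdot>\<^bsub>D\<^esub> \<phi> (fobj F B) B (\<epsilon> B) \<cdot>\<^bsub>D\<^esub> a"
      by (rule nat[OF FO(1)[OF B] A B B _ e(1) i]) (simp add: inS FO(1)[OF B] A a)
    then show ?thesis
      using FI[OF B] e(2) Idn_left[OF e(1)] Idn_left[OF Idn_in_Hom[OF FO(2)[OF B]]] Idn_left[OF a] by simp
  qed
  have "coreflects S B (fobj F B) (\<epsilon> B)" if B: "B \<in> Obj D" for B
    unfolding coreflects_def
  proof (intro conjI ballI)
    show "\<epsilon> B \<in> Hom D (fobj F B) B" "fobj F B \<in> S" using \<epsilon>(1)[OF B] FO(1)[OF B] by auto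
    fix A t assume A: "A \<in> S" and t: "t \<in> Hom D A B"
    note bj = bij[OF A B]
    have s: "\<phi> A B t \<in> Hom D A (fobj F B)" by (rule bspec[OF bij_betwE[OF bj] t])
    have e: "\<epsilon> B \<cdot>\<^bsub>D\<^esub> \<phi> A B t = t"
      by (rule inj_onD[OF bij_betw_imp_inj_on[OF bj] \<phi>[OF A B s] Cmp_in_Hom[OF s \<epsilon>(1)[OF B]] t])
    show "\<exists>!s. s \<in> Hom D A (fobj F B) \<and> \<epsilon> B \<cdot>\<^bsub>D\<^esub> s = t"
    proof (rule ex1I[of _ "\<phi> A B t"])
      show "\<phi> A B t \<in> Hom D A (fobj F B) \<and> \<epsilon> B \<cdot>\<^bsub>D\<^esub> \<phi> A B t = t" using s e by blast
      fix s' assume s': "s' \<in> Hom D A (fobj F B) \<and> \<epsilon> B \<cdot>\<^bsub>D\<^esub> s' = t"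
      show "s' = \<phi> A B t" using \<phi>[OF A B conjunct1[OF s']] conjunct2[OF s'] by simp
    qed
  qed
  moreover have "\<epsilon> B \<cdot>\<^bsub>D\<^esub> farr F f = f \<cdot>\<^bsub>D\<^esub> \<epsilon> A" if f: "f \<in> Hom D A B" for A B f
  proof -
    note A = Hom_Obj(1)[OF f] and B = Hom_Obj(2)[OF f]
    note i = Idn_in_Hom[OF FO(2)[OF A]] and e = \<epsilon>[OF A] and Ff = FH[OF f]
    have "\<phi> (fobj F A) B (f \<cdot>\<^bsub>D\<^esub> \<epsilon> A \<cdot>\<^bsub>D\<^esub> Idn D (fobj F A)) = farr F f \<cdot>\<^bsub>D\<^esub> \<phi> (fobj F A) A (\<epsilon> A) \<cdot>\<^bsub>D\<^esub> Idn D (fobj F A)"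
      by (rule nat[OF FO(1)[OF A] FO(1)[OF A] A B _ e(1) f]) (simp add: inS FO(1)[OF A] i)
    then have "\<phi> (fobj F A) B (f \<cdot>\<^bsub>D\<^esub> \<epsilon> A) = farr F f"
      using Idn_right[OF Cmp_in_Hom[OF e(1) f]] e(2) Idn_right[OF Ff] by simp
    then have "\<phi> (fobj F A) B (\<epsilon> B \<cdot>\<^bsub>D\<^esub> farr F f) = \<phi> (fobj F A) B (f \<cdot>\<^bsub>D\<^esub> \<epsilon> A)"
      using \<phi>[OF FO(1)[OF A] B Ff] by simp
    then show ?thesis
      by (rule inj_onD[OF bij_betw_imp_inj_on[OF bij[OF FO(1)[OF A] B]] _ Cmp_in_Hom[OF Ff \<epsilon>(1)[OF B]] Cmp_in_Hom[OF e(1) f]])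
  qed
  ultimately show ?thesis by blast
qed

section \<open>The functor to the heart is cohomological\<close>

context torsion
begin

lemma functors_exist:
  assumes "is_tau_plus T X Y \<tau>\<^sub>p" and "is_tau_minus T X Y \<tau>\<^sub>m"
  shows "\<exists>et ep. heart_functors T extT zerT pushT pullT dconf U Y W \<tau>\<^sub>p \<tau>\<^sub>m et ep"
proof -
  interpret quot: additive_category Q by (rule Q_additive)
  have P: "is_functor Q (full_subcategory Q ext_plus) \<tau>\<^sub>p" "adjoint Q (full_subcategory Q ext_plus) \<tau>\<^sub>p id_func"
    using assms(1) unfolding is_tau_plus_def under_eq additive_functor_def by blast+
  have M: "is_functor Q (full_subcategory Q ext_minus) \<tau>\<^sub>m" "adjoint (full_subcategory Q ext_minus) Q id_func \<tau>\<^sub>m"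
    using assms(2) unfolding is_tau_minus_def under_eq additive_functor_def by blast+
  have sub: "ext_plus \<subseteq> Obj Q" "ext_minus \<subseteq> Obj Q" using plus_Obj minus_Obj by auto
  have c: "category Q" by unfold_locales
  obtain et where et: "\<And>A. A \<in> Obj Q \<Longrightarrow> quot.reflects ext_plus A (fobj \<tau>\<^sub>p A) (et A)"
    "\<And>A B f. f \<in> Hom Q A B \<Longrightarrow> farr \<tau>\<^sub>p f \<cdot>\<^bsub>Q\<^esub> et A = et B \<cdot>\<^bsub>Q\<^esub> f"
    using left_adjoint_reflects[OF c sub(1) P] by metis
  obtain ep where ep: "\<And>A. A \<in> Obj Q \<Longrightarrow> quot.coreflects ext_minus A (fobj \<tau>\<^sub>m A) (ep A)"
    "\<And>A B f. f \<in> Hom Q A B \<Longrightarrow> ep B \<cdot>\<^bsub>Q\<^esub> farr \<tau>\<^sub>m f = f \<cdot>\<^bsub>Q\<^esub> ep A"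
    using right_adjoint_coreflects[OF c sub(2) M] by metis
  have "heart_functors T extT zerT pushT pullT dconf U Y W \<tau>\<^sub>p \<tau>\<^sub>m et ep"
  proof (intro heart_functors.intro cotorsion heart_functors_axioms.intro)
    fix F A B assume F: "F \<in> Hom Q A B"
    note o = quot.Hom_Obj[OF F]
    have "farr \<tau>\<^sub>p F \<in> Hom (full_subcategory Q ext_plus) (fobj \<tau>\<^sub>p A) (fobj \<tau>\<^sub>p B)"
      using P(1) F o unfolding is_functor_def by blast
    then show "farr \<tau>\<^sub>p F \<in> Hom Q (fobj \<tau>\<^sub>p A) (fobj \<tau>\<^sub>p B)" by (simp add: Hom_full split: if_splits)
    have "farr \<tau>\<^sub>m F \<in> Hom (full_subcategory Q ext_minus) (fobj \<tau>\<^sub>m A) (fobj \<tau>\<^sub>m B)"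
      using M(1) F o unfolding is_functor_def by blast
    then show "farr \<tau>\<^sub>m F \<in> Hom Q (fobj \<tau>\<^sub>m A) (fobj \<tau>\<^sub>m B)" by (simp add: Hom_full split: if_splits)
  qed (simp_all add: et ep)
  then show ?thesis by blast
qed

lemma Q_full_functor:
  assumes "additive_functor Q (full_subcategory Q S) F"
  shows "A \<in> Obj T \<Longrightarrow> fobj F A \<in> S \<and> fobj F A \<in> Obj T"
    and "f \<in> Hom Q A B \<Longrightarrow> farr F f \<in> Hom Q (fobj F A) (fobj F B)"
    and "A \<in> Obj T \<Longrightarrow> farr F (Idn Q A) = Idn Q (fobj F A)"
    and "f \<in> Hom Q A B \<Longrightarrow> g \<in> Hom Q B D \<Longrightarrow> farr F (g \<cdot>\<^bsub>Q\<^esub> f) = farr F g \<cdot>\<^bsub>Q\<^esub> farr F f"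
    and "f \<in> Hom Q A B \<Longrightarrow> f' \<in> Hom Q A B \<Longrightarrow> farr F (Add Q f f') = Add Q (farr F f) (farr F f')"
proof -
  interpret quot: additive_category Q by (rule Q_additive)
  have F: "is_functor Q (full_subcategory Q S) F"
    and add: "\<forall>A\<in>Obj Q. \<forall>B\<in>Obj Q. \<forall>f\<in>Hom Q A B. \<forall>g\<in>Hom Q A B.
      farr F (Add Q f g) = Add (full_subcategory Q S) (farr F f) (farr F g)"
    using assms unfolding additive_functor_def by blast+
  have F1: "\<forall>A\<in>Obj Q. fobj F A \<in> Obj (full_subcategory Q S)"
    and F2: "\<forall>A\<in>Obj Q. \<forall>B\<in>Obj Q. \<forall>f\<in>Hom Q A B. farr F f \<in> Hom (full_subcategory Q S) (fobj F A) (fobj F B)"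
    and F3: "\<forall>A\<in>Obj Q. farr F (Idn Q A) = Idn (full_subcategory Q S) (fobj F A)"
    using F unfolding is_functor_def by simp_all
  show "fobj F A \<in> S \<and> fobj F A \<in> Obj T" if "A \<in> Obj T"
    using bspec[OF F1, of A] that by simp
  show "farr F f \<in> Hom Q (fobj F A) (fobj F B)" if f: "f \<in> Hom Q A B"
    using bspec[OF bspec[OF bspec[OF F2 quot.Hom_Obj(1)[OF f]] quot.Hom_Obj(2)[OF f]] f]
    by (simp add: Hom_full split: if_splits)
  show "farr F (Idn Q A) = Idn Q (fobj F A)" if "A \<in> Obj T"
    using bspec[OF F3, of A] that by simp
  show "farr F (g \<cdot>\<^bsub>Q\<^esub> f) = farr F g \<cdot>\<^bsub>Q\<^esub> farr F f" if "f \<in> Hom Q A B" "g \<in> Hom Q B D"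
    using functor_Cmp[OF F that] by simp
  show "farr F (Add Q f f') = Add Q (farr F f) (farr F f')" if f: "f \<in> Hom Q A B" "f' \<in> Hom Q A B"
    using bspec[OF bspec[OF bspec[OF bspec[OF add quot.Hom_Obj(1)[OF f(1)]] quot.Hom_Obj(2)[OF f(1)]] f(1)] f(2)]
    by simp
qed

text \<open>Each functor lands in its own full subcategory only; \<open>ob\<close> records that the
  composite lands in the heart, whose composition and addition are those of the quotient.\<close>

lemma composite_additive:
  assumes F: "additive_functor Q (full_subcategory Q S) F" and G: "additive_functor Q (full_subcategory Q R) G"
    and ob: "\<And>A. A \<in> Obj T \<Longrightarrow> fobj F (fobj G A) \<in> hrt"
  shows "additive_functor T K (F \<circ>\<^sub>F G \<circ>\<^sub>F quotient_functor T W)"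
proof -
  note f = Q_full_functor[OF F] and g = Q_full_functor[OF G]
  have o: "fobj G A \<in> Obj T" if "A \<in> Obj T" for A using g(1)[OF that] by blast
  have 1: "is_functor T K (F \<circ>\<^sub>F G \<circ>\<^sub>F quotient_functor T W)"
    unfolding is_functor_def comp_func_def quotient_functor_def func.simps o_apply
  proof (intro conjI ballI impI)
    fix A assume A: "A \<in> Obj T"
    show "fobj F (fobj G A) \<in> Obj K" using ob[OF A] f(1)[OF o[OF A]] by simp
    show "farr F (farr G (res (Idn T A))) = Idn K (fobj F (fobj G A))"
      using f(3)[OF o[OF A]] g(3)[OF A] by simp
  next
    fix A B h assume h: "A \<in> Obj T" "B \<in> Obj T" "h \<in> Hom T A B"
    show "farr F (farr G (res h)) \<in> Hom K (fobj F (fobj G A)) (fobj F (fobj G B))"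
      using f(2)[OF g(2)[OF res_in_Hom[OF h(3)]]] ob[OF h(1)] ob[OF h(2)] by (simp add: Hom_full)
  next
    fix h k assume "h \<in> Arr T" "k \<in> Arr T" "Cod T h = Dom T k"
    then have h: "h \<in> Hom T (Dom T h) (Dom T k)" and k: "k \<in> Hom T (Dom T k) (Cod T k)"
      by (simp_all add: Hom_def)
    note hQ = res_in_Hom[OF h] and kQ = res_in_Hom[OF k]
    show "farr F (farr G (res (k \<cdot> h))) = farr F (farr G (res k)) \<cdot>\<^bsub>K\<^esub> farr F (farr G (res h))"
      using res_Cmp[OF h k] g(4)[OF hQ kQ] f(4)[OF g(2)[OF hQ] g(2)[OF kQ]] by simp
  qed
  have 2: "farr F (farr G (res (Add T h k))) = Add K (farr F (farr G (res h))) (farr F (farr G (res k)))"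
    if h: "h \<in> Hom T A B" and k: "k \<in> Hom T A B" for A B h k
  proof -
    note hQ = res_in_Hom[OF h] and kQ = res_in_Hom[OF k]
    show ?thesis using res_Add[OF h k] g(5)[OF hQ kQ] f(5)[OF g(2)[OF hQ] g(2)[OF kQ]] by simp
  qed
  show ?thesis
    unfolding additive_functor_def
    using 1 2 by (simp add: comp_func_def quotient_functor_def)
qed

lemma heart_functor_cohomological:
  assumes "is_tau_plus T X Y \<tau>\<^sub>p" and "is_tau_minus T X Y \<tau>\<^sub>m"
  shows "naturally_isomorphic T K (\<tau>\<^sub>p \<circ>\<^sub>F \<tau>\<^sub>m \<circ>\<^sub>F quotient_functor T W) (\<tau>\<^sub>m \<circ>\<^sub>F \<tau>\<^sub>p \<circ>\<^sub>F quotient_functor T W)"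
    and "cohomological T K (\<tau>\<^sub>p \<circ>\<^sub>F \<tau>\<^sub>m \<circ>\<^sub>F quotient_functor T W)"
proof -
  interpret quot: additive_category Q by (rule Q_additive)
  interpret K: abelian_category K by (rule K_abelian)
  obtain et ep where hf: "heart_functors T extT zerT pushT pullT dconf U Y W \<tau>\<^sub>p \<tau>\<^sub>m et ep"
    using functors_exist[OF assms] by blast
  interpret heart_functors T extT zerT pushT pullT dconf U Y W \<tau>\<^sub>p \<tau>\<^sub>m et ep by (rule hf)
  let ?F = "\<tau>\<^sub>p \<circ>\<^sub>F \<tau>\<^sub>m \<circ>\<^sub>F quotient_functor T W" and ?G = "\<tau>\<^sub>m \<circ>\<^sub>F \<tau>\<^sub>p \<circ>\<^sub>F quotient_functor T W"
  have p: "additive_functor Q (full_subcategory Q ext_plus) \<tau>\<^sub>p"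
    using assms(1) unfolding is_tau_plus_def under_eq by blast
  have m: "additive_functor Q (full_subcategory Q ext_minus) \<tau>\<^sub>m"
    using assms(2) unfolding is_tau_minus_def under_eq by blast
  have F: "additive_functor T K ?F" by (rule composite_additive[OF p m H1o_hrt])
  have G: "additive_functor T K ?G" by (rule composite_additive[OF m p H2o_hrt])
  have obj: "fobj ?F A = H1o A" "fobj ?G A = H2o A" and arr: "farr ?F f = H1 (res f)" "farr ?G f = H2 (res f)"
    for A f by (simp_all add: comp_func_def quotient_functor_def)
  show "naturally_isomorphic T K ?F ?G"
    unfolding naturally_isomorphic_def
  proof (intro conjI exI[of _ cmpr] ballI)
    show "is_functor T K ?F" "is_functor T K ?G" using F G by (simp_all add: additive_functor_def)
    fix A assume A: "A \<in> Obj T"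
    note h = H1o_hrt[OF A] H2o_hrt[OF A]
    show cm: "cmpr A \<in> Hom K (fobj ?F A) (fobj ?G A)"
      unfolding obj using cmpr(1)[OF A] h by (simp add: Hom_full)
    obtain i where i: "i \<in> Hom Q (H2o A) (H1o A)" "i \<cdot>\<^bsub>Q\<^esub> cmpr A = Idn Q (H1o A)" "cmpr A \<cdot>\<^bsub>Q\<^esub> i = Idn Q (H2o A)"
      using cmpr_iso[OF A] unfolding is_iso_def Hom_Dom[OF cmpr(1)[OF A]] Hom_Cod[OF cmpr(1)[OF A]] by blast
    have "i \<in> Hom K (H2o A) (H1o A)" using i(1) h by (simp add: Hom_full)
    then show "is_iso K (cmpr A)"
      unfolding is_iso_def Hom_Dom[OF cm] Hom_Cod[OF cm] unfolding obj
      using Hom_Arr[OF cm] i(2,3) by (intro conjI bexI[of _ i]) simp_all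
  next
    fix f assume "f \<in> Arr T"
    note f = res_in_Hom[OF Arr_Hom[OF this]]
    show "cmpr (Cod T f) \<cdot>\<^bsub>K\<^esub> farr ?F f = farr ?G f \<cdot>\<^bsub>K\<^esub> cmpr (Dom T f)"
      unfolding arr using cmpr_nat[OF f] by simp
  qed
  show "cohomological T K ?F"
    unfolding cohomological_def
  proof (intro conjI allI impI K_abelian F)
    fix f g h assume "(f, g, h) \<in> Dist T"
    from Dist_dconf[OF this] obtain A B D where d: "dconf A B D f g h" by blast
    note dd = dconfD[OF d]
    obtain u v a a' e where a: "u \<in> U" "v \<in> Y" "dconf A v u a a' e" using ex_UV[OF dd(5)] by blast
    \<comment> \<open>The class \<open>sarr T f \<cdot> e\<close> has the form
      \<open>H1_cokernel\<close> asks for, and \<open>n' \<cdot> m = g\<close> factors H(g) through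
      H(M).\<close>
    obtain M m m' n n' where c: "dconf B M u m m' (sarr T f \<cdot> e)" "dconf v M D n n' (sarr T a \<cdot> h)" "n' \<cdot> m = g"
      using PO[OF d a(3)] by blast
    note md = dconfD[OF c(1)] and nd = dconfD[OF c(2)]
    note hA = H1o_hrt[OF dd(5)] and hB = H1o_hrt[OF dd(6)] and hD = H1o_hrt[OF dd(7)] and hM = H1o_hrt[OF md(6)]
    note Hf = H1_Hom[OF res_in_Hom[OF dd(1)]] and Hg = H1_Hom[OF res_in_Hom[OF dd(2)]]
      and Hm = H1_Hom[OF res_in_Hom[OF md(1)]] and Hn = H1_Hom[OF res_in_Hom[OF nd(2)]]
    have Kf: "H1 (res f) \<in> Hom K (H1o A) (H1o B)" and Kg: "H1 (res g) \<in> Hom K (H1o B) (H1o D)"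
      and Km: "H1 (res m) \<in> Hom K (H1o B) (H1o M)"
      using Hf Hg Hm hA hB hD hM by (simp_all add: Hom_full)
    have gm: "H1 (res g) = H1 (res n') \<cdot>\<^bsub>Q\<^esub> H1 (res m)"
      using res_Cmp[OF md(1) nd(2)] c(3) Q_full_functor(4)[OF m res_in_Hom[OF md(1)] res_in_Hom[OF nd(2)]]
        Q_full_functor(4)[OF p tm_Hom[OF res_in_Hom[OF md(1)]] tm_Hom[OF res_in_Hom[OF nd(2)]]] by simp
    have coker: "is_cokernel K (H1 (res f)) (H1 (res m))"
      unfolding is_cokernel_def Hom_Dom[OF Kf] Hom_Cod[OF Kf] Hom_Dom[OF Km] Hom_Cod[OF Km]
    proof (intro conjI ballI impI)
      show "H1 (res f) \<in> Arr K" "H1 (res m) \<in> Arr K" "H1o B = H1o B"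
        using Hom_Arr[OF Kf] Hom_Arr[OF Km] by blast+
      show "H1 (res m) \<cdot>\<^bsub>K\<^esub> H1 (res f) = Zero K (H1o A) (H1o M)"
        using H1_cokernel(1)[OF dd(1) a(3,2,1) c(1)] by simp
      fix E t assume E: "E \<in> Obj K" and t: "t \<in> Hom K (H1o B) E" and z: "t \<cdot>\<^bsub>K\<^esub> H1 (res f) = Zero K (H1o A) E"
      have tQ: "t \<in> Hom Q (H1o B) E" and Eh: "E \<in> ext_plus" "E \<in> hrt" using t E by (simp_all add: Hom_full split: if_splits)
      obtain s where s: "s \<in> Hom Q (H1o M) E" "s \<cdot>\<^bsub>Q\<^esub> H1 (res m) = t"
        using H1_cokernel(2)[OF dd(1) a(3,2,1) c(1) Eh(1) tQ] z by auto
      show "\<exists>!s. s \<in> Hom K (H1o M) E \<and> s \<cdot>\<^bsub>K\<^esub> H1 (res m) = t"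
      proof (rule ex1I[of _ s])
        show "s \<in> Hom K (H1o M) E \<and> s \<cdot>\<^bsub>K\<^esub> H1 (res m) = t" using s hM Eh(2) by (simp add: Hom_full)
        fix s' assume s': "s' \<in> Hom K (H1o M) E \<and> s' \<cdot>\<^bsub>K\<^esub> H1 (res m) = t"
        then have s'Q: "s' \<in> Hom Q (H1o M) E" and eq: "s' \<cdot>\<^bsub>Q\<^esub> H1 (res m) = s \<cdot>\<^bsub>Q\<^esub> H1 (res m)"
          using s(2) by (simp_all add: Hom_full split: if_splits)
        \<comment> \<open>Uniqueness of the factorization is \<open>H1_epi\<close> for the
          difference of two candidates.\<close>
        have "quot.Sub s' s \<cdot>\<^bsub>Q\<^esub> H1 (res m) = Zero Q (H1o B) E"
          using quot.Cmp_Sub_left[OF Hm s'Q s(1)] eq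
            quot.Sub_eq_Zero[OF quot.Cmp_in_Hom[OF Hm s(1)] quot.Cmp_in_Hom[OF Hm s(1)]] by simp
        from H1_epi[OF c(1) a(1) Eh(1) quot.Sub_in_Hom[OF s'Q s(1)] this]
        show "s' = s" using quot.Sub_eq_Zero[OF s'Q s(1)] by simp
      qed
    qed
    obtain k where k: "is_kernel K (H1 (res m)) k" using K.ex_kernel Hom_Arr[OF Km] by blast
    \<comment> \<open>\<open>H1_mono\<close> cancels \<open>H1 (res n')\<close>, so \<open>g\<close>
      and \<open>m\<close> have the same kernel in the heart; as \<open>H1 (res m)\<close> is a
      cokernel of \<open>H1 (res f)\<close>, that kernel is the image of
      \<open>H1 (res f)\<close>.\<close>
    have ker: "is_kernel K (H1 (res g)) k"
    proof -
      have k1: "k \<in> Arr K" "Cod K k = H1o B" "H1 (res m) \<cdot>\<^bsub>K\<^esub> k = Zero K (Dom K k) (H1o M)"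
        and k2: "\<And>E t. E \<in> Obj K \<Longrightarrow> t \<in> Hom K E (H1o B) \<Longrightarrow> H1 (res m) \<cdot>\<^bsub>K\<^esub> t = Zero K E (H1o M)
          \<Longrightarrow> \<exists>!u. u \<in> Hom K E (Dom K k) \<and> k \<cdot>\<^bsub>K\<^esub> u = t"
        using k unfolding is_kernel_def Hom_Dom[OF Km] Hom_Cod[OF Km] by blast+
      have kQ: "k \<in> Hom Q (Dom K k) (H1o B)" and ko: "Dom K k \<in> Obj T"
        using K.Arr_Hom[OF k1(1)] K.Dom_in_Obj[OF k1(1)] k1(2) by (simp_all add: Hom_full split: if_splits)
      show ?thesis
        unfolding is_kernel_def Hom_Dom[OF Kg] Hom_Cod[OF Kg]
      proof (intro conjI ballI impI)
        show "H1 (res g) \<in> Arr K" "k \<in> Arr K" "Cod K k = H1o B" using Hom_Arr[OF Kg] k1 by blast+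
        have "H1 (res g) \<cdot>\<^bsub>Q\<^esub> k = H1 (res n') \<cdot>\<^bsub>Q\<^esub> Zero Q (Dom K k) (H1o M)"
          unfolding gm using quot.Cmp_assoc[OF kQ Hm Hn] k1(3) by simp
        then show "H1 (res g) \<cdot>\<^bsub>K\<^esub> k = Zero K (Dom K k) (H1o D)"
          using quot.Cmp_Zero(2)[OF Hn] ko by simp
        fix E t assume E: "E \<in> Obj K" and t: "t \<in> Hom K E (H1o B)" and z: "H1 (res g) \<cdot>\<^bsub>K\<^esub> t = Zero K E (H1o D)"
        have tQ: "t \<in> Hom Q E (H1o B)" and Eh: "E \<in> ext_minus" using t E by (simp_all add: Hom_full split: if_splits)
        have "H1 (res n') \<cdot>\<^bsub>Q\<^esub> (H1 (res m) \<cdot>\<^bsub>Q\<^esub> t) = Zero Q E (H1o D)"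
          using z quot.Cmp_assoc[OF tQ Hm Hn] unfolding gm by simp
        from H1_mono[OF c(2) a(2) Eh quot.Cmp_in_Hom[OF tQ Hm] this]
        show "\<exists>!u. u \<in> Hom K E (Dom K k) \<and> k \<cdot>\<^bsub>K\<^esub> u = t" using k2[OF E t] by simp
      qed
    qed
    show "exact K (farr ?F f) (farr ?F g)"
      unfolding arr exact_def is_image_def
      using Hom_Arr[OF Kf] Hom_Arr[OF Kg] Hom_Cod[OF Kf] Hom_Dom[OF Kg] coker k ker by auto
  qed
qed

end

theorem theorem5p7:
  fixes T :: "('o, 'm) tricat"
    and X Y :: "'o set"
    and \<tau>\<^sub>p \<tau>\<^sub>m :: "('o, 'm set, 'o, 'm set) func"
  assumes "triangulated_category T"
    and "torsion_pair T X Y"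
    and "is_tau_plus T X Y \<tau>\<^sub>p"
    and "is_tau_minus T X Y \<tau>\<^sub>m"
  shows "naturally_isomorphic T (heart T X Y)
           (\<tau>\<^sub>p \<circ>\<^sub>F \<tau>\<^sub>m \<circ>\<^sub>F quotient_functor T (core T X Y))
           (\<tau>\<^sub>m \<circ>\<^sub>F \<tau>\<^sub>p \<circ>\<^sub>F quotient_functor T (core T X Y)) \<and>
         cohomological T (heart T X Y)
           (\<tau>\<^sub>p \<circ>\<^sub>F \<tau>\<^sub>m \<circ>\<^sub>F quotient_functor T (core T X Y))"
proof -
  interpret torsion T X Y
    by (intro torsion.intro torsion_axioms.intro assms(1,2))
  show ?thesis
    unfolding under_eq using heart_functor_cohomological[OF assms(3,4)] by blast
qed

end
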